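(* The map $c\mapsto \Phi_c$ is an isomorphism of $\mathbb Q$-vector spaces from the space $\mathcal J^*$ of consistent maps onto the algebraic dual $\mathcal S^*$ of $\mathcal S$ (the space of all $\mathbb Q$-linear maps $\mathcal S\to\mathbb Q$).
   Context: Let $\overline{\mathbb Q}$ be an algebraic closure of $\mathbb Q$, $A$ the ring of algebraic integers in $\overline{\mathbb Q}$, and $\mathcal S=\overline{\mathbb Q}^\times/A^\times$, regarded as a $\mathbb Q$-vector space with addition $(\alpha,\beta)\mapsto\alpha\beta$ and scalar multiplication $(r,\alpha)\mapsto\alpha^r$. For a number field $K$ and a non-Archimedean place $v$ of $K$, let $p_v$ be the rational prime below $v$, $K_v$ the completion, and $\|\cdot\|_v$ the unique extension to $K_v$ of the usual $p_v$-adic absolute value on $\mathbb Q_{p_v}$. Let $\mathcal H_K$ be the image of $K^\times$ in $\mathcal S$ and $\mathcal S_K=\{\alpha\in\mathcal S:\alpha^n\in\mathcal H_K\text{ for some }n\in\mathbb N\}$; for $\alpha\in\mathcal S_K$ set $\|\alpha\|_v=\|\alpha^n\|_v^{1/n}$ with $n\ge1$ such that $\alpha^n\in\mathcal H_K$ (well defined). Let $\mathcal J=\{(K,v): K\text{ a number field}, v \text{ a non-Archimedean place of }K\}$. A map $c:\mathcal J\to\mathbb Q$ is consistent if $c(K,v)=\sum_{w\mid v}c(L,w)$ for all number fields $K$, all finite extensions $L/K$, and all non-Archimedean places $v$ of $K$, the sum over places $w$ of $L$ dividing $v$. The consistent maps form a $\mathbb Q$-vector space $\mathcal J^*$ under pointwise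 operations. For $c\in\mathcal J^*$ define $\Phi_c:\mathcal S\to\mathbb Q$ by $\Phi_c(\alpha)=\sum_{v}\frac{c(K,v)}{\log p_v}\log\|\alpha\|_v$, the sum over non-Archimedean places $v$ of any number field $K$ with $\alpha\in\mathcal S_K$ (this is independent of $K$ and $\mathbb Q$-linear). *)

theory Defs
  imports "HOL-Computational_Algebra.Computational_Algebra"
begin

text \<open>The algebraic closure of Q is modelled as the algebraic numbers inside the complex numbers.\<close>

definition nz_alg :: "complex \<Rightarrow> bool" where
  "nz_alg x \<longleftrightarrow> algebraic x \<and> x \<noteq> 0"

definition alg_int :: "complex \<Rightarrow> bool" where
  "alg_int x \<longleftrightarrow> (\<exists>p :: complex poly. lead_coeff p = 1 \<and> (\<forall>i. coeff p i \<in> \<int>) \<and> poly p x = 0)"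

definition alg_unit :: "complex \<Rightarrow> bool" where
  "alg_unit u \<longleftrightarrow> u \<noteq> 0 \<and> alg_int u \<and> alg_int (1 / u)"

definition number_field :: "complex set \<Rightarrow> bool" where
  "number_field K \<longleftrightarrow>
     0 \<in> K \<and> 1 \<in> K \<and>
     (\<forall>x\<in>K. \<forall>y\<in>K. x + y \<in> K \<and> x - y \<in> K \<and> x * y \<in> K) \<and>
     (\<forall>x\<in>K. x \<noteq> 0 \<longrightarrow> inverse x \<in> K) \<and>
     (\<exists>n (b :: nat \<Rightarrow> complex). K \<subseteq> {\<Sum>i<n. of_rat (q i) * b i | q. True})"

definition padic_abs :: "nat \<Rightarrow> rat \<Rightarrow> real" where
  "padic_abs p q = (if q = 0 then 0 else
     (let (a, b) = quotient_of q in
       real p powr (- (real (multiplicity (int p) a) - real (multiplicity (int p) b)))))"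

text \<open>A non-Archimedean place v of K, represented by its normalised absolute value
  (the restriction to K of the unique extension of the p-adic absolute value to K_v);
  it is set to 0 outside K so that it is determined by its values on K.\<close>

definition place :: "complex set \<Rightarrow> (complex \<Rightarrow> real) \<Rightarrow> bool" where
  "place K v \<longleftrightarrow>
     (\<forall>x. x \<notin> K \<longrightarrow> v x = 0) \<and>
     (\<forall>x\<in>K. v x \<ge> 0 \<and> (v x = 0 \<longleftrightarrow> x = 0)) \<and>
     (\<forall>x\<in>K. \<forall>y\<in>K. v (x * y) = v x * v y) \<and>
     (\<forall>x\<in>K. \<forall>y\<in>K. v (x + y) \<le> max (v x) (v y)) \<and>
     (\<exists>p. prime p \<and> (\<forall>q. v (of_rat q) = padic_abs p q))"

definition place_prime :: "(complex \<Rightarrow> real) \<Rightarrow> nat" where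
  "place_prime v = (THE p. prime p \<and> v (of_nat p) < 1)"

definition J :: "(complex set \<times> (complex \<Rightarrow> real)) set" where
  "J = {(K, v). number_field K \<and> place K v}"

definition consistent :: "(complex set \<times> (complex \<Rightarrow> real) \<Rightarrow> rat) \<Rightarrow> bool" where
  "consistent c \<longleftrightarrow>
     (\<forall>K L v. number_field K \<and> number_field L \<and> K \<subseteq> L \<and> place K v \<longrightarrow>
        c (K, v) = (\<Sum>w\<in>{w. place L w \<and> (\<forall>x\<in>K. w x = v x)}. c (L, w)))"

definition Jstar :: "(complex set \<times> (complex \<Rightarrow> real) \<Rightarrow> rat) set" where
  "Jstar = {c. consistent c \<and> (\<forall>x. x \<notin> J \<longrightarrow> c x = 0)}"

text \<open>Phi_c, computed with a number field K containing alpha (so n = 1);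
  the sum runs over the (finitely many) places where the term is nonzero.\<close>

definition Phi_real :: "(complex set \<times> (complex \<Rightarrow> real) \<Rightarrow> rat) \<Rightarrow> complex \<Rightarrow> real" where
  "Phi_real c \<alpha> = (let K = (SOME K. number_field K \<and> \<alpha> \<in> K) in
     (\<Sum>v\<in>{v. place K v \<and> v \<alpha> \<noteq> 1}.
        real_of_rat (c (K, v)) / ln (real (place_prime v)) * ln (v \<alpha>)))"

definition Phi :: "(complex set \<times> (complex \<Rightarrow> real) \<Rightarrow> rat) \<Rightarrow> complex \<Rightarrow> rat" where
  "Phi c \<alpha> = (if nz_alg \<alpha> then (THE q. real_of_rat q = Phi_real c \<alpha>) else 0)"

text \<open>The algebraic dual S^* of S = (nonzero algebraic numbers)/(algebraic integer units):
  Q-linear maps S \<rightarrow> Q, represented as functions on the nonzero algebraic numbers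
  constant on unit classes (extended by 0 elsewhere). Scalar multiplication by r = m/n
  sends the class of alpha to the class of any beta with beta^n = alpha^m.\<close>

definition Sstar :: "(complex \<Rightarrow> rat) set" where
  "Sstar = {\<phi>.
     (\<forall>x. \<not> nz_alg x \<longrightarrow> \<phi> x = 0) \<and>
     (\<forall>u. alg_unit u \<longrightarrow> \<phi> u = 0) \<and>
     (\<forall>x y. nz_alg x \<and> nz_alg y \<longrightarrow> \<phi> (x * y) = \<phi> x + \<phi> y) \<and>
     (\<forall>\<alpha> \<beta> (m :: int) (n :: nat). nz_alg \<alpha> \<and> nz_alg \<beta> \<and> n > 0 \<and> \<beta> ^ n = \<alpha> powi m \<longrightarrow>
        \<phi> \<beta> = of_int m / of_nat n * \<phi> \<alpha>)}"

end

theory Submission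
  imports Defs "Jordan_Normal_Form.Determinant"
begin

text \<open>Everything rests on three facts about a number field \<open>K\<close>. A nonzero element has absolute value
  1 at almost all places. An element that has absolute value at most 1 at every place is an algebraic
  integer: otherwise a subring of \<open>K\<close> maximal among those containing \<open>1/x\<close> but not \<open>x\<close> is
  a valuation ring, and it induces a place where \<open>x\<close> is large. Finally, for every place \<open>v\<close> some
  \<open>a\<close> in \<open>K\<close> is a non-unit at \<open>v\<close> and a unit at all other places; this is where a
  norm and Hurwitz' pigeonhole argument enter.

  The isolating element at \<open>v\<close> recovers \<open>c (K, v)\<close> from \<open>Phi c\<close>, which gives injectivity. Conversely
  a functional on \<open>S\<close> prescribes \<open>c (K, v)\<close> by its value there, and since up to
  units and integral powers every element is a product of isolating elements, these \<open>c\<close> are consistent and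
  represent the functional.\<close>

section \<open>Number fields as rational vector spaces\<close>

text \<open>The recurring tool is linear algebra over the rationals. In a field spanned by
  \<open>B\<close>, the first \<open>card B + 1\<close> powers of an element satisfy a rational
  relation, and in a vanishing sum two terms have the same value at a given place. So a bounded
  positive power of each nonzero element is an integral power of the residue prime up to a local
  unit. This turns valuation rings into real-valued places without completions, and it makes
  logarithms to base p rational: \<open>Phi\<close> is therefore rational-valued, and exponents can
  be matched exactly by integral powers. The obstacle is the isolating element. With a finite class
  group it would generate a power of the prime ideal at \<open>v\<close>; here an ideal is principal
  only up to a factor \<open>fact M\<close>. What saves the argument is that \<open>M\<close> is the
  same for all ideals, so it controls an infinite family of them at once. \<open>Phi_real\<close>
  picks its field arbitrarily. Consistency allows passing from a field to a larger one, and two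
  fields are compared through their intersection.\<close>

interpretation qv: vector_space "\<lambda>(q::rat) (x::complex). of_rat q * x"
  by unfold_locales (auto simp: algebra_simps of_rat_add of_rat_mult)

definition subring :: "complex set \<Rightarrow> bool" where
  "subring R \<longleftrightarrow> 0 \<in> R \<and> 1 \<in> R \<and> (\<forall>x\<in>R. \<forall>y\<in>R. x + y \<in> R \<and> x - y \<in> R \<and> x * y \<in> R)"

lemma subringD:
  assumes "subring R"
  shows "0 \<in> R" "1 \<in> R" "x \<in> R \<Longrightarrow> y \<in> R \<Longrightarrow> x + y \<in> R" "x \<in> R \<Longrightarrow> y \<in> R \<Longrightarrow> x - y \<in> R"
    "x \<in> R \<Longrightarrow> y \<in> R \<Longrightarrow> x * y \<in> R"
  using assms by (auto simp: subring_def)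

lemma subring_uminus: "subring R \<Longrightarrow> x \<in> R \<Longrightarrow> - x \<in> R"
  using subringD(1)[of R] subringD(4)[of R 0 x] by simp

lemma subring_sum: "subring R \<Longrightarrow> (\<And>i. i \<in> I \<Longrightarrow> f i \<in> R) \<Longrightarrow> sum f I \<in> R"
  by (induction I rule: infinite_finite_induct) (auto simp: subringD)

lemma subring_power: "subring R \<Longrightarrow> x \<in> R \<Longrightarrow> x ^ n \<in> R"
  by (induction n) (auto simp: subringD)

lemma subring_of_nat: "subring R \<Longrightarrow> of_nat n \<in> R"
  by (induction n) (auto simp: subringD)

lemma subring_of_int: "subring R \<Longrightarrow> of_int n \<in> R"
  by (cases n) (auto intro!: subring_of_nat subring_uminus subringD simp del: of_nat_Suc)

lemma number_field_subring: "number_field K \<Longrightarrow> subring K"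
  by (auto simp: number_field_def subring_def)

lemma number_field_inverse: "number_field K \<Longrightarrow> x \<in> K \<Longrightarrow> inverse x \<in> K"
  by (cases "x = 0") (auto simp: number_field_def)

lemma number_field_divide: "number_field K \<Longrightarrow> x \<in> K \<Longrightarrow> y \<in> K \<Longrightarrow> x / y \<in> K"
  unfolding divide_inverse by (intro subringD number_field_subring number_field_inverse)

lemma number_field_of_rat: "number_field K \<Longrightarrow> of_rat q \<in> K"
  by (cases q) (auto simp: of_rat_rat intro: number_field_divide subring_of_int number_field_subring)

lemma number_field_powi: "number_field K \<Longrightarrow> x \<in> K \<Longrightarrow> x powi k \<in> K"
  by (auto simp: power_int_def intro!: subring_power number_field_subring number_field_inverse)

lemmas number_fieldD =
  subringD[OF number_field_subring] subring_sum[OF number_field_subring]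
  subring_power[OF number_field_subring]
  subring_of_nat[OF number_field_subring] subring_of_int[OF number_field_subring]
  subring_uminus[OF number_field_subring]
  number_field_inverse number_field_divide number_field_of_rat number_field_powi

lemma number_field_finite_span:
  assumes "number_field K"
  obtains B where "finite B" "K \<subseteq> qv.span B"
proof -
  from assms obtain n and b :: "nat \<Rightarrow> complex"
    where K: "K \<subseteq> {\<Sum>i<n. of_rat (q i) * b i | q. True}" unfolding number_field_def by auto
  have "K \<subseteq> qv.span (b ` {..<n})"
    using K by (fastforce intro!: qv.span_sum qv.span_scale intro: qv.span_base)
  then show thesis using that[of "b ` {..<n}"] by simp
qed

text \<open>Stated for an indexed family rather than a set because powers of an element may
  coincide; a repetition \<open>f i = f j\<close> yields the relation with coefficients 1 and
  -1.\<close>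

lemma rational_relation:
  fixes f :: "'i \<Rightarrow> complex"
  assumes B: "finite B" "\<And>i. i \<in> I \<Longrightarrow> f i \<in> qv.span B" and I: "finite I" "card B < card I"
  obtains q :: "'i \<Rightarrow> rat" where "\<exists>i\<in>I. q i \<noteq> 0" "(\<Sum>i\<in>I. of_rat (q i) * f i) = 0"
proof (cases "inj_on f I")
  case True
  have "qv.dependent (f ` I)"
  proof (rule ccontr)
    assume "qv.independent (f ` I)"
    then have "card (f ` I) \<le> card B" using qv.independent_span_bound[of B "f ` I"] B by auto
    then show False using I card_image[OF True] by simp
  qed
  then obtain u where u: "\<exists>v\<in>f ` I. u v \<noteq> 0" "(\<Sum>v\<in>f ` I. of_rat (u v) * v) = 0"
    using qv.dependent_finite[of "f ` I"] I by auto
  show thesis by (rule that[of "\<lambda>i. u (f i)"]) (use u True in \<open>auto simp: sum.reindex\<close>)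
next
  case False
  then obtain i j where ij: "i \<in> I" "j \<in> I" "i \<noteq> j" "f i = f j" by (auto simp: inj_on_def)
  define q where "q = (\<lambda>k. if k = i then 1 else if k = j then -1 else (0::rat))"
  have "(\<Sum>k\<in>I. of_rat (q k) * f k) = (\<Sum>k\<in>{i,j}. of_rat (q k) * f k)"
    by (rule sum.mono_neutral_right) (use I ij in \<open>auto simp: q_def\<close>)
  also have "\<dots> = 0" using ij by (simp add: q_def of_rat_minus)
  finally show thesis using that[of q] ij(1) by (force simp: q_def)
qed

text \<open>The degree bound \<open>card B\<close> does not depend on \<open>x\<close>. This
  uniformity later bounds the denominators of all exponents at a place.\<close>

lemma power_relation:
  assumes "finite B" "subring R" "R \<subseteq> qv.span B" "x \<in> R"
  obtains q :: "nat \<Rightarrow> rat" where "\<exists>i\<le>card B. q i \<noteq> 0" "(\<Sum>i\<le>card B. of_rat (q i) * x ^ i) = 0"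
proof -
  have "\<And>i. i \<in> {..card B} \<Longrightarrow> x ^ i \<in> qv.span B"
    using assms subring_power by blast
  from rational_relation[where I="{..card B}" and f="\<lambda>i. x ^ i", OF assms(1) this] obtain q :: "nat \<Rightarrow> rat"
    where "\<exists>i\<in>{..card B}. q i \<noteq> 0" "(\<Sum>i\<le>card B. of_rat (q i) * x ^ i) = 0" by auto
  then show thesis using that by auto
qed

lemma algebraic_of_relation:
  assumes "i \<le> d" "q i \<noteq> 0" "(\<Sum>i\<le>d. of_rat (q i) * x ^ i) = (0::complex)"
  shows "algebraic x"
proof -
  define p where "p = (\<Sum>i\<le>d. monom (of_rat (q i) :: complex) i)"
  have c: "coeff p j = (if j \<le> d then of_rat (q j) else 0)" for j
    by (simp add: p_def coeff_sum sum.delta)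
  show ?thesis
  proof (rule algebraicI')
    show "coeff p j \<in> \<rat>" for j by (simp add: c)
    show "p \<noteq> 0" using c[of i] assms by auto
    show "poly p x = 0" using assms(3) by (simp add: p_def poly_sum poly_monom)
  qed
qed

lemma relation_of_algebraic:
  assumes "algebraic (x::complex)"
  obtains d and q :: "nat \<Rightarrow> rat" where "q d \<noteq> 0" "(\<Sum>i\<le>d. of_rat (q i) * x ^ i) = 0"
proof -
  from assms obtain p where p: "\<And>i. coeff p i \<in> \<int>" "p \<noteq> 0" "poly p x = 0"
    by (elim algebraicE) blast
  then have "\<forall>i. \<exists>z::int. coeff p i = of_int z" by (metis Ints_cases)
  then obtain z :: "nat \<Rightarrow> int" where z: "\<And>i. coeff p i = of_int (z i)" by metis
  show thesis
  proof (rule that[of "\<lambda>i. of_int (z i)" "degree p"])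
    show "(of_int (z (degree p)) :: rat) \<noteq> 0" using z[of "degree p"] p(2) by auto
    show "(\<Sum>i\<le>degree p. of_rat (of_int (z i)) * x ^ i) = 0"
      using p(3) by (simp add: poly_altdef z)
  qed
qed

lemma number_field_algebraic: "number_field K \<Longrightarrow> x \<in> K \<Longrightarrow> algebraic x"
  by (metis algebraic_of_relation number_field_finite_span number_field_subring power_relation)

text \<open>Cancelling the lowest occurring power of \<open>x\<close> in a rational relation leaves
  a nonzero constant term, which exhibits \<open>inverse x\<close> as a rational polynomial in
  \<open>x\<close>.\<close>

lemma finite_span_subring_number_field:
  assumes R: "subring R" and sub: "qv.subspace R" and B: "finite B" "R \<subseteq> qv.span B"
  shows "number_field R"
  unfolding number_field_def
proof (intro conjI)
  show "\<exists>n (b :: nat \<Rightarrow> complex). R \<subseteq> {\<Sum>i<n. of_rat (q i) * b i | q. True}"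
  proof -
    obtain b :: "nat \<Rightarrow> complex" where b: "bij_betw b {..<card B} B"
      using ex_bij_betw_nat_finite[OF B(1)] by (auto simp: atLeast0LessThan)
    have "(\<Sum>v\<in>B. of_rat (u v) * v) = (\<Sum>i<card B. of_rat (u (b i)) * b i)" for u :: "complex \<Rightarrow> rat"
      using sum.reindex_bij_betw[OF b, of "\<lambda>v. of_rat (u v) * v"] by simp
    then have "R \<subseteq> {\<Sum>i<card B. of_rat (q i) * b i | q. True}"
      using B by (fastforce simp: qv.span_finite)
    then show ?thesis by blast
  qed
  show "\<forall>x\<in>R. x \<noteq> 0 \<longrightarrow> inverse x \<in> R"
  proof (intro ballI impI)
    fix x assume x: "x \<in> R" "x \<noteq> 0"
    obtain q where q: "\<exists>i\<le>card B. q i \<noteq> 0" "(\<Sum>i\<le>card B. of_rat (q i) * x ^ i) = 0"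
      using power_relation[OF B(1) R B(2) x(1)] by blast
    define m where "m = (LEAST i. q i \<noteq> 0)"
    have m: "q m \<noteq> 0" "m \<le> card B" "\<And>i. i < m \<Longrightarrow> q i = 0"
      using q(1) LeastI_ex[of "\<lambda>i. q i \<noteq> 0"] Least_le[of "\<lambda>i. q i \<noteq> 0"] not_less_Least[of _ "\<lambda>i. q i \<noteq> 0"]
      unfolding m_def by (blast, meson order_trans, blast)
    have "0 = (\<Sum>i\<in>{m..card B}. of_rat (q i) * x ^ i)"
      unfolding q(2)[symmetric] by (rule sum.mono_neutral_right) (use m in \<open>auto simp: not_le\<close>)
    also have "\<dots> = of_rat (q m) * x ^ m + (\<Sum>i\<in>{Suc m..card B}. of_rat (q i) * x ^ i)"
      using m(2) by (simp add: sum.atLeast_Suc_atMost)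
    also have "(\<Sum>i\<in>{Suc m..card B}. of_rat (q i) * x ^ i)
        = x ^ Suc m * (\<Sum>i\<in>{Suc m..card B}. of_rat (q i) * x ^ (i - Suc m))"
      unfolding sum_distrib_left
      by (rule sum.cong) (auto simp: power_add[symmetric] simp del: power_Suc)
    finally have "x ^ m * (of_rat (q m) + x * (\<Sum>i\<in>{Suc m..card B}. of_rat (q i) * x ^ (i - Suc m))) = 0"
      by (simp add: algebra_simps)
    then have "of_rat (q m) + x * (\<Sum>i\<in>{Suc m..card B}. of_rat (q i) * x ^ (i - Suc m)) = 0"
      using x by simp
    then have s: "(\<Sum>i\<in>{Suc m..card B}. of_rat (q i) * x ^ (i - Suc m)) = - of_rat (q m) / x"
      using x by (simp add: eq_divide_eq add_eq_0_iff2 mult.commute)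
    have "inverse x = of_rat (- inverse (q m)) * (\<Sum>i\<in>{Suc m..card B}. of_rat (q i) * x ^ (i - Suc m))"
      unfolding s using x m(1) by (simp add: of_rat_minus of_rat_inverse divide_inverse)
    also have "\<dots> \<in> R"
      by (intro qv.subspace_scale[OF sub] qv.subspace_sum[OF sub] subring_power R x)
    finally show "inverse x \<in> R" .
  qed
qed (use R in \<open>auto simp: subring_def\<close>)

section \<open>Number fields containing given algebraic numbers\<close>

lemma algebraic_power_span:
  assumes "algebraic x"
  obtains d where "\<And>i. x ^ i \<in> qv.span ((\<lambda>i. x ^ i) ` {..<d})"
proof -
  obtain d and q :: "nat \<Rightarrow> rat" where q: "q d \<noteq> 0" "(\<Sum>i\<le>d. of_rat (q i) * x ^ i) = 0"
    using relation_of_algebraic[OF assms] by metis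
  let ?S = "qv.span ((\<lambda>i. x ^ i) ` {..<d})"
  have "x ^ i \<in> ?S" for i
  proof (induction i rule: less_induct)
    case (less i)
    show ?case
    proof (cases "i < d")
      case True
      then show ?thesis by (intro qv.span_base) auto
    next
      case False
      \<comment> \<open>The relation rewrites \<open>x ^ d\<close> through lower powers; after
        multiplication by \<open>x ^ (i - d)\<close> every exponent is below \<open>i\<close>, as
        the induction requires.\<close>
      have "of_rat (q d) * x ^ d = - (\<Sum>j<d. of_rat (q j) * x ^ j)"
        using q(2) by (simp add: lessThan_Suc_atMost[symmetric] add_eq_0_iff)
      then have "x ^ d = of_rat (- inverse (q d)) * (\<Sum>j<d. of_rat (q j) * x ^ j)"
        using q(1) by (simp add: of_rat_minus of_rat_inverse) (simp add: field_simps)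
      then have "x ^ i = of_rat (- inverse (q d)) * (\<Sum>j<d. of_rat (q j) * x ^ j) * x ^ (i - d)"
        using False by (metis le_add_diff_inverse not_less power_add)
      also have "\<dots> = of_rat (- inverse (q d)) * (\<Sum>j<d. of_rat (q j) * x ^ (j + (i - d)))"
        by (simp add: sum_distrib_right sum_distrib_left power_add mult_ac)
      also have "\<dots> \<in> ?S"
        using False by (intro qv.span_scale qv.span_sum less.IH) auto
      finally show ?thesis .
    qed
  qed
  then show thesis using that by blast
qed

lemma span_mult:
  assumes "x \<in> qv.span A" "y \<in> qv.span B"
  shows "x * y \<in> qv.span ((\<lambda>(a,b). a * b) ` (A \<times> B))"
proof -
  obtain s r t u where s: "finite s" "s \<subseteq> A" "x = (\<Sum>a\<in>s. of_rat (r a) * a)"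
    and t: "finite t" "t \<subseteq> B" "y = (\<Sum>b\<in>t. of_rat (u b) * b)"
    using assms unfolding qv.span_explicit by blast
  have "x * y = (\<Sum>a\<in>s. \<Sum>b\<in>t. of_rat (r a * u b) * (a * b))"
    unfolding s(3) t(3) sum_product by (simp add: of_rat_mult mult_ac)
  also have "\<dots> \<in> qv.span ((\<lambda>(a,b). a * b) ` (A \<times> B))"
    using s t by (intro qv.span_sum qv.span_scale qv.span_base) auto
  finally show ?thesis .
qed

text \<open>The products of powers of \<open>x\<close> and \<open>y\<close> span a ring, and
  reducing the exponents below \<open>d\<close> and \<open>e\<close> shows that finitely many
  products suffice. Two elements are treated at once because the conditions in \<open>Sstar\<close>
  relate two algebraic numbers.\<close>

lemma algebraic_pair_number_field:
  assumes "algebraic x" "algebraic y"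
  obtains K where "number_field K" "x \<in> K" "y \<in> K"
proof -
  obtain d where d: "\<And>i. x ^ i \<in> qv.span ((\<lambda>i. x ^ i) ` {..<d})" using algebraic_power_span[OF assms(1)] by blast
  obtain e where e: "\<And>i. y ^ i \<in> qv.span ((\<lambda>i. y ^ i) ` {..<e})" using algebraic_power_span[OF assms(2)] by blast
  define S where "S = (\<lambda>(i,j). x ^ i * y ^ j) ` UNIV"
  have mem: "x ^ i * y ^ j \<in> qv.span S" for i j by (intro qv.span_base) (auto simp: S_def)
  have "(\<lambda>(a,b). a * b) ` (S \<times> S) \<subseteq> S"
  proof clarsimp
    fix a b assume "a \<in> S" "b \<in> S"
    then obtain i j k l where "a = x ^ i * y ^ j" "b = x ^ k * y ^ l" by (auto simp: S_def)
    then have "a * b = x ^ (i + k) * y ^ (j + l)" by (simp add: power_add mult_ac)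
    then show "a * b \<in> S" by (auto simp: S_def)
  qed
  then have R: "subring (qv.span S)"
    unfolding subring_def using span_mult qv.span_mono mem[of 0 0]
    by (auto simp: qv.span_zero qv.span_add qv.span_diff) blast
  let ?B = "(\<lambda>(a,b). a * b) ` (((\<lambda>i. x ^ i) ` {..<d}) \<times> ((\<lambda>i. y ^ i) ` {..<e}))"
  have "S \<subseteq> qv.span ?B" using span_mult[OF d e] by (auto simp: S_def)
  then have "qv.span S \<subseteq> qv.span ?B" by (simp add: qv.span_minimal)
  then have "number_field (qv.span S)"
    by (intro finite_span_subring_number_field[OF R, of ?B]) auto
  then show thesis using that mem[of 1 0] mem[of 0 1] by auto
qed

section \<open>Valuation rings\<close>

definition valuation_ring :: "complex set \<Rightarrow> complex set \<Rightarrow> bool" where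
  "valuation_ring K V \<longleftrightarrow> subring V \<and> V \<subseteq> K \<and> (\<forall>z\<in>K. z \<in> V \<or> inverse z \<in> V)"

definition ring_unit :: "complex set \<Rightarrow> complex \<Rightarrow> bool" where
  "ring_unit V z \<longleftrightarrow> z \<noteq> 0 \<and> z \<in> V \<and> inverse z \<in> V"

lemma ring_unit_mult: "subring V \<Longrightarrow> ring_unit V x \<Longrightarrow> ring_unit V y \<Longrightarrow> ring_unit V (x * y)"
  by (auto simp: ring_unit_def subringD)

lemma ring_unit_inverse: "ring_unit V x \<Longrightarrow> ring_unit V (inverse x)"
  by (auto simp: ring_unit_def)

lemma ring_unit_divide: "subring V \<Longrightarrow> ring_unit V x \<Longrightarrow> ring_unit V y \<Longrightarrow> ring_unit V (x / y)"
  by (simp add: divide_inverse ring_unit_mult ring_unit_inverse)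

lemma ring_unit_power: "subring V \<Longrightarrow> ring_unit V x \<Longrightarrow> ring_unit V (x ^ n)"
  by (auto simp: ring_unit_def subring_power power_inverse[symmetric])

text \<open>One of \<open>a / b\<close>, \<open>b / a\<close> lies in \<open>V\<close>. If
  \<open>x / y\<close> lies in \<open>V\<close> and \<open>x + y\<close> is a unit, then
  \<open>inverse y = (1 + x / y) * inverse (x + y)\<close> is in \<open>V\<close> and
  \<open>y\<close> would be a unit.\<close>

lemma nonunit_add:
  assumes V: "valuation_ring K V" and K: "number_field K"
    and a: "a \<in> V" "\<not> ring_unit V a" and b: "b \<in> V" "\<not> ring_unit V b"
  shows "\<not> ring_unit V (a + b)"
proof
  assume u: "ring_unit V (a + b)"
  have R: "subring V" and VK: "V \<subseteq> K" using V by (auto simp: valuation_ring_def)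
  have *: False if "x \<in> V" "\<not> ring_unit V x" "y \<in> V" "\<not> ring_unit V y" "x / y \<in> V" "ring_unit V (x + y)" "y \<noteq> 0"
    for x y
  proof -
    have "inverse y = (1 + x / y) * inverse (x + y)"
      using that by (auto simp: field_simps ring_unit_def)
    also have "\<dots> \<in> V" using that by (auto simp: ring_unit_def intro!: subringD R)
    finally show False using that by (auto simp: ring_unit_def)
  qed
  consider "a = 0" | "b = 0" | "a \<noteq> 0" "b \<noteq> 0" by blast
  then show False
  proof cases
    case 3
    have "a / b \<in> K" using a b VK K by (auto intro: number_fieldD)
    then have "a / b \<in> V \<or> b / a \<in> V" using V unfolding valuation_ring_def by force
    then show False using *[of a b] *[of b a] a b u 3 by (auto simp: add.commute)
  qed (use a b u in auto)
qed

lemma nonunit_sum: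
  assumes V: "valuation_ring K V" and K: "number_field K"
    and "finite I" "\<And>i. i \<in> I \<Longrightarrow> f i \<in> V \<and> \<not> ring_unit V (f i)"
  shows "sum f I \<in> V \<and> \<not> ring_unit V (sum f I)"
  using assms(3,4)
proof (induction I rule: finite_induct)
  case empty
  then show ?case using V by (auto simp: valuation_ring_def ring_unit_def subringD)
next
  case (insert i I)
  then show ?case using nonunit_add[OF V K, of "f i" "sum f I"] V
    by (auto simp: valuation_ring_def subringD)
qed

text \<open>Divisibility in \<open>V\<close> is a total preorder on the nonzero elements of
  \<open>K\<close>, so a finite family has a member dividing all the others.\<close>

lemma dominant_term:
  assumes V: "valuation_ring K V" and K: "number_field K" and "finite I" "I \<noteq> {}"
    and "\<And>i. i \<in> I \<Longrightarrow> f i \<in> K \<and> f i \<noteq> 0"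
  shows "\<exists>i\<in>I. \<forall>j\<in>I. f j / f i \<in> V"
  using assms(3-)
proof (induction I rule: finite_ne_induct)
  case (singleton i)
  then show ?case using V by (auto simp: valuation_ring_def subringD)
next
  case (insert k I)
  have R: "subring V" using V by (auto simp: valuation_ring_def)
  from insert obtain i where i: "i \<in> I" "\<forall>j\<in>I. f j / f i \<in> V" by auto
  have "f k / f i \<in> K" using insert.prems i K by (auto intro: number_fieldD)
  then have "f k / f i \<in> V \<or> f i / f k \<in> V" using V unfolding valuation_ring_def by force
  then show ?case
  proof
    assume "f k / f i \<in> V"
    then show ?thesis using i by auto
  next
    assume a: "f i / f k \<in> V"
    have "f j / f k \<in> V" if "j \<in> I" for j
    proof -
      have "f j / f k = (f j / f i) * (f i / f k)" using insert.prems i by (auto simp: field_simps)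
      then show ?thesis using a i that subringD(5)[OF R] by metis
    qed
    then show ?thesis using insert.prems subringD(2)[OF R] by (intro bexI[of _ k]) auto
  qed
qed

text \<open>Divide by a dominant term: the other quotients sum to -1, which is a unit, while a sum
  of nonunits is a nonunit. This is the ultrametric principle that the maximum in a vanishing sum is
  attained twice, phrased without an absolute value.\<close>

lemma zero_sum_two_associated:
  assumes V: "valuation_ring K V" and K: "number_field K" and I: "finite I" "i \<in> I" "f i \<noteq> 0"
    and f: "\<And>i. i \<in> I \<Longrightarrow> f i \<in> K" and 0: "sum f I = 0"
  obtains i j where "i \<in> I" "j \<in> I" "i \<noteq> j" "f i \<noteq> 0" "f j \<noteq> 0" "ring_unit V (f i / f j)"
proof (rule ccontr)
  assume "\<not> thesis"
  with that have no: "\<And>i j. i \<in> I \<Longrightarrow> j \<in> I \<Longrightarrow> i \<noteq> j \<Longrightarrow> f i \<noteq> 0 \<Longrightarrow> f j \<noteq> 0 \<Longrightarrow> \<not> ring_unit V (f i / f j)"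
    by blast
  have R: "subring V" using V by (auto simp: valuation_ring_def)
  let ?I = "{i\<in>I. f i \<noteq> 0}"
  have "\<exists>k\<in>?I. \<forall>j\<in>?I. f j / f k \<in> V"
    by (rule dominant_term[OF V K]) (use I f in auto)
  then obtain k where k: "k \<in> I" "f k \<noteq> 0" "\<And>j. j \<in> ?I \<Longrightarrow> f j / f k \<in> V" by auto
  have "sum f I = sum f ?I" by (rule sum.mono_neutral_right) (use I in auto)
  also have "\<dots> = f k + sum f (?I - {k})" by (subst sum.remove[of _ k]) (use I k in auto)
  finally have "sum f (?I - {k}) / f k = -1" using 0 k by (simp add: field_simps add_eq_0_iff)
  then have "(\<Sum>j\<in>?I - {k}. f j / f k) = -1" by (simp add: sum_divide_distrib)
  moreover have "\<not> ring_unit V (\<Sum>j\<in>?I - {k}. f j / f k)"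
    by (rule nonunit_sum[OF V K, THEN conjunct2]) (use I k no in auto)
  moreover have "ring_unit V (-1)" using R by (auto simp: ring_unit_def subringD subring_uminus)
  ultimately show False by simp
qed

subsection \<open>Existence of valuation rings\<close>

definition adjoin :: "complex set \<Rightarrow> complex \<Rightarrow> complex set" where
  "adjoin R z = {poly p z | p. \<forall>i. coeff p i \<in> R}"

lemma coeff_mult_in_subring:
  "subring R \<Longrightarrow> \<forall>i. coeff p i \<in> R \<Longrightarrow> \<forall>i. coeff q i \<in> R \<Longrightarrow> coeff (p * q) i \<in> R"
  by (auto simp: coeff_mult intro!: subring_sum subringD)

lemma subring_adjoin:
  assumes R: "subring R"
  shows "subring (adjoin R z)" "R \<subseteq> adjoin R z" "z \<in> adjoin R z"
proof -
  have c: "x \<in> adjoin R z" if "x \<in> R" for x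
    unfolding adjoin_def using that R
    by (auto intro!: exI[of _ "[:x:]"] simp: coeff_pCons subringD split: nat.splits)
  show "subring (adjoin R z)"
    unfolding subring_def
  proof (intro conjI ballI)
    fix x y assume "x \<in> adjoin R z" "y \<in> adjoin R z"
    then obtain p q where pq: "x = poly p z" "y = poly q z" "\<forall>i. coeff p i \<in> R" "\<forall>i. coeff q i \<in> R"
      by (auto simp: adjoin_def)
    show "x + y \<in> adjoin R z" unfolding adjoin_def
      by (auto intro!: exI[of _ "p + q"] simp: pq subringD[OF R])
    show "x - y \<in> adjoin R z" unfolding adjoin_def
      by (auto intro!: exI[of _ "p - q"] simp: pq subringD[OF R])
    show "x * y \<in> adjoin R z" unfolding adjoin_def
      by (auto intro!: exI[of _ "p * q"] simp: pq coeff_mult_in_subring[OF R])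
  qed (use c R in \<open>auto simp: subringD\<close>)
  show "R \<subseteq> adjoin R z" using c by blast
  show "z \<in> adjoin R z" unfolding adjoin_def
    using R by (auto intro!: exI[of _ "[:0,1:]"] simp: coeff_pCons subringD split: nat.splits)
qed

lemma adjoin_subset: "subring S \<Longrightarrow> R \<subseteq> S \<Longrightarrow> z \<in> S \<Longrightarrow> adjoin R z \<subseteq> S"
  by (auto simp: adjoin_def poly_altdef intro!: subring_sum subringD subring_power)

lemma subring_Union_chain:
  assumes C: "\<C> \<noteq> {}" "subset.chain \<A> \<C>" and R: "\<And>R. R \<in> \<C> \<Longrightarrow> subring R"
  shows "subring (\<Union>\<C>)"
  unfolding subring_def
proof (intro conjI ballI)
  fix x y assume "x \<in> \<Union>\<C>" "y \<in> \<Union>\<C>"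
  then obtain A B where "A \<in> \<C>" "B \<in> \<C>" "x \<in> A" "y \<in> B" by blast
  moreover from this C have "A \<subseteq> B \<or> B \<subseteq> A" by (auto simp: subset.chain_def)
  ultimately obtain D where D: "D \<in> \<C>" "x \<in> D" "y \<in> D" by blast
  then show "x + y \<in> \<Union>\<C>" "x - y \<in> \<Union>\<C>" "x * y \<in> \<Union>\<C>" using R[OF D(1)] by (auto intro: subringD)
qed (use C R in \<open>auto simp: subringD\<close>)

text \<open>If \<open>u = 1 - y * b\<close> had no inverse in \<open>R\<close>, then
  \<open>inverse y\<close> would be a polynomial in \<open>inverse u\<close>, so
  \<open>u ^ n * inverse y\<close> would lie in \<open>R\<close> for \<open>n\<close> its degree.
  But \<open>u ^ n\<close> is 1 modulo \<open>y\<close>, so this product differs from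
  \<open>inverse y\<close> by an element of \<open>R\<close>.\<close>

lemma unit_of_maximal_subring:
  assumes R: "subring R" and y: "y \<in> R" "y \<noteq> 0" "inverse y \<notin> R"
    and K: "number_field K" "R \<subseteq> K"
    and max: "\<And>z. z \<in> K \<Longrightarrow> z \<notin> R \<Longrightarrow> inverse y \<in> adjoin R z"
    and b: "b \<in> R"
  shows "ring_unit R (1 - y * b)"
proof -
  define u where "u = 1 - y * b"
  have uR: "u \<in> R" unfolding u_def by (intro subringD R y b)
  have nz: "u \<noteq> 0"
  proof
    assume "u = 0"
    then have "b = inverse y" using y by (simp add: u_def field_simps)
    then show False using b y by simp
  qed
  have "inverse u \<in> R"
  proof (rule ccontr)
    assume "inverse u \<notin> R"
    then have "inverse y \<in> adjoin R (inverse u)"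
      using max[of "inverse u"] uR K by (auto intro: number_fieldD)
    then obtain p where p: "inverse y = poly p (inverse u)" "\<forall>i. coeff p i \<in> R" by (auto simp: adjoin_def)
    let ?n = "degree p"
    have "u ^ ?n * poly p (inverse u) = (\<Sum>i\<le>?n. coeff p i * u ^ (?n - i))"
      unfolding poly_altdef sum_distrib_left
      by (rule sum.cong) (use nz in \<open>auto simp: power_diff power_inverse field_simps\<close>)
    then have "u ^ ?n * inverse y \<in> R"
      using p R uR by (auto intro!: subring_sum subringD subring_power)
    moreover have "\<exists>r\<in>R. u ^ n = 1 + y * r" for n
    proof (induction n)
      case 0
      then show ?case using R by (auto intro!: bexI[of _ 0] simp: subringD)
    next
      case (Suc n)
      then obtain r where "r \<in> R" "u ^ n = 1 + y * r" by blast
      then show ?case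
        by (intro bexI[of _ "r - b - y * b * r"])
           (auto simp: u_def algebra_simps intro!: subringD R y b)
    qed
    then obtain r where r: "r \<in> R" "u ^ ?n = 1 + y * r" by blast
    ultimately have "inverse y + r \<in> R" using y by (simp add: field_simps)
    then have "inverse y + r - r \<in> R" using r(1) R by (metis subringD(4))
    then show False using y(3) by (metis add_diff_cancel_right')
  qed
  then show ?thesis using nz uR by (simp add: ring_unit_def u_def)
qed

text \<open>The polynomial of larger degree can be shortened: since \<open>1 - y * coeff q 0\<close>
  is a unit, the equation for \<open>inverse z\<close> expresses a high power of \<open>z\<close>
  through lower ones. The other case follows by exchanging \<open>z\<close> and
  \<open>inverse z\<close>. The sum of the degrees descends until a constant in \<open>R\<close>
  would equal \<open>inverse y\<close>.\<close>

lemma no_double_representation: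
  assumes R: "subring R" and y: "y \<in> R" "inverse y \<notin> R"
    and unit: "\<And>b. b \<in> R \<Longrightarrow> ring_unit R (1 - y * b)"
    and "z \<noteq> 0" "\<forall>i. coeff p i \<in> R" "\<forall>i. coeff q i \<in> R"
    "y * poly p z = 1" "y * poly q (inverse z) = 1"
  shows False
  using assms(5-)
proof (induction "degree p + degree q" arbitrary: p q z rule: less_induct)
  case less
  have step: False
    if z: "z \<noteq> 0" and p: "\<forall>i. coeff p i \<in> R" "y * poly p z = 1"
      and q: "\<forall>i. coeff q i \<in> R" "y * poly q (inverse z) = 1" and le: "degree q \<le> degree p"
      and IH: "\<And>p'. degree p' < degree p \<Longrightarrow> \<forall>i. coeff p' i \<in> R \<Longrightarrow> y * poly p' z = 1 \<Longrightarrow> False"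
    for z p q
  proof (cases "degree p = 0")
    case True
    then have "poly p z = coeff p 0" by (auto elim: degree_eq_zeroE)
    then have "inverse y = coeff p 0" using p(2) by (metis inverse_unique)
    then show False using p(1) y by auto
  next
    case False
    let ?n = "degree p" and ?m = "degree q"
    define u where "u = 1 - y * coeff q 0"
    have u: "ring_unit R u" using unit q by (auto simp: u_def)
    \<comment> \<open>\<open>poly r z\<close> is \<open>z ^ ?n\<close> times the nonconstant part of
      \<open>q\<close> at \<open>inverse z\<close>. The sum starts at 1, so the degree of
      \<open>r\<close> stays below \<open>?n\<close>.\<close>
    define r where "r = (\<Sum>j=1..?m. monom (coeff q j) (?n - j))"
    have rR: "coeff r i \<in> R" for i
      unfolding r_def coeff_sum using q R by (intro subring_sum) (auto simp: subringD)
    have rdeg: "coeff r i = 0" if "i \<ge> ?n" for i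
      unfolding r_def coeff_sum using that False by (intro sum.neutral) auto
    have "poly q (inverse z) = coeff q 0 + (\<Sum>j=1..?m. coeff q j * inverse z ^ j)"
      by (simp add: poly_altdef sum.atLeast1_atMost_eq sum.atMost_shift)
    then have "u = y * (\<Sum>j=1..?m. coeff q j * inverse z ^ j)"
      using q(2) by (simp add: u_def algebra_simps)
    then have "z ^ ?n * u = y * (\<Sum>j=1..?m. coeff q j * (z ^ ?n * inverse z ^ j))"
      by (simp add: sum_distrib_left mult_ac)
    also have "(\<Sum>j=1..?m. coeff q j * (z ^ ?n * inverse z ^ j)) = poly r z"
      unfolding r_def poly_sum poly_monom
      by (rule sum.cong) (use le z in \<open>auto simp: power_diff power_inverse divide_inverse\<close>)
    finally have zn: "z ^ ?n = inverse u * y * poly r z"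
      using u by (auto simp: ring_unit_def field_simps)
    define a where "a = coeff p ?n"
    \<comment> \<open>The leading term of \<open>p\<close> is traded for its expression through
      \<open>r\<close>, which keeps the value at \<open>z\<close> and lowers the degree.\<close>
    define p' where "p' = p - monom a ?n + [:a * inverse u * y:] * r"
    have "poly p' z = poly p z - a * z ^ ?n + a * inverse u * y * poly r z"
      by (simp add: p'_def poly_monom)
    then have 1: "y * poly p' z = 1" using p(2) zn by (simp add: mult.assoc)
    have 2: "\<forall>i. coeff p' i \<in> R"
      using p rR u y by (auto simp: p'_def a_def ring_unit_def intro!: subringD R)
    have "coeff p' i = 0" if "i \<ge> ?n" for i
      using that rdeg[OF that] by (auto simp: p'_def a_def coeff_eq_0)
    then have "degree p' \<le> ?n - 1" using False by (intro degree_le) auto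
    then have "degree p' < ?n" using False by linarith
    then show False using IH 1 2 by blast
  qed
  show False
  proof (cases "degree q \<le> degree p")
    case True
    show False
    proof (rule step[of z p q])
      fix p' assume "degree p' < degree p" "\<forall>i. coeff p' i \<in> R" "y * poly p' z = 1"
      then show False using less.hyps[of p' q z] less.prems by auto
    qed (use less.prems True in auto)
  next
    case False
    show False
    proof (rule step[of "inverse z" q p])
      fix q' assume "degree q' < degree q" "\<forall>i. coeff q' i \<in> R" "y * poly q' (inverse z) = 1"
      then show False using less.hyps[of p q' z] less.prems by auto
    qed (use less.prems False in auto)
  qed
qed

lemma exists_valuation_ring:
  assumes K: "number_field K" and x: "x \<in> K" "x \<noteq> 0" "\<not> alg_int x"
  obtains V where "valuation_ring K V" "x \<notin> V"
proof -
  define y where "y = inverse x"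
  have y: "y \<in> K" "y \<noteq> 0" "inverse y = x" using x K by (auto simp: y_def number_fieldD)
  define \<A> where "\<A> = {R. subring R \<and> R \<subseteq> K \<and> y \<in> R \<and> x \<notin> R}"
  have Ints: "subring \<int>" by (auto simp: subring_def)
  \<comment> \<open>This provides the starting ring for Zorn's lemma. If
    \<open>x = poly p y\<close>, multiplying by \<open>x ^ degree p\<close> would give a monic
    integral equation for \<open>x\<close>, namely \<open>poly g x = 0\<close>.\<close>
  have "x \<notin> adjoin \<int> y"
  proof
    assume "x \<in> adjoin \<int> y"
    then obtain p where p: "x = poly p y" "\<forall>i. coeff p i \<in> \<int>" by (auto simp: adjoin_def)
    let ?n = "degree p"
    define g where "g = monom 1 (Suc ?n) - (\<Sum>i\<le>?n. monom (coeff p i) (?n - i))"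
    have "x ^ ?n * poly p y = (\<Sum>i\<le>?n. coeff p i * x ^ (?n - i))"
      unfolding poly_altdef sum_distrib_left
      by (rule sum.cong) (use x in \<open>auto simp: y_def power_diff power_inverse field_simps\<close>)
    then have r: "poly g x = 0"
      using p(1)[symmetric] by (simp add: g_def poly_monom poly_sum mult.commute)
    have c: "coeff g i \<in> \<int>" for i
      unfolding g_def coeff_diff coeff_sum using p by (auto intro!: Ints_diff Ints_sum)
    have d: "coeff g i = (if i = Suc ?n then 1 else 0)" if "i \<ge> Suc ?n" for i
      unfolding g_def coeff_diff coeff_sum using that by (auto intro!: sum.neutral)
    have "degree g = Suc ?n"
      using d by (intro antisym degree_le le_degree) auto
    then have "lead_coeff g = 1" using d by simp
    then show False using r c x(3) unfolding alg_int_def by blast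
  qed
  moreover have "\<int> \<subseteq> K" using K by (auto elim!: Ints_cases simp: number_fieldD)
  ultimately have "adjoin \<int> y \<in> \<A>"
    using subring_adjoin[OF Ints, of y] adjoin_subset[OF number_field_subring[OF K] _ y(1), of \<int>]
    by (auto simp: \<A>_def)
  then have "\<exists>M\<in>\<A>. \<forall>X\<in>\<A>. M \<subseteq> X \<longrightarrow> X = M"
  proof (intro subset_Zorn_nonempty)
    fix \<C> assume C: "\<C> \<noteq> {}" "subset.chain \<A> \<C>"
    then have "\<C> \<subseteq> \<A>" by (auto simp: subset.chain_def)
    then show "\<Union>\<C> \<in> \<A>" using C(1) subring_Union_chain[OF C] by (auto simp: \<A>_def)
  qed auto
  then obtain V where V: "V \<in> \<A>" and M: "\<And>X. X \<in> \<A> \<Longrightarrow> V \<subseteq> X \<Longrightarrow> X = V" by blast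
  have R: "subring V" and VK: "V \<subseteq> K" and yV: "y \<in> V" and xV: "x \<notin> V" using V by (auto simp: \<A>_def)
  have max: "x \<in> adjoin V z" if "z \<in> K" "z \<notin> V" for z
  proof (rule ccontr)
    assume "x \<notin> adjoin V z"
    then have "adjoin V z \<in> \<A>"
      using subring_adjoin[OF R, of z] adjoin_subset[OF number_field_subring[OF K] VK that(1)] yV
      by (auto simp: \<A>_def)
    then have "adjoin V z = V" using M subring_adjoin[OF R, of z] by blast
    then show False using subring_adjoin[OF R, of z] that by auto
  qed
  have unit: "ring_unit V (1 - y * b)" if "b \<in> V" for b
    by (rule unit_of_maximal_subring[OF R yV y(2) _ K VK _ that]) (use xV y max in auto)
  have "z \<in> V \<or> inverse z \<in> V" if z: "z \<in> K" for z
  proof (rule ccontr)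
    assume "\<not> ?thesis"
    then have n: "z \<notin> V" "inverse z \<notin> V" by auto
    then have z0: "z \<noteq> 0" using R subringD(1) by auto
    obtain p where p: "x = poly p z" "\<forall>i. coeff p i \<in> V" using max[OF z n(1)] by (auto simp: adjoin_def)
    obtain q where q: "x = poly q (inverse z)" "\<forall>i. coeff q i \<in> V"
      using max[OF _ n(2)] z K by (auto simp: adjoin_def number_fieldD)
    show False
      by (rule no_double_representation[OF R yV _ unit z0 p(2) q(2)])
         (use xV y x p q in \<open>auto simp: y_def\<close>)
  qed
  then have "valuation_ring K V" using R VK by (auto simp: valuation_ring_def)
  then show thesis using that xV by blast
qed

subsection \<open>From valuation rings to places\<close>

text \<open>The integral exponent behind \<open>padic_abs\<close>; it permits computing with
  \<open>powi\<close> instead of real exponents.\<close>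

definition padic_val :: "nat \<Rightarrow> rat \<Rightarrow> int" where
  "padic_val p q = int (multiplicity (int p) (fst (quotient_of q))) - int (multiplicity (int p) (snd (quotient_of q)))"

lemma padic_abs_powi:
  assumes "p > 0" "q \<noteq> 0"
  shows "padic_abs p q = real p powi (- padic_val p q)"
proof -
  have "padic_abs p q = real p powr (- real_of_int (padic_val p q))"
    using assms by (simp add: padic_abs_def padic_val_def case_prod_beta)
  also have "\<dots> = real p powi (- padic_val p q)"
    using assms powr_real_of_int'[of "real p" "- padic_val p q"] by simp
  finally show ?thesis .
qed

lemma padic_val_of_int: "padic_val p (of_int n) = int (multiplicity (int p) n)"
  by (simp add: padic_val_def)

lemma padic_val_decomp:
  assumes p: "prime p" and q: "q \<noteq> 0"
  obtains a b where "\<not> int p dvd a" "\<not> int p dvd b" "q = of_nat p powi (padic_val p q) * of_int a / of_int b"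
proof -
  obtain n d where nd: "quotient_of q = (n, d)" by force
  have qnd: "q = of_int n / of_int d" and d: "d > 0"
    using quotient_of_div[OF nd] quotient_of_denom_pos[OF nd] by auto
  have n: "n \<noteq> 0" using q qnd by auto
  have pi: "\<not> is_unit (int p)" using p by auto
  obtain a where a: "n = int p ^ multiplicity (int p) n * a" "\<not> int p dvd a"
    using multiplicity_decompose'[OF n pi] by metis
  obtain b where b: "d = int p ^ multiplicity (int p) d * b" "\<not> int p dvd b"
    using multiplicity_decompose'[OF _ pi, of d] d by (metis less_irrefl)
  have p0: "(of_nat p :: rat) \<noteq> 0" using p by auto
  have "q = (of_nat p ^ multiplicity (int p) n * of_int a) / (of_nat p ^ multiplicity (int p) d * of_int b)"
    unfolding qnd using arg_cong[OF a(1), of "of_int :: int \<Rightarrow> rat"] arg_cong[OF b(1), of "of_int :: int \<Rightarrow> rat"] by simp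
  also have "\<dots> = of_nat p powi (padic_val p q) * of_int a / of_int b"
    using p0 by (simp add: padic_val_def nd power_int_diff)
  finally show thesis using that a b by blast
qed

context
  fixes K V :: "complex set" and p :: nat
  assumes K: "number_field K" and V: "valuation_ring K V"
    and p: "prime p" and pV: "inverse (of_nat p) \<notin> V"
begin

lemma V_subring: "subring V"
  using V by (auto simp: valuation_ring_def)

lemma p_nonzero: "(of_nat p :: complex) \<noteq> 0"
  using p by auto

text \<open>Bezout gives s p + t a = 1. If p / a lies in \<open>V\<close>, so does 1 / a = s (p / a)
  + t; if instead a / p lay in \<open>V\<close>, then 1 / p = s + t (a / p) would contradict
  \<open>pV\<close>.\<close>

lemma unit_of_int:
  assumes "\<not> int p dvd a"
  shows "ring_unit V (of_int a)"
proof -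
  have a0: "(of_int a :: complex) \<noteq> 0" using assms by auto
  have "coprime (int p) a" using assms p by (simp add: prime_imp_coprime)
  then obtain s t where st: "s * int p + t * a = 1" by (metis bezout_int coprime_iff_gcd_eq_1)
  then have st': "of_int s * of_nat p + of_int t * of_int a = (1::complex)"
    by (metis of_int_1 of_int_add of_int_mult of_int_of_nat_eq)
  note R = V_subring
  have "of_nat p / of_int a \<in> K" using K by (auto intro: number_fieldD)
  then consider "of_nat p / of_int a \<in> V" | "of_int a / of_nat p \<in> V"
    using V unfolding valuation_ring_def by force
  then have "inverse (of_int a) \<in> V"
  proof cases
    case 1
    have "inverse (of_int a) = of_int s * (of_nat p / of_int a) + (of_int t :: complex)"
      using st' a0 by (simp add: field_simps)
    also have "\<dots> \<in> V" by (intro subringD R subring_of_int 1)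
    finally show ?thesis .
  next
    case 2
    have "inverse (of_nat p) = of_int s + of_int t * (of_int a / of_nat p :: complex)"
      using st' p_nonzero by (simp add: field_simps)
    also have "\<dots> \<in> V" by (intro subringD R subring_of_int 2)
    finally show ?thesis using pV by simp
  qed
  then show ?thesis using a0 R by (simp add: ring_unit_def subring_of_int)
qed

lemma unit_of_rat:
  assumes "q \<noteq> 0"
  shows "ring_unit V (of_rat q * of_nat p powi (- padic_val p q))"
proof -
  obtain a b where ab: "\<not> int p dvd a" "\<not> int p dvd b" "q = of_nat p powi (padic_val p q) * of_int a / of_int b"
    using padic_val_decomp[OF p assms] by blast
  have pw: "complex_of_rat (of_nat p powi k) = of_nat p powi k" for k
    by (simp add: power_int_def of_rat_power of_rat_inverse)
  have "complex_of_rat q = of_nat p powi (padic_val p q) * of_int a / of_int b"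
    by (subst ab(3)) (simp add: of_rat_mult of_rat_divide pw)
  then have "of_rat q * of_nat p powi (- padic_val p q) = (of_int a / of_int b :: complex)"
    using p_nonzero by (simp add: power_int_minus field_simps)
  then show ?thesis using ring_unit_divide[OF V_subring unit_of_int[OF ab(1)] unit_of_int[OF ab(2)]] by simp
qed

lemma unit_p_powi: "ring_unit V (of_nat p powi k) \<longleftrightarrow> k = 0"
proof
  have *: "\<not> ring_unit V (of_nat p ^ Suc n)" for n
  proof
    assume "ring_unit V (of_nat p ^ Suc n)"
    then have "of_nat p ^ n * inverse (of_nat p ^ Suc n) \<in> V"
      by (intro subringD subring_power subring_of_nat V_subring) (auto simp: ring_unit_def)
    then show False using pV p_nonzero by (simp add: field_simps)
  qed
  assume u: "ring_unit V (of_nat p powi k)"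
  show "k = 0"
  proof (rule ccontr)
    assume "k \<noteq> 0"
    then consider n where "k = int (Suc n)" | n where "k = - int (Suc n)"
      by (metis int_cases neg_0_equal_iff_equal old.nat.exhaust of_nat_0)
    then show False
    proof cases
      case 1
      then show False using u *[of n] by (simp del: of_nat_Suc power_Suc)
    next
      case 2
      then show False using ring_unit_inverse[OF u] *[of n] by (simp add: power_int_minus del: of_nat_Suc power_Suc)
    qed
  qed
qed (use V_subring in \<open>auto simp: ring_unit_def subringD\<close>)

text \<open>Two terms of a rational relation between the powers of \<open>z\<close> are associated,
  so a nonzero power of \<open>z\<close> is a rational number up to a unit of \<open>V\<close>,
  hence a power of \<open>p\<close> up to a unit. This shows that \<open>V\<close> has rank one,
  with exponents of denominator at most \<open>card B\<close>.\<close>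

lemma power_associated_p_powi:
  assumes B: "finite B" "K \<subseteq> qv.span B" and z: "z \<in> K" "z \<noteq> 0"
  obtains n k where "n \<in> {1..card B}" "ring_unit V (z ^ n * of_nat p powi k)"
proof -
  obtain q where q: "\<exists>i\<le>card B. q i \<noteq> 0" "(\<Sum>i\<le>card B. of_rat (q i) * z ^ i) = 0"
    using power_relation[OF B(1) number_field_subring[OF K] B(2) z(1)] by blast
  then obtain i0 where "i0 \<in> {..card B}" "of_rat (q i0) * z ^ i0 \<noteq> 0" using z by auto
  then obtain i j where ij: "i \<le> card B" "j \<le> card B" "i \<noteq> j" "q i \<noteq> 0" "q j \<noteq> 0"
     "ring_unit V ((of_rat (q i) * z ^ i) / (of_rat (q j) * z ^ j))"
    using zero_sum_two_associated[OF V K _ _ _ _ q(2), of i0] K z by (auto simp: number_fieldD)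
  define l where "l = padic_val p (q i / q j)"
  have "ring_unit V (of_rat (q i / q j) * of_nat p powi (- l))"
    using unit_of_rat[of "q i / q j"] ij by (auto simp: l_def)
  from ring_unit_divide[OF V_subring ij(6) this]
  have u: "ring_unit V (z ^ i / z ^ j * of_nat p powi l)"
    using ij z by (simp add: of_rat_divide power_int_minus) (simp add: field_simps)
  show thesis
  proof (cases "i > j")
    case True
    then have "i - j \<in> {1..card B}" using ij by auto
    then show thesis using that[of "i - j" l] u True z by (simp add: power_diff)
  next
    case False
    then have "ring_unit V (z ^ (j - i) * of_nat p powi (- l))"
      using ring_unit_inverse[OF u] z ij by (simp add: power_diff power_int_minus field_simps)
    moreover have "j - i \<in> {1..card B}" using ij False by auto
    ultimately show thesis using that[of "j - i" "- l"] by blast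
  qed
qed

lemma power_associated_p_powi':
  assumes "z \<in> K" "z \<noteq> 0"
  obtains n k where "n > 0" "ring_unit V (z ^ n * of_nat p powi k)"
proof -
  obtain B where B: "finite B" "K \<subseteq> qv.span B" using number_field_finite_span[OF K] by blast
  obtain n k where "n \<in> {1..card B}" "ring_unit V (z ^ n * of_nat p powi k)"
    using power_associated_p_powi[OF B assms] by blast
  then show thesis using that[of n k] by auto
qed

text \<open>Raising the units to the powers \<open>m\<close> and \<open>n\<close> and dividing
  eliminates \<open>z\<close>; what remains is a power of \<open>p\<close>, which is a unit only for
  exponent 0.\<close>

lemma associated_exponent_unique:
  assumes "z \<noteq> 0" "n > 0" "ring_unit V (z ^ n * of_nat p powi k)" "m > 0" "ring_unit V (z ^ m * of_nat p powi l)"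
  shows "real_of_int k / real n = real_of_int l / real m"
proof -
  have "ring_unit V ((z ^ n * of_nat p powi k) ^ m / (z ^ m * of_nat p powi l) ^ n)"
    by (intro ring_unit_divide ring_unit_power V_subring assms)
  also have "(z ^ n * of_nat p powi k) ^ m / (z ^ m * of_nat p powi l) ^ n = of_nat p powi (k * int m - l * int n)"
    using assms p_nonzero
    by (simp add: power_mult_distrib power_mult[symmetric] mult.commute[of n m] power_int_diff power_int_mult)
  finally have "k * int m = l * int n" by (simp add: unit_p_powi)
  then have "real_of_int k * real m = real_of_int l * real n" by (metis of_int_mult of_int_of_nat_eq)
  then show ?thesis using assms by (simp add: field_simps)
qed

text \<open>The value is forced: an absolute value that is 1 on units of \<open>V\<close> and 1 / p
  at \<open>p\<close> must take \<open>z ^ n\<close> to \<open>p powi k\<close>.\<close>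

definition vr_place :: "complex \<Rightarrow> real" where
  "vr_place z = (if z \<in> K \<and> z \<noteq> 0 then
     (SOME r. \<exists>n k. n > 0 \<and> ring_unit V (z ^ n * of_nat p powi k) \<and> r = real p powr (real_of_int k / real n)) else 0)"

lemma vr_place_eq:
  assumes "z \<in> K" "z \<noteq> 0" "n > 0" "ring_unit V (z ^ n * of_nat p powi k)"
  shows "vr_place z = real p powr (real_of_int k / real n)"
proof -
  have "(SOME r. \<exists>n k. n > 0 \<and> ring_unit V (z ^ n * of_nat p powi k) \<and> r = real p powr (real_of_int k / real n))
    = real p powr (real_of_int k / real n)"
  proof (rule some_equality)
    fix r assume "\<exists>n k. n > 0 \<and> ring_unit V (z ^ n * of_nat p powi k) \<and> r = real p powr (real_of_int k / real n)"
    then obtain m l where ml: "m > 0" "ring_unit V (z ^ m * of_nat p powi l)"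
      and r: "r = real p powr (real_of_int l / real m)" by blast
    show "r = real p powr (real_of_int k / real n)"
      using associated_exponent_unique[OF assms(2-4) ml] r by simp
  qed (use assms in blast)
  then show ?thesis using assms by (simp add: vr_place_def)
qed

lemma vr_place_pos: "z \<in> K \<Longrightarrow> z \<noteq> 0 \<Longrightarrow> vr_place z > 0"
proof -
  assume z: "z \<in> K" "z \<noteq> 0"
  obtain n k where n: "n > 0" "ring_unit V (z ^ n * of_nat p powi k)" using power_associated_p_powi'[OF z] by blast
  show ?thesis using vr_place_eq[OF z n] prime_gt_0_nat[OF p] by simp
qed

lemma vr_place_mult:
  assumes x: "x \<in> K" and y: "y \<in> K"
  shows "vr_place (x * y) = vr_place x * vr_place y"
proof (cases "x = 0 \<or> y = 0")
  case True
  then show ?thesis by (auto simp: vr_place_def)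
next
  case False
  obtain n k where n: "n > 0" "ring_unit V (x ^ n * of_nat p powi k)" using power_associated_p_powi' x False by blast
  obtain m l where m: "m > 0" "ring_unit V (y ^ m * of_nat p powi l)" using power_associated_p_powi' y False by blast
  have "ring_unit V ((x ^ n * of_nat p powi k) ^ m * (y ^ m * of_nat p powi l) ^ n)"
    by (intro ring_unit_mult ring_unit_power V_subring n m)
  also have "(x ^ n * of_nat p powi k) ^ m * (y ^ m * of_nat p powi l) ^ n
     = (x * y) ^ (n * m) * of_nat p powi (k * int m + l * int n)"
    using p_nonzero
    by (simp add: power_mult_distrib power_mult[symmetric] mult.commute[of n m] power_int_add power_int_mult)
  finally have "vr_place (x * y) = real p powr (real_of_int (k * int m + l * int n) / real (n * m))"
    using n m x y K False by (intro vr_place_eq) (auto simp: number_fieldD)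
  also have "real_of_int (k * int m + l * int n) / real (n * m) = real_of_int k / real n + real_of_int l / real m"
    using n m by (simp add: field_simps)
  finally show ?thesis using vr_place_eq n m x y False by (simp add: powr_add)
qed

lemma vr_place_le_1_iff:
  assumes z: "z \<in> K"
  shows "vr_place z \<le> 1 \<longleftrightarrow> z \<in> V"
proof (cases "z = 0")
  case True
  then show ?thesis using V_subring by (auto simp: vr_place_def subringD)
next
  case False
  obtain n k where n: "n > 0" "ring_unit V (z ^ n * of_nat p powi k)" using power_associated_p_powi' z False by blast
  let ?u = "z ^ n * of_nat p powi k"
  have v: "vr_place z \<le> 1 \<longleftrightarrow> k \<le> 0"
    using vr_place_eq[OF z False n] n(1) prime_gt_1_nat[OF p] powr_le_cancel_iff[of "real p" "real_of_int k / real n" 0]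
    by (auto simp: divide_le_0_iff)
  have pV': "of_nat p powi m \<in> V \<longleftrightarrow> m \<ge> 0" for m
  proof
    assume a: "of_nat p powi m \<in> V"
    show "m \<ge> 0"
    proof (rule ccontr)
      assume "\<not> m \<ge> 0"
      then obtain j where j: "m = - int (Suc j)" by (metis int_cases of_nat_0_le_iff)
      have "of_nat p ^ Suc j \<in> V" by (intro subring_power subring_of_nat V_subring)
      then have "ring_unit V (of_nat p powi m)"
        using a p_nonzero by (auto simp: ring_unit_def j power_int_minus simp del: of_nat_Suc power_Suc)
      then show False using j by (simp add: unit_p_powi)
    qed
  next
    assume "m \<ge> 0"
    then show "of_nat p powi m \<in> V" by (auto simp: power_int_def intro!: subring_power subring_of_nat V_subring)
  qed
  have eq: "z ^ n = ?u * of_nat p powi (- k)" and eq': "of_nat p powi (- k) = z ^ n * inverse ?u"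
    using p_nonzero False by (auto simp: power_int_minus field_simps)
  \<comment> \<open>An instance of integral closedness: if \<open>inverse z\<close> is in
    \<open>V\<close>, then so is \<open>z = z ^ n * inverse z ^ (n - 1)\<close>.\<close>
  have "z \<in> V \<longleftrightarrow> z ^ n \<in> V"
  proof
    assume a: "z ^ n \<in> V"
    show "z \<in> V"
    proof (rule ccontr)
      assume b: "z \<notin> V"
      then have "inverse z \<in> V" using V z by (auto simp: valuation_ring_def)
      then have "z ^ n * inverse z ^ (n - 1) \<in> V"
        using a subringD(5)[OF V_subring] subring_power[OF V_subring] by blast
      also have "z ^ n * inverse z ^ (n - 1) = z"
        using False n(1) by (cases n) (auto simp: field_simps power_inverse)
      finally show False using b by simp
    qed
  qed (auto intro: subring_power V_subring)
  also have "z ^ n \<in> V \<longleftrightarrow> of_nat p powi (- k) \<in> V"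
    using eq eq' n(2) subringD(5)[OF V_subring] unfolding ring_unit_def by metis
  also have "\<dots> \<longleftrightarrow> k \<le> 0" by (simp add: pV')
  finally show ?thesis using v by simp
qed

lemma place_vr_place: "place K vr_place"
  unfolding place_def
proof (intro conjI ballI allI impI)
  show "vr_place x = 0" if "x \<notin> K" for x using that by (auto simp: vr_place_def)
  show "vr_place x \<ge> 0" if "x \<in> K" for x
    using vr_place_pos[OF that] by (cases "x = 0") (auto simp: vr_place_def)
  show "vr_place x = 0 \<longleftrightarrow> x = 0" if "x \<in> K" for x
    using vr_place_pos[OF that] by (cases "x = 0") (auto simp: vr_place_def)
  show "vr_place (x * y) = vr_place x * vr_place y" if "x \<in> K" "y \<in> K" for x y
    using vr_place_mult that by blast
  \<comment> \<open>After division by \<open>y\<close> the ultrametric inequality only says that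
    \<open>x / y\<close> in \<open>V\<close> implies \<open>1 + x / y\<close> in \<open>V\<close>;
    multiplicativity scales back.\<close>
  have *: "vr_place (x + y) \<le> vr_place y" if xy: "x \<in> K" "y \<in> K" "vr_place x \<le> vr_place y" for x y
  proof (cases "y = 0")
    case True
    then show ?thesis using xy vr_place_pos[of x] by (auto simp: vr_place_def)
  next
    case False
    have q: "x / y \<in> K" "1 + x / y \<in> K" using xy K by (auto intro!: number_fieldD)
    have "vr_place x = vr_place (x / y) * vr_place y"
      using vr_place_mult[of "x / y" y] q xy False by simp
    then have "vr_place (x / y) \<le> 1" using xy(3) vr_place_pos[OF xy(2) False]
      by (simp add: mult_le_cancel_right1)
    then have "x / y \<in> V" using vr_place_le_1_iff q by blast
    then have "1 + x / y \<in> V" by (intro subringD V_subring)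
    then have "vr_place (1 + x / y) \<le> 1" using vr_place_le_1_iff q by blast
    moreover have "vr_place (x + y) = vr_place (1 + x / y) * vr_place y"
      using vr_place_mult[of "1 + x / y" y] q xy False by (simp add: distrib_right add.commute)
    ultimately show ?thesis using vr_place_pos[OF xy(2) False] by (simp add: mult_left_le_one_le)
  qed
  show "vr_place (x + y) \<le> max (vr_place x) (vr_place y)" if "x \<in> K" "y \<in> K" for x y
    using *[of x y] *[of y x] that by (cases "vr_place x \<le> vr_place y") (auto simp: add.commute)
  show "\<exists>p. prime p \<and> (\<forall>q. vr_place (of_rat q) = padic_abs p q)"
  proof (intro exI[of _ p] conjI allI p)
    fix q
    show "vr_place (of_rat q) = padic_abs p q"
    proof (cases "q = 0")
      case True
      then show ?thesis by (simp add: vr_place_def padic_abs_def)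
    next
      case False
      have "vr_place (of_rat q) = real p powr (real_of_int (- padic_val p q) / real 1)"
        using False K unit_of_rat[of q] by (intro vr_place_eq) (auto simp: number_fieldD)
      also have "\<dots> = padic_abs p q"
        using False p by (simp add: padic_abs_def padic_val_def case_prod_beta)
      finally show ?thesis .
    qed
  qed
qed

end

text \<open>If all primes were invertible in \<open>V\<close>, then \<open>V\<close> would contain
  the rationals. Since \<open>inverse x\<close> is in \<open>V\<close>, dividing a rational relation
  for \<open>x\<close> by \<open>x ^ (d - 1)\<close> and its leading coefficient would express
  \<open>x\<close> inside \<open>V\<close>.\<close>

lemma valuation_ring_prime:
  assumes K: "number_field K" and V: "valuation_ring K V" and x: "x \<in> K" "x \<notin> V"
  obtains p :: nat where "prime p" "inverse (of_nat p) \<notin> V"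
proof (rule ccontr)
  assume "\<not> thesis"
  with that have P: "\<And>p::nat. prime p \<Longrightarrow> inverse (of_nat p) \<in> V" by blast
  have R: "subring V" using V by (simp add: valuation_ring_def)
  have N: "inverse (of_nat n) \<in> V" if "n > 0" for n :: nat
    using that
  proof (induction n rule: less_induct)
    case (less n)
    show ?case
    proof (cases "n = 1")
      case True
      then show ?thesis using R by (simp add: subringD)
    next
      case False
      then obtain p where p: "prime p" "p dvd n" using prime_factor_nat by blast
      then obtain m where m: "n = p * m" by blast
      then have "m < n" "m > 0" using less.prems p prime_gt_1_nat[OF p(1)] by auto
      then show ?thesis using less.IH[of m] P[OF p(1)] R m by (simp add: subringD mult.commute)
    qed
  qed
  have Q: "of_rat q \<in> V" for q
  proof -
    obtain a b where ab: "quotient_of q = (a, b)" by force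
    then have b: "b > 0" and q: "q = of_int a / of_int b"
      using quotient_of_denom_pos quotient_of_div by auto
    have "inverse (of_int b) \<in> V" using N[of "nat b"] b by simp
    moreover have "of_rat q = of_int a * inverse (of_int b :: complex)"
      by (simp add: q of_rat_divide divide_inverse of_rat_mult of_rat_inverse)
    ultimately show ?thesis using R by (simp add: subringD subring_of_int)
  qed
  have iV: "inverse x \<in> V" using V x by (auto simp: valuation_ring_def)
  have x0: "x \<noteq> 0" using x R by (auto simp: subringD)
  obtain d and q :: "nat \<Rightarrow> rat" where q: "q d \<noteq> 0" "(\<Sum>i\<le>d. of_rat (q i) * x ^ i) = 0"
    using relation_of_algebraic[OF number_field_algebraic[OF K x(1)]] by metis
  have d: "d > 0" using q by (cases d) auto
  have "of_rat (q d) * x ^ d = - (\<Sum>i<d. of_rat (q i) * x ^ i)"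
    using q(2) by (simp add: lessThan_Suc_atMost[symmetric] add_eq_0_iff)
  then have "inverse (of_rat (q d)) * inverse x ^ (d - 1) * (of_rat (q d) * x ^ d)
     = inverse (of_rat (q d)) * inverse x ^ (d - 1) * - (\<Sum>i<d. of_rat (q i) * x ^ i)" by simp
  also have "inverse (of_rat (q d)) * inverse x ^ (d - 1) * (of_rat (q d) * x ^ d) = x"
    using d x0 q(1) by (cases d) (auto simp: field_simps power_inverse)
  also have "inverse (of_rat (q d)) * inverse x ^ (d - 1) * - (\<Sum>i<d. of_rat (q i) * x ^ i)
     = - (\<Sum>i<d. of_rat (inverse (q d) * q i) * inverse x ^ (d - 1 - i))"
    unfolding sum_distrib_left mult_minus_right of_rat_mult of_rat_inverse
    by (intro arg_cong[of _ _ uminus] sum.cong refl)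
       (use x0 in \<open>auto simp: power_inverse power_diff field_simps\<close>)
  also have "\<dots> \<in> V" by (intro subring_uminus subring_sum subringD subring_power R Q iV)
  finally show False using x by simp
qed

theorem alg_int_if_places_le_1:
  assumes K: "number_field K" and x: "x \<in> K" and le: "\<And>v. place K v \<Longrightarrow> v x \<le> 1"
  shows "alg_int x"
proof (rule ccontr)
  assume n: "\<not> alg_int x"
  have "alg_int 0" unfolding alg_int_def by (rule exI[of _ "[:0,1:]"]) (auto simp: coeff_pCons split: nat.splits)
  then have "x \<noteq> 0" using n by auto
  then obtain V where V: "valuation_ring K V" "x \<notin> V" using exists_valuation_ring[OF K x _ n] by blast
  obtain p :: nat where p: "prime p" "inverse (of_nat p) \<notin> V" using valuation_ring_prime[OF K V(1) x V(2)] by blast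
  show False
    using le[OF place_vr_place[OF K V(1) p]] vr_place_le_1_iff[OF K V(1) p x] V(2) by simp
qed

section \<open>Places\<close>

context
  fixes K :: "complex set" and v :: "complex \<Rightarrow> real"
  assumes K: "number_field K" and v: "place K v"
begin

lemma place_nonneg: "v x \<ge> 0"
  using v by (cases "x \<in> K") (auto simp: place_def)

lemma place_eq_0_iff: "x \<in> K \<Longrightarrow> v x = 0 \<longleftrightarrow> x = 0"
  using v by (auto simp: place_def)

lemma place_pos: "x \<in> K \<Longrightarrow> x \<noteq> 0 \<Longrightarrow> v x > 0"
  using place_nonneg[of x] place_eq_0_iff[of x] by simp

lemma place_0: "v 0 = 0"
  using place_eq_0_iff[of 0] K by (simp add: number_fieldD)

lemma place_mult: "x \<in> K \<Longrightarrow> y \<in> K \<Longrightarrow> v (x * y) = v x * v y"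
  using v by (auto simp: place_def)

lemma place_add: "x \<in> K \<Longrightarrow> y \<in> K \<Longrightarrow> v (x + y) \<le> max (v x) (v y)"
  using v by (auto simp: place_def)

lemma place_1: "v 1 = 1"
  using place_mult[of 1 1] place_eq_0_iff[of 1] K by (simp add: number_fieldD)

lemma place_power: "x \<in> K \<Longrightarrow> v (x ^ n) = v x ^ n"
  by (induction n) (auto simp: place_1 place_mult number_fieldD K)

lemma place_inverse: "x \<in> K \<Longrightarrow> v (inverse x) = inverse (v x)"
proof (cases "x = 0")
  case False
  assume x: "x \<in> K"
  have "v x * v (inverse x) = 1" using place_mult[of x "inverse x"] x False K by (simp add: number_fieldD place_1)
  then show ?thesis by (metis inverse_unique)
qed (simp add: place_0)

lemma place_divide: "x \<in> K \<Longrightarrow> y \<in> K \<Longrightarrow> v (x / y) = v x / v y"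
  by (simp add: divide_inverse place_mult place_inverse number_fieldD K)

lemma place_powi: "x \<in> K \<Longrightarrow> v (x powi k) = v x powi k"
  by (auto simp: power_int_def place_power place_inverse number_fieldD K)

lemma place_uminus: "x \<in> K \<Longrightarrow> v (- x) = v x"
proof -
  assume x: "x \<in> K"
  have m: "-1 \<in> K" using number_fieldD(10)[OF K, of 1] number_fieldD(2)[OF K] by simp
  have "v (-1) ^ 2 = 1" using place_power[OF m, of 2] by (simp add: place_1)
  then have "v (-1) = 1" using place_nonneg[of "-1"] by (simp add: power2_eq_1_iff)
  then show ?thesis using place_mult[OF m x] by simp
qed

lemma place_add_eq:
  assumes "x \<in> K" "y \<in> K" "v x < v y"
  shows "v (x + y) = v y"
proof (rule antisym)
  show "v (x + y) \<le> v y" using place_add[OF assms(1,2)] assms(3) by simp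
  have "v (x + y + - x) \<le> max (v (x + y)) (v (- x))"
    by (rule place_add) (use assms K in \<open>auto intro!: number_fieldD\<close>)
  then show "v y \<le> v (x + y)" using assms by (simp add: place_uminus)
qed

lemma place_sum_le:
  assumes "finite I" "\<And>i. i \<in> I \<Longrightarrow> f i \<in> K" "\<And>i. i \<in> I \<Longrightarrow> v (f i) \<le> b" "b \<ge> 0"
  shows "v (sum f I) \<le> b"
  using assms
proof (induction I rule: finite_induct)
  case (insert i I)
  have "v (f i + sum f I) \<le> max (v (f i)) (v (sum f I))"
    using insert.prems K by (intro place_add) (auto intro!: number_fieldD)
  then show ?case using insert by force
qed (simp add: place_0)

lemma place_of_nat_le_1: "v (of_nat n) \<le> 1"
proof (induction n)
  case (Suc n)
  have "v (of_nat n + 1) \<le> max (v (of_nat n)) (v 1)"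
    by (rule place_add) (use K in \<open>auto intro!: number_fieldD\<close>)
  then show ?case using Suc by (simp add: place_1 add.commute)
qed (simp add: place_0)

lemma place_of_int_le_1: "v (of_int n) \<le> 1"
  using place_of_nat_le_1 place_uminus[OF number_fieldD(8)[OF K]]
  by (cases n) (auto simp del: of_nat_Suc)

lemma place_prime:
  shows prime_place_prime: "prime (place_prime v)"
    and place_of_rat: "v (of_rat q) = padic_abs (place_prime v) q"
proof -
  obtain p where p: "prime p" and vp: "\<And>q. v (of_rat q) = padic_abs p q" using v by (auto simp: place_def)
  have n: "v (of_nat r) = real p powi (- int (multiplicity (int p) (int r)))" if "r > 0" for r
  proof -
    have "v (of_nat r) = padic_abs p (of_int (int r))" using vp[of "of_int (int r)"] by simp
    also have "\<dots> = real p powi (- int (multiplicity (int p) (int r)))"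
      using that prime_gt_0_nat[OF p] padic_abs_powi[of p "of_int (int r)", unfolded padic_val_of_int] by simp
    finally show ?thesis .
  qed
  have "place_prime v = p" unfolding place_prime_def
  proof (rule the_equality)
    have "multiplicity (int p) (int p) = 1" using p by (simp add: multiplicity_prime)
    then show "prime p \<and> v (of_nat p) < 1"
      using n[of p] p prime_gt_1_nat[OF p] by (simp add: power_int_minus inverse_less_1_iff)
    fix r assume r: "prime r \<and> v (of_nat r) < 1"
    show "r = p"
    proof (rule ccontr)
      assume "r \<noteq> p"
      then have "multiplicity (int p) (int r) = 0" using r p by (simp add: prime_multiplicity_other)
      then show False using n[of r] r prime_gt_0_nat[of r] by simp
    qed
  qed
  then show "prime (place_prime v)" "v (of_rat q) = padic_abs (place_prime v) q" using p vp by auto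
qed

lemma place_prime_gt_1: "real (place_prime v) > 1"
  using prime_gt_1_nat[OF prime_place_prime] by simp

lemma place_of_rat_powi: "q \<noteq> 0 \<Longrightarrow> v (of_rat q) = real (place_prime v) powi (- padic_val (place_prime v) q)"
  using prime_gt_0_nat[OF prime_place_prime] by (simp add: place_of_rat padic_abs_powi)

lemma place_place_prime: "v (of_nat (place_prime v)) = 1 / real (place_prime v)"
proof -
  have p: "place_prime v > 0" "multiplicity (int (place_prime v)) (int (place_prime v)) = 1"
    using prime_gt_0_nat[OF prime_place_prime] prime_place_prime by (auto simp: multiplicity_prime)
  then have "v (of_rat (of_int (int (place_prime v)))) = real (place_prime v) powi (- 1)"
    by (subst place_of_rat_powi, simp, subst padic_val_of_int) simp
  then show ?thesis by (simp add: power_int_minus divide_inverse)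
qed

lemma place_of_int_eq_1: "\<not> int (place_prime v) dvd n \<Longrightarrow> v (of_int n) = 1"
proof -
  assume n: "\<not> int (place_prime v) dvd n"
  then have "n \<noteq> 0" by auto
  then have "v (of_rat (of_int n)) = 1"
    by (subst place_of_rat_powi, simp, subst padic_val_of_int) (simp add: not_dvd_imp_multiplicity_0 n)
  then show ?thesis by simp
qed

lemma place_of_nat_eq_1: "\<not> place_prime v dvd n \<Longrightarrow> v (of_nat n) = 1"
  using place_of_int_eq_1[of "int n"] by simp

lemma place_valuation_ring: "valuation_ring K {x\<in>K. v x \<le> 1}"
  unfolding valuation_ring_def
proof (intro conjI ballI)
  show "subring {x\<in>K. v x \<le> 1}"
    unfolding subring_def
  proof (intro conjI ballI)
    fix x y assume xy: "x \<in> {x\<in>K. v x \<le> 1}" "y \<in> {x\<in>K. v x \<le> 1}"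
    then show "x + y \<in> {x\<in>K. v x \<le> 1}" using place_add[of x y] K by (auto simp: number_fieldD)
    show "x - y \<in> {x\<in>K. v x \<le> 1}"
      using xy place_add[of x "- y"] place_uminus[of y] K by (auto simp: number_fieldD)
    show "x * y \<in> {x\<in>K. v x \<le> 1}"
      using xy K place_nonneg by (auto simp: number_fieldD place_mult intro: mult_le_one)
  qed (use K in \<open>auto simp: number_fieldD place_0 place_1\<close>)
  show "z \<in> {x\<in>K. v x \<le> 1} \<or> inverse z \<in> {x\<in>K. v x \<le> 1}" if "z \<in> K" for z
    using that K place_pos[of z] by (cases "z = 0") (auto simp: number_fieldD place_inverse place_0 inverse_le_1_iff)
qed auto

lemma place_ring_unit_iff: "ring_unit {x\<in>K. v x \<le> 1} z \<longleftrightarrow> z \<in> K \<and> v z = 1"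
  using K place_pos[of z] place_0
  by (cases "z = 0") (auto simp: ring_unit_def number_fieldD place_inverse inverse_le_1_iff)

text \<open>The rank one argument applied to the valuation ring of \<open>v\<close>. The exponent
  \<open>n\<close> is bounded independently of \<open>z\<close>, which later makes the set of values
  discrete.\<close>

lemma place_power_eq_powi:
  assumes "finite B" "K \<subseteq> qv.span B" "z \<in> K" "z \<noteq> 0"
  obtains n k where "n \<in> {1..card B}" "v z ^ n = real (place_prime v) powi k"
proof -
  let ?V = "{x\<in>K. v x \<le> 1}" and ?p = "place_prime v"
  have p: "inverse (of_nat ?p) \<notin> ?V"
    using place_prime_gt_1 K by (simp add: place_inverse number_fieldD place_place_prime)
  obtain n k where n: "n \<in> {1..card B}" "ring_unit ?V (z ^ n * of_nat ?p powi k)"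
    using power_associated_p_powi[OF K place_valuation_ring prime_place_prime p assms] by blast
  then have "v z ^ n * (1 / real ?p) powi k = 1"
    using K assms by (simp add: place_ring_unit_iff place_mult place_power place_powi number_fieldD place_place_prime)
  then have "v z ^ n = real ?p powi k"
    using place_prime_gt_1 by (simp add: power_int_divide_distrib divide_simps split: if_splits)
  then show thesis using that n by blast
qed

text \<open>For \<open>v x > 1\<close> the lower terms of the monic equation have value at most
  \<open>v x ^ (?n - 1)\<close> and cannot balance \<open>x ^ ?n\<close>.\<close>

lemma alg_int_place_le_1:
  assumes "alg_int x" "x \<in> K"
  shows "v x \<le> 1"
proof (rule ccontr)
  assume "\<not> v x \<le> 1"
  then have gt: "v x > 1" by simp
  obtain p where p: "lead_coeff p = 1" "\<forall>i. coeff p i \<in> \<int>" "poly p x = 0"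
    using assms unfolding alg_int_def by blast
  let ?n = "degree p"
  have n: "?n > 0" using p by (cases "?n = 0") (auto elim!: degree_eq_zeroE)
  have c: "coeff p i \<in> K" "v (coeff p i) \<le> 1" for i
    using p(2) K place_of_int_le_1 by (metis Ints_cases number_fieldD(9), metis Ints_cases)
  have "x ^ ?n = - (\<Sum>i<?n. coeff p i * x ^ i)"
    using p(1,3) by (simp add: poly_altdef lessThan_Suc_atMost[symmetric] add_eq_0_iff)
  then have "v x ^ ?n = v (\<Sum>i<?n. coeff p i * x ^ i)"
    using place_power[OF assms(2), of ?n] c K assms by (simp add: place_uminus number_fieldD)
  also have "\<dots> \<le> v x ^ (?n - 1)"
  proof (rule place_sum_le)
    fix i assume i: "i \<in> {..<?n}"
    have "v (coeff p i * x ^ i) \<le> v x ^ i"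
      using c K assms place_nonneg by (simp add: place_mult place_power number_fieldD mult_left_le_one_le)
    also have "\<dots> \<le> v x ^ (?n - 1)" using i gt by (intro power_increasing) auto
    finally show "v (coeff p i * x ^ i) \<le> v x ^ (?n - 1)" .
  qed (use c K assms in \<open>auto simp: number_fieldD place_nonneg\<close>)
  finally show False using gt n power_strict_increasing[of "?n - 1" ?n "v x"] by simp
qed

end

lemma place_restrict:
  assumes K: "number_field K" and L: "number_field L" and KL: "K \<subseteq> L" and w: "place L w"
  shows "place K (\<lambda>x. if x \<in> K then w x else 0)"
proof -
  obtain p where "prime p" "\<And>q. w (of_rat q) = padic_abs p q" using w by (auto simp: place_def)
  then have "\<exists>p. prime p \<and> (\<forall>q. (if of_rat q \<in> K then w (of_rat q) else 0) = padic_abs p q)"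
    using K by (auto simp: number_fieldD)
  moreover have "x \<in> K \<Longrightarrow> x \<in> L" for x using KL by blast
  ultimately show ?thesis using place_nonneg[OF L w] place_eq_0_iff[OF L w] place_mult[OF L w] place_add[OF L w]
    unfolding place_def by (intro conjI ballI allI impI) (simp_all add: number_fieldD[OF K])
qed

lemma place_eqI:
  assumes "place K v" "place K w" "\<And>x. x \<in> K \<Longrightarrow> v x = w x"
  shows "v = w"
proof
  fix x
  show "v x = w x" using assms(3)[of x] assms(1,2) by (cases "x \<in> K") (simp_all add: place_def)
qed

subsection \<open>Approximation and finiteness\<close>

lemma separate_two_places:
  assumes K: "number_field K" and v: "place K v" and w: "place K w" and ne: "v \<noteq> w"
    and p: "place_prime v = place_prime w"
  obtains x where "x \<in> K" "v x > 1" "w x < 1"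
proof -
  have main: "\<exists>x\<in>K. v x > 1 \<and> w x < 1" if v: "place K v" and w: "place K w" and p: "place_prime v = place_prime w"
    and z: "z \<in> K" "z \<noteq> 0" "v z > w z" for v w z
  proof -
    obtain B where B: "finite B" "K \<subseteq> qv.span B" using number_field_finite_span[OF K] .
    let ?p = "real (place_prime v)"
    obtain n k where n: "n \<in> {1..card B}" "v z ^ n = ?p powi k"
      using place_power_eq_powi[OF K v B z(1,2)] .
    obtain m l where m: "m \<in> {1..card B}" "w z ^ m = ?p powi l"
      using place_power_eq_powi[OF K w B z(1,2), folded p] .
    have p1: "?p > 1" using place_prime_gt_1[OF K v] .
    \<comment> \<open>Put a = k m and b = l n, so that \<open>z ^ (n * m)\<close> has value p powi a
      at \<open>v\<close> and p powi b at \<open>w\<close>, with a > b. The square of this element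
      times p powi (a + b) has the values p powi (a - b) and p powi (b - a), one on each side of 1.
      A common residue prime is essential here: both places take the same value on powers of
      p.\<close>
    define x where "x = z ^ (2 * n * m) * of_nat (place_prime v) powi (k * int m + l * int n)"
    have x: "x \<in> K" unfolding x_def using K z by (intro number_fieldD)
    have vn: "v z ^ (n * m) = ?p powi (k * int m)" "w z ^ (n * m) = ?p powi (l * int n)"
      using power_mult[of "v z" n m] power_mult[of "w z" m n] n(2) m(2) by (simp_all add: power_int_mult mult.commute)
    have vx: "v' x = (v' z ^ (n * m))\<^sup>2 * ?p powi (- (k * int m + l * int n))"
      if "place K v'" "place_prime v' = place_prime v" for v'
    proof -
      have "v' x = v' z ^ (2 * n * m) * v' (of_nat (place_prime v)) powi (k * int m + l * int n)"
        unfolding x_def using K z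
        by (simp add: place_mult[OF K that(1)] place_power[OF K that(1)] place_powi[OF K that(1)] number_fieldD)
      also have "v' z ^ (2 * n * m) = (v' z ^ (n * m))\<^sup>2"
        by (simp add: power_mult[symmetric] mult_ac)
      also have "v' (of_nat (place_prime v)) powi (k * int m + l * int n) = ?p powi (- (k * int m + l * int n))"
        using place_place_prime[OF K that(1)] power_int_minus[of ?p "k * int m + l * int n"] unfolding that(2)
        by (simp add: divide_inverse power_int_inverse)
      finally show ?thesis .
    qed
    have pw: "(?p powi a)\<^sup>2 * ?p powi (- (a + b)) = ?p powi (a - b)" for a b
    proof -
      have "?p powi (a - b) = ?p powi ((a + a) + (- (a + b)))" by simp
      also have "\<dots> = ?p powi (a + a) * ?p powi (- (a + b))" by (rule power_int_add) (use p1 in simp)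
      also have "?p powi (a + a) = (?p powi a)\<^sup>2"
        unfolding power2_eq_square by (rule power_int_add) (use p1 in simp)
      finally show ?thesis ..
    qed
    have "w z ^ (n * m) < v z ^ (n * m)"
      using z(3) place_nonneg[OF K w] n m by (intro power_strict_mono) auto
    then have lt: "l * int n < k * int m"
      unfolding vn using p1 power_int_increasing[of "k * int m" "l * int n" ?p] by linarith
    have "v x = ?p powi (k * int m - l * int n)" unfolding vx[OF v refl] vn pw ..
    moreover have "w x = ?p powi (l * int n - k * int m)"
      unfolding vx[OF w p[symmetric]] vn using pw[of "l * int n" "k * int m"] by (simp add: add.commute)
    ultimately have "v x > 1" "w x < 1"
      using lt p1 one_less_power_int[of ?p "k * int m - l * int n"]
        power_int_strict_increasing[of "l * int n - k * int m" 0 ?p] by auto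
    then show ?thesis using x by blast
  qed
  obtain z where z: "z \<in> K" "v z \<noteq> w z" using place_eqI[OF v w] ne by blast
  then have z0: "z \<noteq> 0" using place_0[OF K v] place_0[OF K w] by auto
  consider "v z > w z" | "v (inverse z) > w (inverse z)"
    using z z0 place_pos[OF K v z(1)] place_pos[OF K w z(1)]
    by (force simp: place_inverse[OF K v] place_inverse[OF K w])
  then have "\<exists>x\<in>K. v x > 1 \<and> w x < 1"
    by cases (use main[OF v w p, of z] main[OF v w p, of "inverse z"] z z0 K in \<open>auto simp: number_fieldD\<close>)
  then show thesis using that by blast
qed

text \<open>Weak approximation in the manner of Artin and Whaples: an element \<open>x\<close> good
  for \<open>W\<close> and an element \<open>y\<close> separating \<open>v\<close> from the new
  place are combined.\<close>

lemma separate_places: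
  assumes K: "number_field K" and v: "place K v" and "finite W"
    and "\<And>w. w \<in> W \<Longrightarrow> place K w \<and> w \<noteq> v \<and> place_prime w = place_prime v"
  shows "\<exists>x\<in>K. v x > 1 \<and> (\<forall>w\<in>W. w x < 1)"
  using assms(3,4)
proof (induction W rule: finite_induct)
  case empty
  have "inverse (of_nat (place_prime v)) \<in> K" "v (inverse (of_nat (place_prime v))) > 1"
    using K place_prime_gt_1[OF K v] by (auto simp: number_fieldD place_inverse[OF K v] place_place_prime[OF K v])
  then show ?case by blast
next
  case (insert w0 W)
  obtain x where x: "x \<in> K" "v x > 1" "\<And>w. w \<in> W \<Longrightarrow> w x < 1" using insert by auto
  have w0: "place K w0" "w0 \<noteq> v" "place_prime w0 = place_prime v" using insert.prems by auto
  obtain y where y: "y \<in> K" "v y > 1" "w0 y < 1"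
    using separate_two_places[OF K v w0(1) w0(2)[symmetric] w0(3)[symmetric]] by blast
  have W: "place K w" if "w \<in> W" for w using insert.prems that by auto
  \<comment> \<open>On \<open>W\<close> the powers of \<open>x\<close> tend to 0 and so absorb
    \<open>y\<close>, whatever its size there.\<close>
  have "\<forall>\<^sub>F k in sequentially. \<forall>w\<in>W. w x ^ k * w y < 1"
  proof (rule eventually_ball_finite[OF insert.hyps(1)], intro ballI)
    fix w assume w: "w \<in> W"
    have "(\<lambda>k. w x ^ k * w y) \<longlonglongrightarrow> 0 * w y"
      using place_nonneg[OF K W[OF w]] x(3)[OF w] by (intro tendsto_mult LIMSEQ_realpow_zero tendsto_const) auto
    then show "\<forall>\<^sub>F k in sequentially. w x ^ k * w y < 1" by (rule order_tendstoD(2)) simp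
  qed
  then have "\<forall>\<^sub>F k in sequentially. k \<ge> 1 \<and> (\<forall>w\<in>W. w x ^ k * w y < 1)"
    by (intro eventually_conj eventually_ge_at_top)
  then obtain k where k: "k \<ge> 1" "\<And>w. w \<in> W \<Longrightarrow> w x ^ k * w y < 1"
    by (auto dest: eventually_happens)
  show ?case
  proof (cases "w0 x \<le> 1")
    case True
    have m: "u (x ^ k * y) = u x ^ k * u y" if "place K u" for u
      using x y K by (simp add: place_mult[OF K that] place_power[OF K that] number_fieldD)
    have "v x ^ k * v y > 1" using x(2) y(2) k(1) by (intro less_1_mult) (auto intro: one_less_power)
    moreover have "w0 x ^ k * w0 y < 1"
    proof -
      have "w0 x ^ k * w0 y \<le> 1 * w0 y"
        using True place_nonneg[OF K w0(1)] by (intro mult_right_mono power_le_one) auto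
      then show ?thesis using y by simp
    qed
    ultimately have "v (x ^ k * y) > 1" "w0 (x ^ k * y) < 1" using m v w0(1) by auto
    moreover have "w (x ^ k * y) < 1" if "w \<in> W" for w using m[OF W[OF that]] k(2)[OF that] by simp
    moreover have "x ^ k * y \<in> K" using x y K by (simp add: number_fieldD)
    ultimately show ?thesis by blast
  next
    case False
    \<comment> \<open>When \<open>x\<close> is large at \<open>w0\<close>, its powers cannot serve
      as multiplier. \<open>t\<close> has value 1 where \<open>x\<close> is large and the value of
      \<open>x ^ k\<close> where \<open>x\<close> is small, so \<open>y\<close> decides at
      \<open>v\<close> and \<open>w0\<close> while the places of \<open>W\<close> stay
      controlled.\<close>
    define t where "t = x ^ k / (1 + x ^ k)"
    have t: "t \<in> K" unfolding t_def using K x by (intro number_fieldD)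
    have big: "u t = 1" if "place K u" "u x > 1" for u
    proof -
      have "u 1 < u (x ^ k)" using that x(1) k(1) by (simp add: place_1[OF K] place_power[OF K] one_less_power)
      then have "u (1 + x ^ k) = u (x ^ k)" using x K by (intro place_add_eq[OF K that(1)]) (auto simp: number_fieldD)
      moreover have "u (x ^ k) > 0" using \<open>u 1 < u (x ^ k)\<close> by (simp add: place_1[OF K that(1)])
      ultimately show ?thesis using x K that by (simp add: t_def place_divide[OF K that(1)] number_fieldD)
    qed
    have small: "u t = u x ^ k" if "place K u" "u x < 1" for u
    proof -
      have "u x ^ k < 1" using that k(1) place_nonneg[OF K that(1)] by (simp add: power_less_one_iff)
      then have "u (x ^ k + 1) = u 1" using x K that
        by (intro place_add_eq[OF K that(1)]) (auto simp: number_fieldD place_1[OF K] place_power[OF K])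
      then show ?thesis using x K that
        by (simp add: t_def place_divide[OF K that(1)] number_fieldD place_1[OF K] place_power[OF K] add.commute)
    qed
    have m: "u (t * y) = u t * u y" if "place K u" for u
      using t y by (simp add: place_mult[OF K that])
    have "t * y \<in> K" using t y K by (simp add: number_fieldD)
    moreover have "v (t * y) > 1" using m[OF v] big[OF v x(2)] y by simp
    moreover have "w0 (t * y) < 1" using m[OF w0(1)] big[OF w0(1)] False y by simp
    moreover have "w (t * y) < 1" if "w \<in> W" for w
      using m[OF W[OF that]] small[OF W[OF that] x(3)[OF that]] k(2)[OF that] by simp
    ultimately show ?thesis by blast
  qed
qed

text \<open>Separating elements of more than \<open>card B\<close> places are linearly dependent
  over Q. At a place \<open>v\<close> whose coefficient has the largest p-adic value
  \<open>M\<close>, its own term has value above \<open>M\<close> and all others at most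
  \<open>M\<close>, so they cannot cancel. Thus there are at most \<open>card B\<close> such
  places.\<close>

lemma finite_places_over_prime:
  assumes K: "number_field K"
  shows "finite {v. place K v \<and> place_prime v = p}"
proof (rule ccontr)
  assume inf: "infinite {v. place K v \<and> place_prime v = p}"
  obtain B where B: "finite B" "K \<subseteq> qv.span B" using number_field_finite_span[OF K] .
  obtain T where T: "finite T" "card T = Suc (card B)" "T \<subseteq> {v. place K v \<and> place_prime v = p}"
    using infinite_arbitrarily_large[OF inf] by metis
  have "\<forall>v\<in>T. \<exists>x\<in>K. v x > 1 \<and> (\<forall>w\<in>T - {v}. w x < 1)"
    using T by (intro ballI separate_places[OF K]) auto
  then obtain x where x: "\<And>v. v \<in> T \<Longrightarrow> x v \<in> K" "\<And>v. v \<in> T \<Longrightarrow> v (x v) > 1"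
    "\<And>v w. v \<in> T \<Longrightarrow> w \<in> T \<Longrightarrow> w \<noteq> v \<Longrightarrow> w (x v) < 1" by (metis DiffI singletonD)
  obtain q :: "_ \<Rightarrow> rat" where q: "\<exists>v\<in>T. q v \<noteq> 0" "(\<Sum>v\<in>T. of_rat (q v) * x v) = 0"
    using rational_relation[of B T x] B T x(1) by (auto simp: subset_iff)
  have pl: "place K v" "place_prime v = p" if "v \<in> T" for v using T that by auto
  define M where "M = Max ((\<lambda>v. padic_abs p (q v)) ` T)"
  have ge: "padic_abs p (q v) \<le> M" if "v \<in> T" for v unfolding M_def using T that by simp
  obtain v where v: "v \<in> T" "padic_abs p (q v) = M"
    unfolding M_def using Max_in[of "(\<lambda>v. padic_abs p (q v)) ` T"] T by fastforce
  have M0: "M > 0"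
  proof -
    obtain u where u: "u \<in> T" "q u \<noteq> 0" using q by blast
    then have "padic_abs p (q u) > 0"
      using place_pos[OF K pl(1)[OF u(1)], of "of_rat (q u)"] place_of_rat[OF K pl(1)[OF u(1)]] pl(2)[OF u(1)] K
      by (simp add: number_fieldD)
    then show ?thesis using ge[OF u(1)] by simp
  qed
  have t: "of_rat (q u) * x u \<in> K" if "u \<in> T" for u using that x K by (simp add: number_fieldD)
  have val: "v (of_rat (q u) * x u) = padic_abs p (q u) * v (x u)" if "u \<in> T" for u
    using that v x K pl[OF v(1)] place_of_rat[OF K pl(1)[OF v(1)]] by (simp add: place_mult[OF K pl(1)] number_fieldD)
  have "v (\<Sum>u\<in>T - {v}. of_rat (q u) * x u) \<le> M"
  proof (rule place_sum_le[OF K pl(1)[OF v(1)]])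
    fix u assume u: "u \<in> T - {v}"
    have "padic_abs p (q u) * v (x u) \<le> M * 1"
      using u ge[of u] x(3)[of u v] v(1) M0 place_nonneg[OF K pl(1)[OF v(1)]] by (intro mult_mono) auto
    then show "v (of_rat (q u) * x u) \<le> M" using u by (simp add: val)
  qed (use T t M0 in auto)
  moreover have "of_rat (q v) * x v = - (\<Sum>u\<in>T - {v}. of_rat (q u) * x u)"
    using q(2) T(1) v(1) by (simp add: sum.remove add_eq_0_iff2)
  then have "v (of_rat (q v) * x v) = v (\<Sum>u\<in>T - {v}. of_rat (q u) * x u)"
    using place_uminus[OF K pl(1)[OF v(1)], of "\<Sum>u\<in>T - {v}. of_rat (q u) * x u"] t K
      number_fieldD(6)[OF K, of "T - {v}" "\<lambda>u. of_rat (q u) * x u"] by simp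
  ultimately have "M * v (x v) \<le> M" using val[OF v(1)] v by simp
  then show False using M0 x(2)[OF v(1)] by simp
qed

lemma finite_padic_val_nonzero:
  assumes "q \<noteq> 0"
  shows "finite {p. prime p \<and> padic_val p q \<noteq> 0}"
proof -
  obtain a b where ab: "quotient_of q = (a, b)" by force
  have "b \<noteq> 0" using quotient_of_denom_pos[OF ab] by simp
  moreover have "a \<noteq> 0" using assms quotient_of_div[OF ab] by auto
  moreover have "{p. prime p \<and> padic_val p q \<noteq> 0} \<subseteq> {p. p dvd nat \<bar>a\<bar>} \<union> {p. p dvd nat \<bar>b\<bar>}"
  proof clarify
    fix p assume "prime p" "padic_val p q \<noteq> 0" "\<not> p dvd nat \<bar>b\<bar>"
    then have "multiplicity (int p) a \<noteq> 0"
      by (auto simp: padic_val_def ab not_dvd_imp_multiplicity_0 dvd_nat_abs_iff)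
    then have "int p dvd a" by (metis not_dvd_imp_multiplicity_0)
    then show "p dvd nat \<bar>a\<bar>" by (simp add: dvd_nat_abs_iff)
  qed
  moreover have "finite {p. p dvd nat \<bar>n\<bar>}" if "n \<noteq> 0" for n :: int
    using that by (intro finite_divisors_nat) simp
  ultimately show ?thesis by (meson finite_Un finite_subset)
qed

text \<open>Away from the finitely many primes occurring in the nonzero coefficients of a relation
  for \<open>x\<close>, these coefficients have value 1. Two associated terms then give
  \<open>v x ^ i = v x ^ j\<close> with distinct exponents, so \<open>v x = 1\<close>.\<close>

theorem finite_places_neq_1:
  assumes K: "number_field K" and x: "x \<in> K" "x \<noteq> 0"
  shows "finite {v. place K v \<and> v x \<noteq> 1}"
proof -
  obtain B where B: "finite B" "K \<subseteq> qv.span B" using number_field_finite_span[OF K] .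
  obtain q where q: "\<exists>i\<le>card B. q i \<noteq> 0" "(\<Sum>i\<le>card B. of_rat (q i) * x ^ i) = 0"
    using power_relation[OF B(1) number_field_subring[OF K] B(2) x(1)] by blast
  define S where "S = (\<Union>i\<in>{i. i \<le> card B \<and> q i \<noteq> 0}. {p. prime p \<and> padic_val p (q i) \<noteq> 0})"
  have "finite S" unfolding S_def using finite_padic_val_nonzero by (intro finite_UN_I) auto
  then have "finite (\<Union>p\<in>S. {v. place K v \<and> place_prime v = p})"
    using finite_places_over_prime[OF K] by (intro finite_UN_I) auto
  moreover have "{v. place K v \<and> v x \<noteq> 1} \<subseteq> (\<Union>p\<in>S. {v. place K v \<and> place_prime v = p})"
  proof (clarsimp, rule ccontr)
    fix v assume v: "place K v" "v x \<noteq> 1" "place_prime v \<notin> S"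
    have one: "v (of_rat (q i)) = 1" if "i \<le> card B" "q i \<noteq> 0" for i
      using v(3) that prime_place_prime[OF K v(1)] place_of_rat_powi[OF K v(1), of "q i"] by (auto simp: S_def)
    obtain i0 where "i0 \<in> {..card B}" "of_rat (q i0) * x ^ i0 \<noteq> 0" using q x by auto
    then obtain i j where ij: "i \<le> card B" "j \<le> card B" "i \<noteq> j" "q i \<noteq> 0" "q j \<noteq> 0"
      "ring_unit {x\<in>K. v x \<le> 1} ((of_rat (q i) * x ^ i) / (of_rat (q j) * x ^ j))"
      using zero_sum_two_associated[OF place_valuation_ring[OF K v(1)] K _ _ _ _ q(2), of i0] K x
      by (auto simp: number_fieldD)
    then have eq: "v x ^ i = v x ^ j"
      using K x one by (simp add: place_ring_unit_iff[OF K v(1)] place_mult[OF K v(1)] place_divide[OF K v(1)]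
        place_power[OF K v(1)] number_fieldD divide_eq_1_iff)
    have "v x > 0" using place_pos[OF K v(1) x] .
    then show False using ij(3) v(2) eq by (simp add: power_inject_exp')
  qed
  ultimately show ?thesis by (rule finite_subset[rotated])
qed

section \<open>Integers, norm and almost principal ideals\<close>

text \<open>By the two integrality criteria this is the ring of algebraic integers in
  \<open>K\<close>; the local form allows membership to be checked place by place.\<close>

definition place_integers :: "complex set \<Rightarrow> complex set" where
  "place_integers K = {x\<in>K. \<forall>v. place K v \<longrightarrow> v x \<le> 1}"

lemma place_integersD: "x \<in> place_integers K \<Longrightarrow> x \<in> K" "x \<in> place_integers K \<Longrightarrow> place K v \<Longrightarrow> v x \<le> 1"
  by (auto simp: place_integers_def)

lemma subring_place_integers:
  assumes K: "number_field K"
  shows "subring (place_integers K)"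
proof -
  have *: "subring {x\<in>K. v x \<le> 1}" if "place K v" for v
    using place_valuation_ring[OF K that] by (simp add: valuation_ring_def)
  show ?thesis
    unfolding subring_def
  proof (intro conjI ballI)
    fix x y assume x: "x \<in> place_integers K" and y: "y \<in> place_integers K"
    then show "x + y \<in> place_integers K" "x - y \<in> place_integers K" "x * y \<in> place_integers K"
      using subringD(3-5)[OF *, of _ x y] number_fieldD(3-5)[OF K, of x y] by (auto simp: place_integers_def)
  qed (use subringD(1,2)[OF *] number_fieldD(1,2)[OF K] in \<open>auto simp: place_integers_def\<close>)
qed

text \<open>The last conclusion matters for the construction of isolating elements: where
  \<open>x\<close> is integral at all places over p, clearing denominators leaves its values over p
  unchanged.\<close>

lemma exists_denominator:
  assumes K: "number_field K" and x: "x \<in> K"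
  obtains D :: nat where "D > 0" "of_nat D * x \<in> place_integers K"
    "\<And>p. prime p \<Longrightarrow> (\<And>v. place K v \<Longrightarrow> place_prime v = p \<Longrightarrow> v x \<le> 1) \<Longrightarrow> \<not> p dvd D"
proof -
  define W where "W = {v. place K v \<and> v x > 1}"
  have fin: "finite W"
  proof (cases "x = 0")
    case True
    then have "\<not> v x > 1" if "place K v" for v using place_0[OF K that] by simp
    then have "W = {}" by (auto simp: W_def)
    then show ?thesis by simp
  next
    case False
    show ?thesis by (rule finite_subset[OF _ finite_places_neq_1[OF K x False]]) (auto simp: W_def)
  qed
  have WK: "place K w" if "w \<in> W" for w using that by (simp add: W_def)
  \<comment> \<open>Base 2 suffices because every residue prime is at least 2: the factor of
    \<open>D\<close> belonging to a place of \<open>W\<close> contributes at most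
    \<open>(1 / 2) ^ k\<close> there.\<close>
  obtain k where k: "Max (insert 1 ((\<lambda>w. w x) ` W)) < 2 ^ k" using real_arch_pow[of 2] by auto
  have k: "w x \<le> 2 ^ k" if "w \<in> W" for w
    using k fin that Max_ge[of "insert 1 ((\<lambda>w. w x) ` W)" "w x"] by auto
  define D where "D = (\<Prod>w\<in>W. place_prime w ^ k)"
  have "D > 0" unfolding D_def using prime_gt_0_nat[OF prime_place_prime[OF K WK]] by (intro prod_pos) auto
  moreover have "of_nat D * x \<in> place_integers K"
    unfolding place_integers_def
  proof (safe)
    show "of_nat D * x \<in> K" using K x by (intro number_fieldD)
    fix u assume u: "place K u"
    have m: "u (of_nat D * x) = u (of_nat D) * u x" using K x by (simp add: place_mult[OF K u] number_fieldD)
    show "u (of_nat D * x) \<le> 1"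
    proof (cases "u \<in> W")
      case False
      then show ?thesis unfolding m using place_of_nat_le_1[OF K u, of D] place_nonneg[OF K u] u
        by (intro mult_le_one) (auto simp: W_def)
    next
      case True
      let ?p = "place_prime u" and ?r = "\<Prod>w\<in>W - {u}. place_prime w ^ k"
      have "D = ?p ^ k * ?r" unfolding D_def using fin True by (simp add: prod.remove)
      then have "u (of_nat D) = (1 / real ?p) ^ k * u (of_nat ?r)"
        using K by (simp add: place_mult[OF K u] place_power[OF K u] number_fieldD place_place_prime[OF K u] del: of_nat_prod)
      also have "\<dots> \<le> (1 / real ?p) ^ k" using place_of_nat_le_1[OF K u, of ?r] by (intro mult_left_le) auto
      also have "\<dots> \<le> (1 / 2) ^ k"
        using prime_ge_2_nat[OF prime_place_prime[OF K u]] by (intro power_mono) (auto simp: field_simps)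
      finally have "u (of_nat D) * u x \<le> (1 / 2) ^ k * 2 ^ k"
        using k[OF True] place_nonneg[OF K u] by (intro mult_mono) auto
      then show ?thesis unfolding m by (simp add: power_mult_distrib[symmetric])
    qed
  qed
  moreover have "\<not> p dvd D" if p: "prime p" "\<And>v. place K v \<Longrightarrow> place_prime v = p \<Longrightarrow> v x \<le> 1" for p
  proof
    assume "p dvd D"
    then obtain w where w: "w \<in> W" "p dvd place_prime w ^ k"
      unfolding D_def using p(1) fin by (auto simp: prime_dvd_prod_iff)
    then have "p = place_prime w"
      using p(1) prime_place_prime[OF K WK[OF w(1)]] by (metis prime_dvd_power primes_dvd_imp_eq)
    then show False using p(2)[of w] w(1) by (auto simp: W_def)
  qed
  ultimately show thesis using that by blast
qed

text \<open>A rational basis of \<open>K\<close> consisting of integers, obtained by scaling; it is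
  not claimed to generate \<open>place_integers K\<close> over the integers. Coordinates of integers
  may thus be fractions, and integrality of the norm takes a separate argument.\<close>

lemma exists_integral_basis:
  assumes K: "number_field K"
  obtains n and b :: "nat \<Rightarrow> complex" and c :: "complex \<Rightarrow> nat \<Rightarrow> rat" where
    "n > 0" "\<And>i. i < n \<Longrightarrow> b i \<in> place_integers K"
    "\<And>x. x \<in> K \<Longrightarrow> x = (\<Sum>i<n. of_rat (c x i) * b i)"
    "\<And>x q i. x = (\<Sum>i<n. of_rat (q i) * b i) \<Longrightarrow> i < n \<Longrightarrow> c x i = q i"
proof -
  obtain B0 where B0: "finite B0" "K \<subseteq> qv.span B0" using number_field_finite_span[OF K] .
  obtain B where B: "B \<subseteq> K" "qv.independent B" "K \<subseteq> qv.span B" using qv.maximal_independent_subset .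
  have fin: "finite B" using qv.independent_span_bound[OF B0(1) B(2)] B B0 by blast
  define n where "n = card B"
  obtain f where f: "bij_betw f {..<n} B"
    using ex_bij_betw_nat_finite[OF fin] by (auto simp: n_def atLeast0LessThan)
  have fB: "f i \<in> B" if "i < n" for i using f that by (auto simp: bij_betw_def)
  have "\<exists>D::nat. D > 0 \<and> of_nat D * f i \<in> place_integers K" if "i < n" for i
    using exists_denominator[OF K, of "f i"] fB[OF that] B(1) by blast
  then obtain D :: "nat \<Rightarrow> nat" where D: "\<And>i. i < n \<Longrightarrow> D i > 0" "\<And>i. i < n \<Longrightarrow> of_nat (D i) * f i \<in> place_integers K"
    by metis
  have indep: "r i = 0" if r: "(\<Sum>i<n. of_rat (r i) * f i) = 0" "i < n" for r :: "nat \<Rightarrow> rat" and i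
  proof -
    define u where "u = (\<lambda>x. r (the_inv_into {..<n} f x))"
    have u: "u (f i) = r i" if "i < n" for i
      using the_inv_into_f_f[of f "{..<n}" i] f that by (auto simp: u_def bij_betw_def)
    have "(\<Sum>x\<in>B. of_rat (u x) * x) = (\<Sum>i<n. of_rat (u (f i)) * f i)"
      by (rule sum.reindex_bij_betw[OF f, symmetric])
    also have "\<dots> = 0" using r(1) by (simp add: u)
    finally have "\<forall>x\<in>B. u x = 0" using B(2) qv.dependent_finite[OF fin] by blast
    then show ?thesis using u[OF r(2)] fB[OF r(2)] by simp
  qed
  define b where "b = (\<lambda>i. of_nat (D i) * f i)"
  define c where "c = (\<lambda>x i. qv.representation B x (f i) / of_nat (D i))"
  have exp: "x = (\<Sum>i<n. of_rat (c x i) * b i)" if x: "x \<in> K" for x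
  proof -
    have "x = (\<Sum>y\<in>B. of_rat (qv.representation B x y) * y)"
      using qv.sum_representation_eq[OF B(2) _ fin subset_refl, of x] x B(3) by auto
    also have "\<dots> = (\<Sum>i<n. of_rat (qv.representation B x (f i)) * f i)"
      by (rule sum.reindex_bij_betw[OF f, symmetric])
    also have "\<dots> = (\<Sum>i<n. of_rat (c x i) * b i)"
    proof (rule sum.cong)
      fix i assume "i \<in> {..<n}"
      then have "D i \<noteq> 0" using D(1)[of i] by simp
      then show "of_rat (qv.representation B x (f i)) * f i = of_rat (c x i) * b i"
        by (simp add: c_def b_def of_rat_divide)
    qed simp
    finally show ?thesis .
  qed
  have bK: "b i \<in> K" if "i < n" for i using D(2)[OF that] by (simp add: b_def place_integers_def)
  have uniq: "c x i = q i" if x: "x = (\<Sum>i<n. of_rat (q i) * b i)" and i: "i < n" for x q i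
  proof -
    have "x \<in> K" unfolding x using K bK by (intro number_fieldD) auto
    from exp[OF this] x have "(\<Sum>i<n. of_rat (q i) * b i) = (\<Sum>i<n. of_rat (c x i) * b i)" by simp
    then have "(\<Sum>i<n. of_rat ((q i - c x i) * of_nat (D i)) * f i) = 0"
      by (simp add: b_def of_rat_mult of_rat_diff algebra_simps sum_subtractf)
    from indep[OF this i] show ?thesis using D(1)[OF i] by simp
  qed
  have "n > 0" using exp[OF number_fieldD(2)[OF K]] by (cases "n = 0") auto
  then show thesis using that[of n b c] D(2) exp uniq by (auto simp: b_def)
qed

text \<open>In lowest terms every power of the denominator \<open>b\<close> divides
  \<open>C\<close>, and for \<open>b\<close> at least 2 the exponent
  \<open>nat \<bar>C\<bar>\<close> already makes that power too large.\<close>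

lemma rat_Ints_if_powers_bounded_denominator:
  fixes q :: rat and C :: int
  assumes C: "C \<noteq> 0" and *: "\<And>k. of_int C * q ^ k \<in> \<int>"
  shows "q \<in> \<int>"
proof -
  obtain a b where ab: "quotient_of q = (a, b)" by force
  have b: "b > 0" and q: "q = of_int a / of_int b" and cop: "coprime a b"
    using quotient_of_denom_pos[OF ab] quotient_of_div[OF ab] quotient_of_coprime[OF ab] by auto
  have dvd: "b ^ k dvd C" for k
  proof -
    obtain z where "of_int C * q ^ k = of_int z" using * Ints_cases by metis
    then have "of_int (C * a ^ k) = (of_int (z * b ^ k) :: rat)"
      using b by (simp add: q power_divide field_simps)
    then have "b ^ k dvd C * a ^ k" by (metis dvd_triv_right of_int_eq_iff)
    then show ?thesis using cop by (metis coprime_commute coprime_dvd_mult_left_iff coprime_power_left_iff coprime_power_right_iff)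
  qed
  have "b = 1"
  proof (rule ccontr)
    assume "b \<noteq> 1"
    then have "2 \<le> b" using b by simp
    let ?k = "nat \<bar>C\<bar>"
    have "\<bar>C\<bar> < 2 ^ ?k" using of_nat_less_two_power[of ?k, where 'a=int] by simp
    also have "\<dots> \<le> b ^ ?k" using \<open>2 \<le> b\<close> by (intro power_mono) auto
    also have "\<dots> \<le> \<bar>C\<bar>" using dvd_imp_le_int[OF C dvd] b by simp
    finally show False by simp
  qed
  then show ?thesis using q by simp
qed

lemma common_denominator:
  assumes "finite (S :: rat set)"
  shows "\<exists>D::int. D > 0 \<and> (\<forall>q\<in>S. of_int D * q \<in> \<int>)"
  using assms
proof (induction S rule: finite_induct)
  case empty
  show ?case by (rule exI[of _ 1]) auto
next
  case (insert q S)
  then obtain D where D: "D > 0" "\<forall>q\<in>S. of_int D * q \<in> \<int>" by auto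
  obtain a b where ab: "quotient_of q = (a, b)" by force
  have b: "b > 0" and q: "q = of_int a / of_int b"
    using quotient_of_denom_pos[OF ab] quotient_of_div[OF ab] by auto
  have "of_int (b * D) * r \<in> \<int>" if "r \<in> S" for r
  proof -
    have "of_int (b * D) * r = of_int b * (of_int D * r)" by simp
    then show ?thesis using D that by (metis Ints_mult Ints_of_int)
  qed
  moreover have "of_int (b * D) * q \<in> \<int>" using b by (simp add: q)
  ultimately show ?case using D b by (intro exI[of _ "b * D"]) auto
qed

text \<open>Reduction modulo a monic integral polynomial. Finitely many powers serve all
  \<open>k\<close>, which gives the multiplication matrices of all powers of \<open>x\<close> one
  common denominator.\<close>

lemma alg_int_power_span:
  assumes "alg_int x"
  obtains m where "\<And>k. \<exists>z :: nat \<Rightarrow> int. x ^ k = (\<Sum>l<m. of_int (z l) * x ^ l)"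
proof -
  obtain p where p: "lead_coeff p = 1" "\<forall>i. coeff p i \<in> \<int>" "poly p x = 0"
    using assms unfolding alg_int_def by blast
  have "\<forall>i. \<exists>z::int. coeff p i = of_int z" using p(2) by (metis Ints_cases)
  then obtain a :: "nat \<Rightarrow> int" where a: "\<And>i. coeff p i = of_int (a i)" by metis
  let ?m = "degree p"
  have xm: "x ^ ?m = - (\<Sum>i<?m. of_int (a i) * x ^ i)"
    using p(1,3) by (simp add: poly_altdef lessThan_Suc_atMost[symmetric] add_eq_0_iff a)
  have "\<exists>z :: nat \<Rightarrow> int. x ^ k = (\<Sum>l<?m. of_int (z l) * x ^ l)" for k
  proof (induction k rule: less_induct)
    case (less k)
    show ?case
    proof (cases "k < ?m")
      case True
      then show ?thesis
        by (intro exI[of _ "\<lambda>l. if l = k then 1 else 0"]) (simp add: if_distrib[of of_int] if_distrib[of "\<lambda>r. r * _"] sum.delta cong: if_cong)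
    next
      case False
      have "\<forall>i<?m. \<exists>z :: nat \<Rightarrow> int. x ^ (k - ?m + i) = (\<Sum>l<?m. of_int (z l) * x ^ l)"
        using False less.IH by auto
      then obtain z :: "nat \<Rightarrow> nat \<Rightarrow> int"
        where z: "\<And>i. i < ?m \<Longrightarrow> x ^ (k - ?m + i) = (\<Sum>l<?m. of_int (z i l) * x ^ l)" by metis
      have "x ^ k = x ^ (k - ?m) * x ^ ?m" using False by (simp add: power_add[symmetric])
      also have "\<dots> = - (\<Sum>i<?m. of_int (a i) * x ^ (k - ?m + i))"
        unfolding xm by (simp add: sum_distrib_left power_add mult_ac)
      also have "\<dots> = - (\<Sum>i<?m. \<Sum>l<?m. of_int (a i * z i l) * x ^ l)"
        by (simp add: z sum_distrib_left mult_ac)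
      also have "\<dots> = (\<Sum>l<?m. of_int (- (\<Sum>i<?m. a i * z i l)) * x ^ l)"
        by (subst sum.swap) (simp add: sum_distrib_right sum_negf)
      finally show ?thesis by (rule exI[of _ "\<lambda>l. - (\<Sum>i<?m. a i * z i l)"])
    qed
  qed
  then show thesis using that by blast
qed

lemma det_abs_le:
  fixes A :: "rat mat"
  assumes A: "A \<in> carrier_mat n n" and e: "\<And>i j. i < n \<Longrightarrow> j < n \<Longrightarrow> \<bar>A $$ (i, j)\<bar> \<le> e"
  shows "\<bar>det A\<bar> \<le> of_nat (fact n) * e ^ n"
proof -
  have "\<bar>det A\<bar> \<le> (\<Sum>p | p permutes {0..<n}. \<bar>of_int (sign p) * (\<Prod>i = 0..<n. A $$ (i, p i))\<bar>)"
    unfolding det_def'[OF A] by (rule sum_abs)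
  also have "\<dots> \<le> (\<Sum>p | p permutes {0..<n}. e ^ n)"
  proof (rule sum_mono)
    fix p assume "p \<in> {p. p permutes {0..<n}}"
    then have p: "p i < n" if "i < n" for i using that permutes_in_image[of p "{0..<n}" i] by auto
    have "\<bar>of_int (sign p) * (\<Prod>i = 0..<n. A $$ (i, p i))\<bar> = (\<Prod>i = 0..<n. \<bar>A $$ (i, p i)\<bar>)"
      by (simp add: abs_mult abs_prod sign_def)
    also have "\<dots> \<le> (\<Prod>i = 0..<n. e)" using e p by (intro prod_mono) auto
    finally show "\<bar>of_int (sign p) * (\<Prod>i = 0..<n. A $$ (i, p i))\<bar> \<le> e ^ n" by simp
  qed
  also have "\<dots> = of_nat (fact n) * e ^ n"
    using card_permutations[of "{0..<n}" n] by simp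
  finally show ?thesis .
qed

lemma det_Ints:
  fixes A :: "rat mat"
  assumes A: "A \<in> carrier_mat n n" and e: "\<And>i j. i < n \<Longrightarrow> j < n \<Longrightarrow> A $$ (i, j) \<in> \<int>"
  shows "det A \<in> \<int>"
  unfolding det_def'[OF A]
proof (intro Ints_sum Ints_mult Ints_of_int Ints_prod)
  fix p i assume "p \<in> {p. p permutes {0..<n}}" "i \<in> {0..<n}"
  then show "A $$ (i, p i) \<in> \<int>" using e permutes_in_image[of p "{0..<n}" i] by auto
qed

section \<open>The norm as a determinant, and Hurwitz' pigeonhole argument\<close>

locale integral_basis =
  fixes K :: "complex set" and n :: nat and b :: "nat \<Rightarrow> complex" and c :: "complex \<Rightarrow> nat \<Rightarrow> rat"
  assumes K: "number_field K" and n: "n > 0" and b: "\<And>i. i < n \<Longrightarrow> b i \<in> place_integers K"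
    and expand: "\<And>x. x \<in> K \<Longrightarrow> x = (\<Sum>i<n. of_rat (c x i) * b i)"
    and coord: "\<And>x q i. x = (\<Sum>i<n. of_rat (q i) * b i) \<Longrightarrow> i < n \<Longrightarrow> c x i = q i"
begin

lemma basis_in_K: "i < n \<Longrightarrow> b i \<in> K"
  using b by (simp add: place_integers_def)

lemma coord_sum:
  assumes "finite I" "\<And>k. k \<in> I \<Longrightarrow> y k \<in> K" "i < n"
  shows "c (\<Sum>k\<in>I. of_rat (r k) * y k) i = (\<Sum>k\<in>I. r k * c (y k) i)"
proof (rule coord[OF _ assms(3)])
  have "(\<Sum>k\<in>I. of_rat (r k) * y k) = (\<Sum>k\<in>I. of_rat (r k) * (\<Sum>i<n. of_rat (c (y k) i) * b i))"
    using expand assms(2) by (intro sum.cong) auto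
  also have "\<dots> = (\<Sum>i<n. \<Sum>k\<in>I. of_rat (r k * c (y k) i) * b i)"
    unfolding sum_distrib_left by (subst sum.swap) (simp add: of_rat_mult mult_ac)
  also have "\<dots> = (\<Sum>i<n. of_rat (\<Sum>k\<in>I. r k * c (y k) i) * b i)"
    by (simp add: of_rat_sum sum_distrib_right)
  finally show "(\<Sum>k\<in>I. of_rat (r k) * y k) = (\<Sum>i<n. of_rat (\<Sum>k\<in>I. r k * c (y k) i) * b i)" .
qed

text \<open>Multiplication by \<open>x\<close> in the basis \<open>b\<close>, with the coordinates
  of \<open>x * b i\<close> in row \<open>i\<close>; its determinant is the norm from
  \<open>K\<close> to Q.\<close>

definition mulmat :: "complex \<Rightarrow> rat mat" where
  "mulmat x = mat n n (\<lambda>(i, j). c (x * b i) j)"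

lemma mulmat_carrier: "mulmat x \<in> carrier_mat n n"
  by (simp add: mulmat_def)

lemma mulmat_mult:
  assumes x: "x \<in> K" and y: "y \<in> K"
  shows "mulmat (x * y) = mulmat x * mulmat y"
proof (rule eq_matI)
  fix i j assume "i < dim_row (mulmat x * mulmat y)" "j < dim_col (mulmat x * mulmat y)"
  then have i: "i < n" and j: "j < n" by (auto simp: mulmat_def)
  have "x * y * b i = y * (\<Sum>k<n. of_rat (c (x * b i) k) * b k)"
    using expand[of "x * b i"] x basis_in_K[OF i] K by (simp add: number_fieldD mult_ac)
  also have "\<dots> = (\<Sum>k<n. of_rat (c (x * b i) k) * (y * b k))" by (simp add: sum_distrib_left mult_ac)
  finally have "c (x * y * b i) j = (\<Sum>k<n. c (x * b i) k * c (y * b k) j)"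
    using coord_sum[of "{..<n}" "\<lambda>k. y * b k" j "c (x * b i)"] y basis_in_K K j by (simp add: number_fieldD)
  then show "mulmat (x * y) $$ (i, j) = (mulmat x * mulmat y) $$ (i, j)"
    using i j by (simp add: mulmat_def scalar_prod_def atLeast0LessThan)
qed (auto simp: mulmat_def)

lemma mulmat_1: "mulmat 1 = 1\<^sub>m n"
proof (rule eq_matI)
  fix i j assume "i < dim_row (1\<^sub>m n :: rat mat)" "j < dim_col (1\<^sub>m n :: rat mat)"
  then have i: "i < n" and j: "j < n" by auto
  have "c (b i) j = (if j = i then 1 else 0)"
    by (rule coord[OF _ j]) (use i in \<open>simp add: if_distrib[of of_rat] if_distrib[of "\<lambda>r. r * _"] sum.delta cong: if_cong\<close>)
  then show "mulmat 1 $$ (i, j) = 1\<^sub>m n $$ (i, j)" using i j by (simp add: mulmat_def)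
qed (auto simp: mulmat_def)

lemma det_mulmat_mult: "x \<in> K \<Longrightarrow> y \<in> K \<Longrightarrow> det (mulmat (x * y)) = det (mulmat x) * det (mulmat y)"
  by (simp add: mulmat_mult det_mult[OF mulmat_carrier mulmat_carrier])

lemma det_mulmat_power: "x \<in> K \<Longrightarrow> det (mulmat (x ^ k)) = det (mulmat x) ^ k"
  by (induction k) (simp_all add: mulmat_1 det_mulmat_mult number_fieldD[OF K])

lemma det_mulmat_nonzero:
  assumes "x \<in> K" "x \<noteq> 0"
  shows "det (mulmat x) \<noteq> 0"
proof -
  have "det (mulmat x) * det (mulmat (inverse x)) = 1"
    using det_mulmat_mult[of x "inverse x"] assms K by (simp add: number_fieldD mulmat_1)
  then show ?thesis by auto
qed

text \<open>A common denominator \<open>D\<close> of the entries for the first \<open>m\<close>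
  powers of \<open>x\<close> works for every power, so \<open>D ^ n\<close> times each power of the
  norm is an integer. A rational number whose powers have bounded denominators is an
  integer.\<close>

lemma det_mulmat_Ints:
  assumes x: "x \<in> place_integers K"
  shows "det (mulmat x) \<in> \<int>"
proof -
  have xK: "x \<in> K" using x by (simp add: place_integers_def)
  have "alg_int x" using alg_int_if_places_le_1[OF K xK] x by (simp add: place_integers_def)
  then obtain m where m: "\<And>k. \<exists>z :: nat \<Rightarrow> int. x ^ k = (\<Sum>l<m. of_int (z l) * x ^ l)"
    using alg_int_power_span by blast
  define S where "S = (\<lambda>(l,i,j). c (x ^ l * b i) j) ` ({..<m} \<times> {..<n} \<times> {..<n})"
  have "finite S" by (simp add: S_def)
  then obtain D :: int where D: "D > 0" "\<And>q. q \<in> S \<Longrightarrow> of_int D * q \<in> \<int>" using common_denominator by blast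
  have "of_int (D ^ n) * det (mulmat x) ^ k \<in> \<int>" for k
  proof -
    obtain z :: "nat \<Rightarrow> int" where z: "x ^ k = (\<Sum>l<m. of_int (z l) * x ^ l)" using m by blast
    let ?A = "of_int D \<cdot>\<^sub>m mulmat (x ^ k)"
    have A: "?A \<in> carrier_mat n n" using mulmat_carrier by simp
    have "?A $$ (i, j) \<in> \<int>" if i: "i < n" and j: "j < n" for i j
    proof -
      have "x ^ k * b i = (\<Sum>l<m. of_rat (of_int (z l)) * (x ^ l * b i))"
        unfolding z sum_distrib_right by (simp add: mult_ac)
      then have "c (x ^ k * b i) j = (\<Sum>l<m. of_int (z l) * c (x ^ l * b i) j)"
        using coord_sum[of "{..<m}" "\<lambda>l. x ^ l * b i" j "\<lambda>l. of_int (z l)"] j xK basis_in_K[OF i] K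
        by (simp add: number_fieldD)
      then have "?A $$ (i, j) = (\<Sum>l<m. of_int (z l) * (of_int D * c (x ^ l * b i) j))"
        using i j by (simp add: mulmat_def sum_distrib_left mult_ac)
      also have "\<dots> \<in> \<int>"
      proof (rule Ints_sum)
        fix l assume "l \<in> {..<m}"
        then have "c (x ^ l * b i) j \<in> S" using i j by (force simp: S_def)
        then show "of_int (z l) * (of_int D * c (x ^ l * b i) j) \<in> \<int>" by (intro Ints_mult[OF Ints_of_int] D)
      qed
      finally show ?thesis .
    qed
    then have "det ?A \<in> \<int>" by (rule det_Ints[OF A])
    moreover have "det ?A = of_int D ^ n * det (mulmat x) ^ k"
      using det_mulmat_power[OF xK] mulmat_carrier[of "x ^ k"] by simp
    ultimately show ?thesis by simp
  qed
  moreover have "D ^ n \<noteq> 0" using D(1) by simp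
  ultimately show ?thesis by (rule rat_Ints_if_powers_bounded_denominator[rotated])
qed

text \<open>The norm is homogeneous of degree \<open>n\<close> in the coordinates. If
  \<open>A\<close> bounds the structure constants of the basis, matrix entries are at most
  \<open>n * A * e\<close>; with \<open>fact n\<close> terms in the Leibniz formula this gives
  \<open>C = fact n * (n * A) ^ n\<close>.\<close>

lemma small_coords_small_norm:
  obtains C :: rat where "\<And>y e. y \<in> K \<Longrightarrow> (\<And>i. i < n \<Longrightarrow> \<bar>c y i\<bar> \<le> e) \<Longrightarrow> \<bar>det (mulmat y)\<bar> \<le> C * e ^ n"
proof -
  let ?S = "(\<lambda>(k,i,j). \<bar>c (b k * b i) j\<bar>) ` ({..<n} \<times> {..<n} \<times> {..<n})"
  define A where "A = Max ?S"
  have A: "\<bar>c (b k * b i) j\<bar> \<le> A" if "k < n" "i < n" "j < n" for k i j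
    unfolding A_def using that by (intro Max_ge) force+
  have "\<bar>det (mulmat y)\<bar> \<le> (of_nat (fact n) * (of_nat n * A) ^ n) * e ^ n"
    if y: "y \<in> K" and e: "\<And>i. i < n \<Longrightarrow> \<bar>c y i\<bar> \<le> e" for y e
  proof -
    have "\<bar>det (mulmat y)\<bar> \<le> of_nat (fact n) * (of_nat n * A * e) ^ n"
    proof (rule det_abs_le[OF mulmat_carrier])
      fix i j assume i: "i < n" and j: "j < n"
      have "y * b i = (\<Sum>k<n. of_rat (c y k) * (b k * b i))"
        by (subst expand[OF y], unfold sum_distrib_right) (simp add: mult_ac)
      then have "\<bar>c (y * b i) j\<bar> = \<bar>\<Sum>k<n. c y k * c (b k * b i) j\<bar>"
        using coord_sum[of "{..<n}" "\<lambda>k. b k * b i" j "c y"] j basis_in_K i K by (simp add: number_fieldD)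
      also have "\<dots> \<le> (\<Sum>k<n. \<bar>c y k * c (b k * b i) j\<bar>)" by (rule sum_abs)
      also have "\<dots> \<le> (\<Sum>k<n. e * A)"
        unfolding abs_mult using e A i j
        by (intro sum_mono mult_mono) (auto intro: order_trans[OF abs_ge_zero])
      finally show "\<bar>mulmat y $$ (i, j)\<bar> \<le> of_nat n * A * e"
        using i j by (simp add: mulmat_def mult_ac)
    qed
    then show ?thesis by (simp add: power_mult_distrib mult_ac)
  qed
  then show thesis using that by blast
qed

text \<open>Among \<open>m ^ n + 1\<close> multiples of \<open>x\<close>, two have fractional
  coordinates in the same one of \<open>m ^ n\<close> boxes of side \<open>1 / m\<close>. Their
  difference is within \<open>1 / m\<close> of an integer in each coordinate, and the norm of the
  error is at most \<open>C * (1 / m) ^ n\<close>, hence below 1 once \<open>m\<close> exceeds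
  \<open>C\<close>. So \<open>M = m ^ n\<close> serves all \<open>x\<close>.\<close>

lemma multiple_near_integer:
  obtains M :: nat where
    "\<And>x. x \<in> K \<Longrightarrow> \<exists>t\<in>{1..M}. \<exists>w\<in>place_integers K. \<bar>det (mulmat (of_nat t * x - w))\<bar> < 1"
proof -
  obtain C :: rat where C: "\<And>y e. y \<in> K \<Longrightarrow> (\<And>i. i < n \<Longrightarrow> \<bar>c y i\<bar> \<le> e) \<Longrightarrow> \<bar>det (mulmat y)\<bar> \<le> C * e ^ n"
    using small_coords_small_norm by blast
  obtain m0 :: nat where "C < of_nat m0" using reals_Archimedean2 by blast
  define m where "m = Suc m0"
  have m: "m > 0" "C < of_nat m" using \<open>C < of_nat m0\<close> by (auto simp: m_def)
  have "\<exists>t\<in>{1..m ^ n}. \<exists>w\<in>place_integers K. \<bar>det (mulmat (of_nat t * x - w))\<bar> < 1" if x: "x \<in> K" for x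
  proof -
    define h where "h = (\<lambda>t i. \<lfloor>of_nat m * frac (of_nat t * c x i)\<rfloor>)"
    define g where "g = (\<lambda>t::nat. restrict (h t) {..<n})"
    have "h t i \<in> {0..<int m}" for t i
    proof -
      have "of_nat m * frac (of_nat t * c x i) < of_nat m * 1"
        using m(1) frac_lt_1[of "of_nat t * c x i"] by (intro mult_strict_left_mono) auto
      then show ?thesis using frac_ge_0[of "of_nat t * c x i"] by (auto simp: h_def floor_less_iff)
    qed
    then have "g ` {0..m ^ n} \<subseteq> {..<n} \<rightarrow>\<^sub>E {0..<int m}"      unfolding g_def by (intro image_subsetI restrict_PiE_iff[THEN iffD2]) simp
    then have "card (g ` {0..m ^ n}) \<le> card ({..<n} \<rightarrow>\<^sub>E {0..<int m})"
      by (intro card_mono finite_PiE) auto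
    also have "\<dots> = m ^ n" by (simp add: card_PiE)
    finally have "\<not> inj_on g {0..m ^ n}" using card_image[of g "{0..m ^ n}"] by auto
    then obtain s t where st: "s \<le> m ^ n" "t \<le> m ^ n" "s < t" "g s = g t"
      unfolding inj_on_def by (metis atLeastAtMost_iff linorder_neqE_nat)
    have hst: "h s i = h t i" if "i < n" for i
      using st(4) that unfolding g_def by (metis lessThan_iff restrict_apply')
    \<comment> \<open>Rounding both multiples down makes each coordinate of \<open>y\<close> a
      difference of two fractional parts from the same box.\<close>
    define z where "z = (\<lambda>i. \<lfloor>of_nat t * c x i\<rfloor> - \<lfloor>of_nat s * c x i\<rfloor>)"
    define w where "w = (\<Sum>i<n. of_int (z i) * b i)"
    have wO: "w \<in> place_integers K"
      unfolding w_def using b subring_place_integers[OF K] by (auto intro!: subring_sum subringD subring_of_int)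
    define y where "y = of_nat (t - s) * x - w"
    have y: "y \<in> K" unfolding y_def using wO x K by (auto simp: place_integers_def intro!: number_fieldD)
    have "y = of_nat (t - s) * (\<Sum>i<n. of_rat (c x i) * b i) - w"
      unfolding y_def using expand[OF x] by simp
    also have "\<dots> = (\<Sum>i<n. of_rat (of_nat (t - s) * c x i - of_int (z i)) * b i)"
      unfolding w_def sum_distrib_left sum_subtractf[symmetric]
      by (rule sum.cong) (simp_all add: of_rat_diff of_rat_mult left_diff_distrib mult.assoc)
    finally have yb: "y = (\<Sum>i<n. of_rat (of_nat (t - s) * c x i - of_int (z i)) * b i)" .
    have cy: "c y i = of_nat (t - s) * c x i - of_int (z i)" if "i < n" for i
      by (rule coord[OF yb that])
    have "\<bar>c y i\<bar> \<le> 1 / of_nat m" if i: "i < n" for i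
    proof -
      let ?a = "frac (of_nat t * c x i)" and ?b = "frac (of_nat s * c x i)"
      have "c y i = ?a - ?b"
        using cy[OF i] st(3) by (simp add: z_def frac_def of_nat_diff algebra_simps)
      moreover have "\<bar>of_nat m * ?a - of_nat m * ?b\<bar> < 1"
        using hst[OF i] unfolding h_def by linarith
      ultimately have "\<bar>of_nat m * c y i\<bar> < 1" by (simp only: right_diff_distrib)
      then show ?thesis using m(1) by (simp add: abs_mult field_simps)
    qed
    then have "\<bar>det (mulmat y)\<bar> \<le> C * (1 / of_nat m) ^ n" using C[OF y] by blast
    also have "\<dots> < of_nat m * (1 / of_nat m) ^ n" using m by (intro mult_strict_right_mono) auto
    also have "\<dots> \<le> of_nat m * (1 / of_nat m) ^ 1"
      using m n by (intro mult_left_mono power_decreasing) auto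
    also have "\<dots> = 1" using m by simp
    finally show ?thesis using wO st y_def by (intro bexI[of _ "t - s"] bexI[of _ w]) auto
  qed
  then show thesis using that by blast
qed

end

text \<open>Let \<open>a\<close> in \<open>I\<close> have least norm. For \<open>y\<close> in
  \<open>I\<close> some \<open>t\<close> up to \<open>M\<close> and some integer \<open>w\<close>
  make the norm of \<open>t * (y / a) - w\<close> less than 1, so \<open>t * y - w * a\<close> lies
  in \<open>I\<close> with norm below that of \<open>a\<close> and must vanish. Thus
  \<open>t * y / a\<close> is integral, and \<open>t\<close> divides \<open>fact M\<close>. The
  bound \<open>M\<close> is independent of \<open>I\<close>.\<close>

theorem ideals_almost_principal:
  assumes K: "number_field K"
  obtains M :: nat where "\<And>I. I \<subseteq> place_integers K \<Longrightarrow> (\<And>x y. x \<in> I \<Longrightarrow> y \<in> I \<Longrightarrow> x - y \<in> I) \<Longrightarrow>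
      (\<And>r x. r \<in> place_integers K \<Longrightarrow> x \<in> I \<Longrightarrow> r * x \<in> I) \<Longrightarrow> \<exists>x\<in>I. x \<noteq> 0 \<Longrightarrow>
      \<exists>a\<in>I. a \<noteq> 0 \<and> (\<forall>y\<in>I. of_nat (fact M) * y / a \<in> place_integers K)"
proof -
  obtain n b c where nbc: "n > (0::nat)" "\<And>i. i < n \<Longrightarrow> b i \<in> place_integers K"
    "\<And>x. x \<in> K \<Longrightarrow> x = (\<Sum>i<n. of_rat (c x i) * b i)"
    "\<And>x q i. x = (\<Sum>i<n. of_rat (q i) * b i) \<Longrightarrow> i < n \<Longrightarrow> c x i = q i"
    by (rule exists_integral_basis[OF K]) blast
  interpret integral_basis K n b c using K nbc by unfold_locales
  define N where "N x = \<bar>det (mulmat x)\<bar>" for x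
  have Nmult: "N (x * y) = N x * N y" if "x \<in> K" "y \<in> K" for x y
    using det_mulmat_mult[OF that] by (simp add: N_def abs_mult)
  have Npos: "N x > 0" if "x \<in> K" "x \<noteq> 0" for x
    using det_mulmat_nonzero[OF that] by (simp add: N_def)
  have Nint: "N x \<in> \<int>" if "x \<in> place_integers K" for x
    using det_mulmat_Ints[OF that] by (simp add: N_def)
  obtain M :: nat where M: "\<And>x. x \<in> K \<Longrightarrow> \<exists>t\<in>{1..M}. \<exists>w\<in>place_integers K. N (of_nat t * x - w) < 1"
    using multiple_near_integer unfolding N_def by blast
  note O = subring_place_integers[OF K]
  show thesis
  proof (rule that[of M])
    fix I assume I: "I \<subseteq> place_integers K" "\<And>x y. x \<in> I \<Longrightarrow> y \<in> I \<Longrightarrow> x - y \<in> I"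
      "\<And>r x. r \<in> place_integers K \<Longrightarrow> x \<in> I \<Longrightarrow> r * x \<in> I" "\<exists>x\<in>I. x \<noteq> 0"
    then obtain x0 where "x0 \<in> I \<and> x0 \<noteq> 0" by blast
    \<comment> \<open>Norms of elements of \<open>I\<close> are positive integers away from 0, so
      comparing \<open>nat\<close> floors compares the norms themselves.\<close>
    from ex_has_least_nat[of "\<lambda>x. x \<in> I \<and> x \<noteq> 0", OF this, of "\<lambda>x. nat \<lfloor>N x\<rfloor>"]
    obtain a where a: "a \<in> I" "a \<noteq> 0" "\<And>y. y \<in> I \<Longrightarrow> y \<noteq> 0 \<Longrightarrow> nat \<lfloor>N a\<rfloor> \<le> nat \<lfloor>N y\<rfloor>" by blast
    have IK: "x \<in> K" if "x \<in> I" for x using I(1) that by (auto simp: place_integers_def)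
    have min: "N a \<le> N y" if "y \<in> I" "y \<noteq> 0" for y
    proof -
      have "N a \<in> \<int>" "N y \<in> \<int>" using Nint I(1) a(1) that(1) by auto
      then obtain s t where "N a = of_int s" "N y = of_int t" by (auto elim!: Ints_cases)
      then show ?thesis using a(3)[OF that] Npos[OF IK[OF a(1)] a(2)] Npos[OF IK[OF that(1)] that(2)] by simp
    qed
    have "of_nat (fact M) * y / a \<in> place_integers K" if y: "y \<in> I" for y
    proof -
      have ya: "y / a \<in> K" using IK y a K by (simp add: number_fieldD)
      obtain t w where t: "t \<in> {1..M}" and w: "w \<in> place_integers K" and lt: "N (of_nat t * (y / a) - w) < 1"
        using M[OF ya] by blast
      define r where "r = of_nat t * y - w * a"
      have "r \<in> I" unfolding r_def using I y a w O by (auto intro!: I subring_of_nat)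
      have "r = (of_nat t * (y / a) - w) * a" using a by (simp add: r_def field_simps)
      moreover have "of_nat t * (y / a) - w \<in> K"
        using ya place_integersD(1)[OF w] K by (metis number_fieldD(4,5,8))
      ultimately have "N r = N (of_nat t * (y / a) - w) * N a"
        using IK[OF a(1)] by (simp only: Nmult)
      also have "\<dots> < 1 * N a" using lt Npos[OF IK[OF a(1)] a(2)] by (intro mult_strict_right_mono)
      finally have "r = 0" using min[OF \<open>r \<in> I\<close>] by (cases "r = 0") auto
      then have ty: "of_nat t * y / a = w" using a by (simp add: r_def)
      obtain k where k: "fact M = t * k" using dvd_fact[of t M] t by auto
      have "of_nat (fact M) * y / a = of_nat k * w" unfolding k ty[symmetric] by simp
      also have "\<dots> \<in> place_integers K" by (intro subringD O subring_of_nat w)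
      finally show ?thesis .
    qed
    then show "\<exists>a\<in>I. a \<noteq> 0 \<and> (\<forall>y\<in>I. of_nat (fact M) * y / a \<in> place_integers K)" using a by blast
  qed
qed

section \<open>Elements that isolate one place\<close>

lemma finite_place_values:
  assumes K: "number_field K" and v: "place K v" and c: "c > 0"
  shows "finite {r. \<exists>y\<in>K. r = v y \<and> c \<le> r \<and> r \<le> 1}" (is "finite ?S")
proof -
  obtain B where B: "finite B" "K \<subseteq> qv.span B" using number_field_finite_span[OF K] .
  \<comment> \<open>Exponents have denominators up to \<open>card B\<close>, and \<open>?e\<close>
    clears them all: \<open>?e\<close>-th powers of values are integral powers of \<open>?p\<close>.
    The lower bound \<open>c\<close> leaves only finitely many of these up to 1.\<close>
  let ?p = "real (place_prime v)" and ?e = "fact (card B) :: nat"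
  have p: "?p \<ge> 2" using prime_ge_2_nat[OF prime_place_prime[OF K v]] by simp
  obtain J where J: "1 / c ^ ?e < 2 ^ J" using real_arch_pow[of 2] by auto
  have "(\<lambda>r. r ^ ?e) ` ?S \<subseteq> (\<lambda>j. inverse (?p ^ j)) ` {..J}"
  proof clarify
    fix y assume y: "y \<in> K" "c \<le> v y" "v y \<le> 1"
    have y0: "y \<noteq> 0" using y c place_0[OF K v] by auto
    obtain n k where n: "n \<in> {1..card B}" "v y ^ n = ?p powi k" using place_power_eq_powi[OF K v B y(1) y0] .
    obtain l where l: "?e = n * l" using dvd_fact[of n "card B"] n by auto
    have eq: "v y ^ ?e = ?p powi (k * int l)" unfolding l power_mult n(2) power_int_mult by simp
    have vy: "v y \<ge> 0" using place_nonneg[OF K v] .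
    have "k * int l \<le> 0"
    proof (rule ccontr)
      assume "\<not> k * int l \<le> 0"
      then have "1 < ?p powi (k * int l)" using p by (intro one_less_power_int) auto
      then show False using eq power_le_one[OF vy y(3), of ?e] by simp
    qed
    then obtain j where j: "k * int l = - int j" by (metis neg_0_le_iff_le minus_minus nonneg_int_cases)
    have pj: "v y ^ ?e = inverse (?p ^ j)" unfolding eq j by (simp add: power_int_minus)
    have "c ^ ?e \<le> inverse (?p ^ j)" unfolding pj[symmetric] using y c by (intro power_mono) auto
    then have "?p ^ j \<le> 1 / c ^ ?e" using c p by (simp add: field_simps)
    then have "?p ^ j < 2 ^ J" using J by simp
    moreover have "(2::real) ^ j \<le> ?p ^ j" using p by (intro power_mono) auto
    ultimately have "(2::real) ^ j < 2 ^ J" by linarith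
    then have "j \<le> J" by simp
    then show "v y ^ ?e \<in> (\<lambda>j. inverse (?p ^ j)) ` {..J}" unfolding pj by blast
  qed
  then have "finite ((\<lambda>r. r ^ ?e) ` ?S)" by (rule finite_subset) simp
  moreover have "inj_on (\<lambda>r. r ^ ?e) ?S"
    using place_nonneg[OF K v] by (intro inj_onI) (auto intro: power_eq_imp_eq_base)
  ultimately show ?thesis by (rule finite_imageD)
qed

text \<open>If \<open>x\<close> is large at \<open>v\<close> and small at the other places over the
  same prime, then \<open>inverse (1 + x)\<close> is small at \<open>v\<close> and a unit at the
  others. It is integral over that prime, so it has a denominator prime to it, which does not affect
  these values.\<close>

lemma integer_local_at_place:
  assumes K: "number_field K" and v: "place K v"
  obtains z where "z \<in> place_integers K" "z \<noteq> 0" "v z < 1"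
    "\<And>w. place K w \<Longrightarrow> w \<noteq> v \<Longrightarrow> place_prime w = place_prime v \<Longrightarrow> w z = 1"
proof -
  let ?p = "place_prime v"
  define W where "W = {w. place K w \<and> place_prime w = ?p} - {v}"
  have "finite W" unfolding W_def using finite_places_over_prime[OF K] by simp
  then have "\<exists>x\<in>K. v x > 1 \<and> (\<forall>w\<in>W. w x < 1)"
    by (rule separate_places[OF K v]) (simp add: W_def)
  then obtain x where x: "x \<in> K" "v x > 1" "\<And>w. w \<in> W \<Longrightarrow> w x < 1" by blast
  define y where "y = inverse (1 + x)"
  have x1: "1 + x \<in> K" using x K by (simp add: number_fieldD)
  have yK: "y \<in> K" unfolding y_def using x1 K by (simp add: number_fieldD)
  have "v (1 + x) = v x"
    using x K by (intro place_add_eq[OF K v]) (auto simp: number_fieldD place_1[OF K v])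
  then have vy: "v y = inverse (v x)" using x1 by (simp add: y_def place_inverse[OF K v])
  have wy: "w y = 1" if "w \<in> W" for w
  proof -
    have w: "place K w" using that by (simp add: W_def)
    have "w (x + 1) = w 1"
      using x(1) x(3)[OF that] K by (intro place_add_eq[OF K w]) (auto simp: number_fieldD place_1[OF K w])
    then show ?thesis using x1 by (simp add: y_def place_inverse[OF K w] place_1[OF K w] add.commute)
  qed
  have le: "w y \<le> 1" if "place K w" "place_prime w = ?p" for w
    using wy[of w] vy x(2) that by (cases "w = v") (auto simp: W_def inverse_le_1_iff)
  obtain D :: nat where D: "D > 0" "of_nat D * y \<in> place_integers K" "\<not> ?p dvd D"
    using exists_denominator[OF K yK] prime_place_prime[OF K v] le by metis
  have wD: "w (of_nat D * y) = w y" if "place K w" "place_prime w = ?p" for w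
    using place_of_nat_eq_1[OF K that(1), of D] D(3) that yK K by (simp add: place_mult[OF K that(1)] number_fieldD)
  have "v y \<noteq> 0" using vy x by simp
  then have "y \<noteq> 0" using place_0[OF K v] by auto
  show thesis
  proof (rule that[of "of_nat D * y"])
    show "of_nat D * y \<noteq> 0" using D \<open>y \<noteq> 0\<close> by simp
    show "v (of_nat D * y) < 1" using wD[OF v refl] vy x(2) by (simp add: inverse_less_1_iff)
    show "w (of_nat D * y) = 1" if "place K w" "w \<noteq> v" "place_prime w = place_prime v" for w
      using wD[OF that(1,3)] wy[of w] that by (simp add: W_def)
  qed (rule D)
qed

text \<open>The generators of the almost principal ideals of elements divisible by the \<open>n\<close>-th power of \<open>v\<close>
  can differ at places other than \<open>v\<close> only in finitely many ways, so two of them have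
  the wanted quotient. This replaces finiteness of the class group.\<close>

theorem exists_isolating_element:
  assumes K: "number_field K" and v: "place K v"
  obtains a where "a \<in> K" "a \<noteq> 0" "v a < 1" "\<And>w. place K w \<Longrightarrow> w \<noteq> v \<Longrightarrow> w a = 1"
proof -
  let ?p = "place_prime v" and ?O = "place_integers K"
  obtain z where z: "z \<in> ?O" "z \<noteq> 0" "v z < 1"
    and wz: "\<And>w. place K w \<Longrightarrow> w \<noteq> v \<Longrightarrow> place_prime w = ?p \<Longrightarrow> w z = 1"
    using integer_local_at_place[OF K v] by blast
  have zK: "z \<in> K" using z by (simp add: place_integers_def)
  note O = subring_place_integers[OF K]
  \<comment> \<open>With this \<open>r\<close>, the power of the residue prime with exponent
    \<open>r * n\<close> lies in the ideal \<open>I\<close> below. It is a unit over all other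
    primes, where \<open>z\<close> is not controlled.\<close>
  obtain r where r: "v (of_nat ?p) ^ r < v z"
    using real_arch_pow_inv[OF place_pos[OF K v zK z(2)], of "v (of_nat ?p)"]
      place_place_prime[OF K v] place_prime_gt_1[OF K v] by auto
  obtain M :: nat where M: "\<And>I. I \<subseteq> ?O \<Longrightarrow> (\<And>x y. x \<in> I \<Longrightarrow> y \<in> I \<Longrightarrow> x - y \<in> I) \<Longrightarrow>
      (\<And>r x. r \<in> ?O \<Longrightarrow> x \<in> I \<Longrightarrow> r * x \<in> I) \<Longrightarrow> \<exists>x\<in>I. x \<noteq> 0 \<Longrightarrow>
      \<exists>a\<in>I. a \<noteq> 0 \<and> (\<forall>y\<in>I. of_nat (fact M) * y / a \<in> ?O)"
    using ideals_almost_principal[OF K] by blast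
  define F where "F = (of_nat (fact M) :: complex)"
  have F: "F \<in> K" "F \<noteq> 0" using K by (auto simp: F_def number_fieldD simp del: of_nat_fact)
  have "\<exists>a\<in>K. a \<noteq> 0 \<and> v a \<le> v z ^ n \<and> (\<forall>w. place K w \<longrightarrow> w \<noteq> v \<longrightarrow> w F \<le> w a \<and> w a \<le> 1)" for n
  proof -
    define I where "I = {x\<in>?O. v x \<le> v z ^ n}"
    have IK: "x \<in> K" if "x \<in> I" for x using that by (simp add: I_def place_integers_def)
    have zI: "z ^ n \<in> I"
      using z zK O by (simp add: I_def subring_power place_power[OF K v])
    have pI: "of_nat ?p ^ (r * n) \<in> I"
    proof -
      have "v (of_nat ?p ^ (r * n)) = (v (of_nat ?p) ^ r) ^ n"
        using K by (simp add: place_power[OF K v] number_fieldD power_mult)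
      also have "\<dots> \<le> v z ^ n" using r place_nonneg[OF K v] by (intro power_mono) auto
      finally show ?thesis using O by (simp add: I_def subring_power subring_of_nat)
    qed
    have "\<exists>a\<in>I. a \<noteq> 0 \<and> (\<forall>y\<in>I. of_nat (fact M) * y / a \<in> ?O)"
    proof (rule M)
      fix x y assume x: "x \<in> I" and y: "y \<in> I"
      have "v (x + - y) \<le> max (v x) (v (- y))"
        using IK[OF x] IK[OF y] K by (intro place_add[OF K v]) (auto simp: number_fieldD)
      then show "x - y \<in> I" using x y IK[OF y] O by (auto simp: I_def subringD place_uminus[OF K v])
    next
      fix s x assume s: "s \<in> ?O" and x: "x \<in> I"
      have "v (s * x) = v s * v x" using place_integersD(1)[OF s] IK[OF x] by (simp add: place_mult[OF K v])
      also have "\<dots> \<le> 1 * v x" using place_integersD(2)[OF s v] place_nonneg[OF K v] by (intro mult_right_mono) auto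
      finally show "s * x \<in> I" using x s O by (auto simp: I_def subringD)
    qed (use zI z in \<open>auto simp: I_def intro!: bexI[of _ "z ^ n"]\<close>)
    then obtain a where a: "a \<in> I" "a \<noteq> 0" and aI: "\<And>y. y \<in> I \<Longrightarrow> F * y / a \<in> ?O" unfolding F_def by blast
    have "w F \<le> w a \<and> w a \<le> 1" if w: "place K w" "w \<noteq> v" for w
    proof
      show "w a \<le> 1" using a w by (simp add: I_def place_integers_def)
      \<comment> \<open>\<open>I\<close> contains a unit at \<open>w\<close>: the power of
        \<open>z\<close> if \<open>w\<close> lies over the same prime as \<open>v\<close>, and the
        power of that prime otherwise. So the almost generator \<open>a\<close> can deviate from a
        unit at \<open>w\<close> by at most \<open>F\<close>.\<close>
      obtain y where y: "y \<in> I" "w y = 1"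
      proof (cases "place_prime w = ?p")
        case True
        then show thesis using that[of "z ^ n"] zI wz[OF w True] zK by (simp add: place_power[OF K w(1)])
      next
        case False
        then have "\<not> place_prime w dvd ?p"
          using prime_place_prime[OF K w(1)] prime_place_prime[OF K v] primes_dvd_imp_eq by blast
        then have "w (of_nat ?p) = 1" by (rule place_of_nat_eq_1[OF K w(1)])
        then show thesis using that[of "of_nat ?p ^ (r * n)"] pI K by (simp add: place_power[OF K w(1)] number_fieldD)
      qed
      have "w (F * y / a) \<le> 1" using aI[OF y(1)] w by (simp add: place_integers_def)
      then have "w F / w a \<le> 1"
        using y IK[OF y(1)] IK[OF a(1)] F K by (simp add: place_divide[OF K w(1)] place_mult[OF K w(1)] number_fieldD)
      then show "w F \<le> w a" using place_pos[OF K w(1) IK[OF a(1)] a(2)] by (simp add: divide_le_eq)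
    qed
    then show ?thesis using a IK[OF a(1)] by (intro bexI[of _ a]) (auto simp: I_def)
  qed
  then have "\<forall>n. \<exists>a. a \<in> K \<and> a \<noteq> 0 \<and> v a \<le> v z ^ n \<and> (\<forall>w. place K w \<longrightarrow> w \<noteq> v \<longrightarrow> w F \<le> w a \<and> w a \<le> 1)"
    by blast
  from choice[OF this] obtain a where a: "\<And>n. a n \<in> K" "\<And>n. a n \<noteq> 0" "\<And>n. v (a n) \<le> v z ^ n"
    and wa: "\<And>n w. place K w \<Longrightarrow> w \<noteq> v \<Longrightarrow> w F \<le> w (a n) \<and> w (a n) \<le> 1" by blast
  \<comment> \<open>Away from \<open>W\<close> and \<open>v\<close> the bounds force
    \<open>w (a n) = 1\<close>. On the finite set \<open>W\<close> each \<open>w (a n)\<close> lies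
    in a finite set of values, so some pattern \<open>g n0\<close> recurs infinitely often.\<close>
  define W where "W = {w. place K w \<and> w F \<noteq> 1} - {v}"
  have W: "finite W" unfolding W_def using finite_places_neq_1[OF K F] by simp
  define g where "g = (\<lambda>n. restrict (\<lambda>w. w (a n)) W)"
  have "range g \<subseteq> PiE W (\<lambda>w. {r. \<exists>y\<in>K. r = w y \<and> w F \<le> r \<and> r \<le> 1})"
    unfolding g_def
  proof (intro image_subsetI restrict_PiE_iff[THEN iffD2] ballI CollectI)
    fix n w assume "w \<in> W"
    then show "\<exists>y\<in>K. w (a n) = w y \<and> w F \<le> w (a n) \<and> w (a n) \<le> 1"
      using wa[of w n] a(1) by (auto simp: W_def)
  qed
  moreover have "finite (PiE W (\<lambda>w. {r. \<exists>y\<in>K. r = w y \<and> w F \<le> r \<and> r \<le> 1}))"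
    using W F by (intro finite_PiE finite_place_values[OF K] place_pos[OF K]) (auto simp: W_def)
  ultimately have "finite (range g)" by (rule finite_subset)
  then obtain n0 where inf: "infinite {n. g n = g n0}"
    using pigeonhole_infinite[of UNIV g] by auto
  have "v (a n0) > 0" using place_pos[OF K v] a by blast
  \<comment> \<open>The recurring pattern has arbitrarily large indices, and beyond \<open>N\<close>
    the value at \<open>v\<close> has dropped strictly below \<open>v (a n0)\<close>; the quotient
    is then a nonunit at \<open>v\<close> alone.\<close>
  then obtain N where N: "v z ^ N < v (a n0)" using real_arch_pow_inv[OF _ z(3)] by blast
  obtain n1 where n1: "n1 \<ge> N" "g n1 = g n0"     using inf unfolding infinite_nat_iff_unbounded_le by blast
  show thesis
  proof (rule that[of "a n1 / a n0"])
    show "a n1 / a n0 \<in> K" using a K by (simp add: number_fieldD)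
    show "a n1 / a n0 \<noteq> 0" using a by simp
    have "v (a n1) \<le> v z ^ n1" by (rule a)
    also have "\<dots> \<le> v z ^ N" using n1 z place_nonneg[OF K v] by (intro power_decreasing) auto
    finally show "v (a n1 / a n0) < 1" using N a \<open>v (a n0) > 0\<close> by (simp add: place_divide[OF K v])
    fix w assume w: "place K w" "w \<noteq> v"
    have pos: "w (a n0) > 0" using place_pos[OF K w(1)] a by blast
    have "w (a n1) = w (a n0)"
    proof (cases "w \<in> W")
      case True
      then show ?thesis using fun_cong[OF n1(2), of w] by (simp add: g_def)
    next
      case False
      then have "w F = 1" using w by (simp add: W_def)
      then show ?thesis using wa[OF w, of n0] wa[OF w, of n1] by simp
    qed
    then show "w (a n1 / a n0) = 1" using pos a by (simp add: place_divide[OF K w(1)])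
  qed
qed

section \<open>The isomorphism\<close>

text \<open>Up to sign the additive valuation normalised to 1 at the residue prime. For nonzero
  elements of \<open>K\<close> it exists as a rational number because a positive power of
  \<open>v x\<close> is an integral power of that prime.\<close>

definition place_log :: "(complex \<Rightarrow> real) \<Rightarrow> complex \<Rightarrow> rat" where
  "place_log v x = (THE r. real_of_rat r = ln (v x) / ln (real (place_prime v)))"

context
  fixes K :: "complex set" and v :: "complex \<Rightarrow> real"
  assumes K: "number_field K" and v: "place K v"
begin

lemma of_rat_place_log:
  assumes x: "x \<in> K" "x \<noteq> 0"
  shows "real_of_rat (place_log v x) = ln (v x) / ln (real (place_prime v))"
proof -
  obtain B where B: "finite B" "K \<subseteq> qv.span B" using number_field_finite_span[OF K] .
  let ?p = "real (place_prime v)"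
  obtain n k where n: "n \<in> {1..card B}" "v x ^ n = ?p powi k" using place_power_eq_powi[OF K v B x] .
  have p: "?p > 1" using place_prime_gt_1[OF K v] .
  have "real n * ln (v x) = ln (v x ^ n)" using place_pos[OF K v x] by (simp add: ln_realpow)
  also have "\<dots> = real_of_int k * ln ?p"
    unfolding n(2) using p by (simp add: powr_real_of_int'[symmetric] ln_powr)
  finally have "ln (v x) / ln ?p = real_of_rat (of_int k / of_nat n)"
    using n(1) p by (simp add: of_rat_divide field_simps)
  then have "\<exists>!r. real_of_rat r = ln (v x) / ln ?p" by (auto simp: of_rat_eq_iff)
  then show ?thesis unfolding place_log_def by (rule theI')
qed

lemma place_log_eq_0_iff:
  assumes "x \<in> K" "x \<noteq> 0"
  shows "place_log v x = 0 \<longleftrightarrow> v x = 1"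
proof -
  have "place_log v x = 0 \<longleftrightarrow> real_of_rat (place_log v x) = 0" by simp
  then show ?thesis
    using of_rat_place_log[OF assms] place_pos[OF K v assms] place_prime_gt_1[OF K v] by (simp add: ln_eq_zero_iff)
qed

lemma place_log_mult:
  assumes "x \<in> K" "x \<noteq> 0" "y \<in> K" "y \<noteq> 0"
  shows "place_log v (x * y) = place_log v x + place_log v y"
proof -
  have "real_of_rat (place_log v (x * y)) = real_of_rat (place_log v x + place_log v y)"
    using assms K place_pos[OF K v, of x] place_pos[OF K v, of y]
    by (simp add: of_rat_place_log number_fieldD place_mult[OF K v] ln_mult of_rat_add add_divide_distrib)
  then show ?thesis by simp
qed

lemma place_log_powi:
  assumes "x \<in> K" "x \<noteq> 0"
  shows "place_log v (x powi k) = of_int k * place_log v x"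
proof -
  have "ln (v x powi k) = real_of_int k * ln (v x)"
    using place_pos[OF K v assms] by (simp add: powr_real_of_int'[symmetric] ln_powr)
  then have "real_of_rat (place_log v (x powi k)) = real_of_rat (of_int k * place_log v x)"
    using assms K by (simp add: of_rat_place_log number_fieldD place_powi[OF K v] of_rat_mult)
  then show ?thesis by simp
qed

lemma place_log_power: "x \<in> K \<Longrightarrow> x \<noteq> 0 \<Longrightarrow> place_log v (x ^ n) = of_nat n * place_log v x"
  using place_log_powi[of x "int n"] by simp

end

section \<open>\<open>Phi\<close> as a finite rational sum, and independence of the field\<close>

definition place_sum :: "(complex set \<times> (complex \<Rightarrow> real) \<Rightarrow> rat) \<Rightarrow> complex set \<Rightarrow> complex \<Rightarrow> rat" where
  "place_sum c K x = (\<Sum>v\<in>{v. place K v \<and> v x \<noteq> 1}. c (K, v) * place_log v x)"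

lemma place_sum_superset:
  assumes K: "number_field K" and x: "x \<in> K" "x \<noteq> 0"
    and T: "finite T" "\<And>v. v \<in> T \<Longrightarrow> place K v" "\<And>v. place K v \<Longrightarrow> v x \<noteq> 1 \<Longrightarrow> v \<in> T"
  shows "place_sum c K x = (\<Sum>v\<in>T. c (K, v) * place_log v x)"
  unfolding place_sum_def
proof (rule sum.mono_neutral_left)
  show "\<forall>v\<in>T - {v. place K v \<and> v x \<noteq> 1}. c (K, v) * place_log v x = 0"
    using place_log_eq_0_iff[OF K _ x] T(2) by auto
qed (use T in auto)

text \<open>The chosen field depends on \<open>x\<close> only, not on \<open>c\<close>. This gives
  linearity of \<open>Phi\<close> in \<open>c\<close> before any appeal to consistency.\<close>

lemma Phi_eq_place_sum_some:
  assumes x: "nz_alg x"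
  obtains K where "number_field K" "x \<in> K" "\<And>c. Phi c x = place_sum c K x"
proof -
  define K where "K = (SOME K. number_field K \<and> x \<in> K)"
  have "algebraic x" "x \<noteq> 0" using x by (auto simp: nz_alg_def)
  then have "\<exists>K. number_field K \<and> x \<in> K" using algebraic_pair_number_field by metis
  then have K: "number_field K" "x \<in> K" unfolding K_def by (metis (mono_tags, lifting) someI_ex)+
  have "Phi c x = place_sum c K x" for c
  proof -
    have "Phi_real c x = real_of_rat (place_sum c K x)"
      unfolding Phi_real_def K_def[symmetric] Let_def place_sum_def of_rat_sum
      using \<open>x \<noteq> 0\<close> K by (intro sum.cong) (auto simp: of_rat_mult of_rat_place_log)
    then show ?thesis using x by (auto simp: Phi_def of_rat_eq_iff)
  qed
  then show thesis using that K by blast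
qed

lemma place_prime_cong:
  assumes "number_field K" "\<And>x. x \<in> K \<Longrightarrow> w x = v x"
  shows "place_prime w = place_prime v"
  unfolding place_prime_def using assms by (simp add: number_fieldD)

lemma place_log_cong:
  assumes "number_field K" "\<And>x. x \<in> K \<Longrightarrow> w x = v x" "x \<in> K"
  shows "place_log w x = place_log v x"
  unfolding place_log_def using place_prime_cong[OF assms(1,2)] assms(2,3) by simp

text \<open>Group the places of \<open>L\<close> by their restriction to \<open>K\<close>: on each
  fibre the logarithm of \<open>x\<close> is constant, and consistency sums the
  coefficients.\<close>

lemma place_sum_extend:
  assumes c: "consistent c" and K: "number_field K" and L: "number_field L" and KL: "K \<subseteq> L"
    and x: "x \<in> K" "x \<noteq> 0"
  shows "place_sum c L x = place_sum c K x"
proof -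
  let ?S = "{w. place L w \<and> w x \<noteq> 1}" and ?T = "{v. place K v \<and> v x \<noteq> 1}"
  define g where "g = (\<lambda>(w :: complex \<Rightarrow> real) y. if y \<in> K then w y else 0)"
  have "g ` ?S \<subseteq> ?T" using place_restrict[OF K L KL] x by (auto simp: g_def)
  then have "place_sum c L x = (\<Sum>v\<in>?T. \<Sum>w\<in>{w\<in>?S. g w = v}. c (L, w) * place_log w x)"
    unfolding place_sum_def using finite_places_neq_1[OF K x] finite_places_neq_1[OF L _ x(2)] x KL
    by (intro sum.group[symmetric]) auto
  also have "\<dots> = (\<Sum>v\<in>?T. c (K, v) * place_log v x)"
  proof (rule sum.cong[OF refl])
    fix v assume v: "v \<in> ?T"
    have eq: "{w\<in>?S. g w = v} = {w. place L w \<and> (\<forall>y\<in>K. w y = v y)}"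
    proof (intro Collect_cong iffI conjI)
      fix w assume w: "place L w \<and> (\<forall>y\<in>K. w y = v y)"
      then show "w \<in> ?S" using v x by auto
      have "v y = 0" if "y \<notin> K" for y using v that by (auto simp: place_def)
      then show "g w = v" using w by (auto simp: g_def)
    qed (auto simp: g_def)
    have "(\<Sum>w\<in>{w\<in>?S. g w = v}. c (L, w) * place_log w x)
        = (\<Sum>w\<in>{w. place L w \<and> (\<forall>y\<in>K. w y = v y)}. c (L, w) * place_log v x)"
      unfolding eq
    proof (rule sum.cong)
      fix w assume "w \<in> {w. place L w \<and> (\<forall>y\<in>K. w y = v y)}"
      then have "place_log w x = place_log v x" by (intro place_log_cong[OF K _ x(1)]) simp
      then show "c (L, w) * place_log w x = c (L, w) * place_log v x" by simp
    qed simp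
    also have "\<dots> = c (K, v) * place_log v x"
    proof -
      have "number_field K \<and> number_field L \<and> K \<subseteq> L \<and> place K v" using K L KL v by simp
      then have "c (K, v) = (\<Sum>w\<in>{w. place L w \<and> (\<forall>y\<in>K. w y = v y)}. c (L, w))"
        using c unfolding consistent_def by blast
      then show ?thesis by (simp add: sum_distrib_right)
    qed
    finally show "(\<Sum>w\<in>{w\<in>?S. g w = v}. c (L, w) * place_log w x) = c (K, v) * place_log v x" .
  qed
  finally show ?thesis by (simp add: place_sum_def)
qed

lemma number_field_Int: "number_field K \<Longrightarrow> number_field L \<Longrightarrow> number_field (K \<inter> L)"
proof -
  assume K: "number_field K" and L: "number_field L"
  obtain n and b :: "nat \<Rightarrow> complex" where "K \<subseteq> {\<Sum>i<n. of_rat (q i) * b i | q. True}"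
    using K unfolding number_field_def by auto
  then have "\<exists>n (b :: nat \<Rightarrow> complex). K \<inter> L \<subseteq> {\<Sum>i<n. of_rat (q i) * b i | q. True}" by blast
  then show ?thesis unfolding number_field_def using number_fieldD[OF K] number_fieldD[OF L] by simp
qed

lemma number_field_nz_alg: "number_field K \<Longrightarrow> x \<in> K \<Longrightarrow> x \<noteq> 0 \<Longrightarrow> nz_alg x"
  by (simp add: nz_alg_def number_field_algebraic)

text \<open>The arbitrarily chosen field and \<open>L\<close> both extend their intersection, which
  contains \<open>x\<close>; this avoids constructing a compositum.\<close>

lemma Phi_eq_place_sum:
  assumes c: "consistent c" and L: "number_field L" and x: "x \<in> L" "x \<noteq> 0"
  shows "Phi c x = place_sum c L x"
proof -
  obtain K where K: "number_field K" "x \<in> K" "Phi c x = place_sum c K x"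
    using Phi_eq_place_sum_some[OF number_field_nz_alg[OF L x]] by metis
  note KL = number_field_Int[OF K(1) L]
  have "place_sum c K x = place_sum c (K \<inter> L) x"
    by (rule place_sum_extend[OF c KL K(1)]) (use K x in auto)
  also have "\<dots> = place_sum c L x"
    by (rule place_sum_extend[OF c KL L, symmetric]) (use K x in auto)
  finally show ?thesis using K by simp
qed

lemma nz_alg_pair_number_field:
  assumes "nz_alg x" "nz_alg y"
  obtains K where "number_field K" "x \<in> K" "y \<in> K" "x \<noteq> 0" "y \<noteq> 0"
proof -
  have x: "algebraic x" "x \<noteq> 0" and y: "algebraic y" "y \<noteq> 0" using assms by (auto simp: nz_alg_def)
  obtain K where "number_field K" "x \<in> K" "y \<in> K" using algebraic_pair_number_field[OF x(1) y(1)] .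
  then show thesis using that x y by blast
qed

text \<open>Both integrality criteria, applied to \<open>u\<close> and to \<open>1 / u\<close>. This
  is how the quotient by units becomes visible at the places.\<close>

lemma alg_unit_iff_places:
  assumes K: "number_field K" and u: "u \<in> K" "u \<noteq> 0"
  shows "alg_unit u \<longleftrightarrow> (\<forall>v. place K v \<longrightarrow> v u = 1)"
proof
  have iu: "1 / u \<in> K" using K u by (simp add: number_fieldD)
  {
    assume a: "alg_unit u"
    show "\<forall>v. place K v \<longrightarrow> v u = 1"
    proof (intro allI impI)
      fix v assume v: "place K v"
      have "v u \<le> 1" "v (1 / u) \<le> 1"
        using a alg_int_place_le_1[OF K v] u iu by (auto simp: alg_unit_def)
      then show "v u = 1"
        using place_pos[OF K v u] K u by (simp add: place_divide[OF K v] place_1[OF K v] number_fieldD divide_le_eq)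
    qed
  next
    assume a: "\<forall>v. place K v \<longrightarrow> v u = 1"
    have "v (1 / u) \<le> 1" if "place K v" for v
      using a[rule_format, OF that] K u by (simp add: place_divide[OF K that] place_1[OF K that] number_fieldD)
    then have "alg_int (1 / u)" by (rule alg_int_if_places_le_1[OF K iu])
    moreover have "alg_int u" by (rule alg_int_if_places_le_1[OF K u(1)]) (simp add: a)
    ultimately show "alg_unit u" using u by (simp add: alg_unit_def)
  }
qed

lemma Phi_in_Sstar:
  assumes c: "consistent c"
  shows "Phi c \<in> Sstar"
  unfolding Sstar_def
proof (intro CollectI conjI allI impI)
  show "Phi c x = 0" if "\<not> nz_alg x" for x using that by (simp add: Phi_def)
next
  fix u assume u: "alg_unit u"
  then obtain p where p: "lead_coeff p = 1" "\<forall>i. coeff p i \<in> \<int>" "poly p u = 0"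
    unfolding alg_unit_def alg_int_def by blast
  then have "p \<noteq> 0" by auto
  then have "nz_alg u" using u p unfolding nz_alg_def algebraic_def alg_unit_def by blast
  then obtain K where K: "number_field K" "u \<in> K" "u \<noteq> 0" using nz_alg_pair_number_field by metis
  then have "{v. place K v \<and> v u \<noteq> 1} = {}" using u alg_unit_iff_places[OF K] by auto
  then show "Phi c u = 0" unfolding Phi_eq_place_sum[OF c K] place_sum_def by (simp only: sum.empty)
next
  fix x y assume "nz_alg x \<and> nz_alg y"
  then obtain K where K: "number_field K" and x: "x \<in> K" "x \<noteq> 0" and y: "y \<in> K" "y \<noteq> 0"
    using nz_alg_pair_number_field by metis
  have xy: "x * y \<in> K" "x * y \<noteq> 0" using K x y by (auto simp: number_fieldD)
  let ?T = "{v. place K v \<and> v x \<noteq> 1} \<union> {v. place K v \<and> v y \<noteq> 1}"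
  have T: "finite ?T" using finite_places_neq_1[OF K] x y by simp
  have "Phi c (x * y) = (\<Sum>v\<in>?T. c (K, v) * place_log v (x * y))"
    unfolding Phi_eq_place_sum[OF c K xy] using T
    by (intro place_sum_superset[OF K xy]) (auto simp: place_mult[OF K] x y)
  also have "\<dots> = (\<Sum>v\<in>?T. c (K, v) * place_log v x) + (\<Sum>v\<in>?T. c (K, v) * place_log v y)"
    unfolding sum.distrib[symmetric]
    by (rule sum.cong) (auto simp: place_log_mult[OF K _ x y] distrib_left)
  also have "(\<Sum>v\<in>?T. c (K, v) * place_log v x) = Phi c x"
    unfolding Phi_eq_place_sum[OF c K x] using T by (intro place_sum_superset[OF K x, symmetric]) auto
  also have "(\<Sum>v\<in>?T. c (K, v) * place_log v y) = Phi c y"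
    unfolding Phi_eq_place_sum[OF c K y] using T by (intro place_sum_superset[OF K y, symmetric]) auto
  finally show "Phi c (x * y) = Phi c x + Phi c y" .
next
  fix x y :: complex and m :: int and n :: nat
  assume a: "nz_alg x \<and> nz_alg y \<and> n > 0 \<and> y ^ n = x powi m"
  then obtain K where K: "number_field K" and x: "x \<in> K" "x \<noteq> 0" and y: "y \<in> K" "y \<noteq> 0"
    using nz_alg_pair_number_field by metis
  let ?T = "{v. place K v \<and> v x \<noteq> 1} \<union> {v. place K v \<and> v y \<noteq> 1}"
  have T: "finite ?T" using finite_places_neq_1[OF K] x y by simp
  have l: "place_log v y = of_int m / of_nat n * place_log v x" if v: "place K v" for v
  proof -
    have "of_nat n * place_log v y = of_int m * place_log v x"
      using a place_log_power[OF K v y, of n] place_log_powi[OF K v x, of m] by simp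
    then show ?thesis using a by (simp add: field_simps)
  qed
  have "Phi c y = (\<Sum>v\<in>?T. c (K, v) * place_log v y)"
    unfolding Phi_eq_place_sum[OF c K y] using T by (intro place_sum_superset[OF K y]) auto
  also have "\<dots> = of_int m / of_nat n * (\<Sum>v\<in>?T. c (K, v) * place_log v x)"
    unfolding sum_distrib_left by (rule sum.cong) (auto simp: l)
  also have "(\<Sum>v\<in>?T. c (K, v) * place_log v x) = Phi c x"
    unfolding Phi_eq_place_sum[OF c K x] using T by (intro place_sum_superset[OF K x, symmetric]) auto
  finally show "Phi c y = of_int m / of_nat n * Phi c x" .
qed

section \<open>Recovering a consistent map from a functional\<close>

definition isolates :: "complex set \<Rightarrow> (complex \<Rightarrow> real) \<Rightarrow> complex \<Rightarrow> bool" where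
  "isolates K v a \<longleftrightarrow> a \<in> K \<and> a \<noteq> 0 \<and> v a < 1 \<and> (\<forall>w. place K w \<longrightarrow> w \<noteq> v \<longrightarrow> w a = 1)"

lemma isolates_places: "place K v \<Longrightarrow> isolates K v a \<Longrightarrow> {w. place K w \<and> w a \<noteq> 1} = {v}"
  unfolding isolates_def by auto

lemma Phi_isolates:
  assumes c: "consistent c" and K: "number_field K" and v: "place K v" and a: "isolates K v a"
  shows "Phi c a = c (K, v) * place_log v a" "place_log v a \<noteq> 0"
proof -
  have aK: "a \<in> K" "a \<noteq> 0" "v a \<noteq> 1" using a by (auto simp: isolates_def)
  show "Phi c a = c (K, v) * place_log v a"
    unfolding Phi_eq_place_sum[OF c K aK(1,2)] place_sum_def isolates_places[OF v a] by simp
  show "place_log v a \<noteq> 0" using place_log_eq_0_iff[OF K v aK(1,2)] aK(3) by simp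
qed

definition isolating :: "complex set \<Rightarrow> (complex \<Rightarrow> real) \<Rightarrow> complex" where
  "isolating K v = (SOME a. isolates K v a)"

lemma isolates_isolating:
  assumes "number_field K" "place K v"
  shows "isolates K v (isolating K v)"
proof -
  have "\<exists>a. isolates K v a" using exists_isolating_element[OF assms] unfolding isolates_def by metis
  then show ?thesis unfolding isolating_def by (rule someI_ex)
qed

text \<open>The only candidate: for consistent \<open>c\<close> the sum for \<open>Phi c\<close> at
  an isolating element has the single term \<open>c (K, v) * place_log v a\<close>. The value 0 off
  \<open>J\<close> is the convention of \<open>Jstar\<close>.\<close>

definition dual_coeff :: "(complex \<Rightarrow> rat) \<Rightarrow> complex set \<times> (complex \<Rightarrow> real) \<Rightarrow> rat" where
  "dual_coeff \<phi> = (\<lambda>(K, v). if (K, v) \<in> J then \<phi> (isolating K v) / place_log v (isolating K v) else 0)"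

context
  fixes \<phi> :: "complex \<Rightarrow> rat"
  assumes \<phi>: "\<phi> \<in> Sstar"
begin

lemma Sstar_unit: "alg_unit u \<Longrightarrow> \<phi> u = 0"
  using \<phi> by (simp add: Sstar_def)

lemma Sstar_mult: "nz_alg x \<Longrightarrow> nz_alg y \<Longrightarrow> \<phi> (x * y) = \<phi> x + \<phi> y"
  using \<phi> by (simp add: Sstar_def)

lemma Sstar_powi:
  assumes "nz_alg x" "nz_alg (x powi m)"
  shows "\<phi> (x powi m) = of_int m * \<phi> x"
proof -
  have "\<forall>\<alpha> \<beta> (m :: int) (n :: nat). nz_alg \<alpha> \<and> nz_alg \<beta> \<and> n > 0 \<and> \<beta> ^ n = \<alpha> powi m \<longrightarrow>
        \<phi> \<beta> = of_int m / of_nat n * \<phi> \<alpha>" using \<phi> by (simp add: Sstar_def)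
  from this[rule_format, of x "x powi m" 1 m] show ?thesis using assms by simp
qed

text \<open>Induction on the number of places where \<open>x\<close> is not a unit: suitable powers of \<open>x\<close> and of the
  isolating element at \<open>v\<close> have a quotient that is a unit at \<open>v\<close> and unchanged up to scaling elsewhere.\<close>

lemma Sstar_eq_place_sum:
  assumes K: "number_field K" and x: "x \<in> K" "x \<noteq> 0"
  shows "\<phi> x = place_sum (dual_coeff \<phi>) K x"
proof -
  \<comment> \<open>The claim is quantified over \<open>x\<close> because the induction step passes
    to a different element.\<close>
  have "\<forall>x. x \<in> K \<longrightarrow> x \<noteq> 0 \<longrightarrow> {v. place K v \<and> v x \<noteq> 1} = W \<longrightarrow> \<phi> x = place_sum (dual_coeff \<phi>) K x"
    if "finite W" for W
    using that
  proof (induction W rule: finite_induct)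
    case empty
    show ?case
    proof (intro allI impI)
      fix x assume x: "x \<in> K" "x \<noteq> 0" and W: "{v. place K v \<and> v x \<noteq> 1} = {}"
      then have "alg_unit x" using alg_unit_iff_places[OF K x] by blast
      then show "\<phi> x = place_sum (dual_coeff \<phi>) K x" unfolding place_sum_def W by (simp add: Sstar_unit)
    qed
  next
    case (insert v W)
    show ?case
    proof (intro allI impI)
      fix x assume x: "x \<in> K" "x \<noteq> 0" and W: "{v. place K v \<and> v x \<noteq> 1} = insert v W"
      have v: "place K v" "v x \<noteq> 1" using W by auto
      define a where "a = isolating K v"
      have "isolates K v a" unfolding a_def by (rule isolates_isolating[OF K v(1)])
      then have a: "a \<in> K" "a \<noteq> 0" "v a < 1" "\<And>w. place K w \<Longrightarrow> w \<noteq> v \<Longrightarrow> w a = 1"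
        by (auto simp: isolates_def)
      have la: "place_log v a \<noteq> 0" using place_log_eq_0_iff[OF K v(1) a(1,2)] a(3) by simp
      \<comment> \<open>Here rationality of the logarithms is decisive: with \<open>m / n\<close>
        the exact ratio at \<open>v\<close>, the element \<open>x powi n * a powi (- m)\<close>
        becomes a unit at \<open>v\<close>.\<close>
      obtain m n where mn: "quotient_of (place_log v x / place_log v a) = (m, n)" by force
      have n: "n > 0" and q: "place_log v x / place_log v a = of_int m / of_int n"
        using quotient_of_denom_pos[OF mn] quotient_of_div[OF mn] by auto
      have q': "of_int n * place_log v x = of_int m * place_log v a"
        using q n la by (simp add: field_simps)
      define y where "y = x powi n * a powi (- m)"
      have pK: "x powi n \<in> K" "x powi n \<noteq> 0" "a powi (- m) \<in> K" "a powi (- m) \<noteq> 0"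
        using K x a by (auto simp: number_fieldD)
      have y: "y \<in> K" "y \<noteq> 0" unfolding y_def using K pK by (auto simp: number_fieldD)
      have ly: "place_log w y = of_int n * place_log w x - of_int m * place_log w a" if "place K w" for w
        unfolding y_def place_log_mult[OF K that pK] place_log_powi[OF K that x] place_log_powi[OF K that a(1,2)] by simp
      have ly': "place_log w y = of_int n * place_log w x" if "place K w" "w \<noteq> v" for w
        using ly[OF that(1)] place_log_eq_0_iff[OF K that(1) a(1,2)] a(4)[OF that] by simp
      have "v y = 1" using place_log_eq_0_iff[OF K v(1) y] ly[OF v(1)] q' by simp
      moreover have "w y \<noteq> 1 \<longleftrightarrow> w x \<noteq> 1" if "place K w" "w \<noteq> v" for w
        using place_log_eq_0_iff[OF K that(1) y] place_log_eq_0_iff[OF K that(1) x] ly'[OF that] n by auto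
      ultimately have "{w. place K w \<and> w y \<noteq> 1} = {w. place K w \<and> w x \<noteq> 1} - {v}" by auto
      then have Wy: "{w. place K w \<and> w y \<noteq> 1} = W" using W insert.hyps(2) by simp
      then have "\<phi> y = place_sum (dual_coeff \<phi>) K y" using insert.IH y by blast
      also have "\<dots> = of_int n * (\<Sum>w\<in>W. dual_coeff \<phi> (K, w) * place_log w x)"
        unfolding place_sum_def Wy sum_distrib_left
      proof (rule sum.cong)
        fix w assume "w \<in> W"
        then have "place K w" "w \<noteq> v" using W insert.hyps(2) by auto
        then show "dual_coeff \<phi> (K, w) * place_log w y = of_int n * (dual_coeff \<phi> (K, w) * place_log w x)"
          using ly'[of w] by simp
      qed simp
      finally have 1: "\<phi> y = of_int n * (\<Sum>w\<in>W. dual_coeff \<phi> (K, w) * place_log w x)" .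
      have "\<phi> y = of_int n * \<phi> x - of_int m * \<phi> a"
        unfolding y_def using Sstar_mult[of "x powi n" "a powi (- m)"] Sstar_powi[of x n] Sstar_powi[of a "- m"]
          number_field_nz_alg[OF K] pK x a(1,2) by simp
      moreover have "of_int m * \<phi> a = of_int n * (dual_coeff \<phi> (K, v) * place_log v x)"
        using la q' v K by (simp add: dual_coeff_def J_def a_def[symmetric] field_simps)
      ultimately have "of_int n * \<phi> x = of_int n *
          (dual_coeff \<phi> (K, v) * place_log v x + (\<Sum>w\<in>W. dual_coeff \<phi> (K, w) * place_log w x))"
        using 1 by (simp add: distrib_left)
      then have "\<phi> x = dual_coeff \<phi> (K, v) * place_log v x + (\<Sum>w\<in>W. dual_coeff \<phi> (K, w) * place_log w x)"
        using n by (simp only: mult_cancel_left) simp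
      then show "\<phi> x = place_sum (dual_coeff \<phi>) K x"
        unfolding place_sum_def W using insert.hyps by simp
    qed
  qed
  then show ?thesis using finite_places_neq_1[OF K x] x by blast
qed

text \<open>Evaluate \<phi> at an element \<open>a\<close> isolating \<open>v\<close> in
  \<open>K\<close>, but with the sum over places of \<open>L\<close>. A place of \<open>L\<close>
  where \<open>a\<close> is not a unit restricts to a place of \<open>K\<close> with the same
  property, hence to \<open>v\<close>, so the sum runs exactly over the places above
  \<open>v\<close>. All its logarithms equal \<open>place_log v a\<close>, which is nonzero and can
  be cancelled.\<close>

lemma consistent_dual_coeff: "consistent (dual_coeff \<phi>)"
  unfolding consistent_def
proof (intro allI impI)
  fix K L v assume a: "number_field K \<and> number_field L \<and> K \<subseteq> L \<and> place K v"
  then have K: "number_field K" and L: "number_field L" and KL: "K \<subseteq> L" and v: "place K v" by auto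
  define a where "a = isolating K v"
  have iso: "isolates K v a" unfolding a_def by (rule isolates_isolating[OF K v])
  then have a: "a \<in> K" "a \<noteq> 0" "v a < 1" by (auto simp: isolates_def)
  have la: "place_log v a \<noteq> 0" using place_log_eq_0_iff[OF K v a(1,2)] a(3) by simp
  have aL: "a \<in> L" using a KL by blast
  have eq: "{w. place L w \<and> w a \<noteq> 1} = {w. place L w \<and> (\<forall>x\<in>K. w x = v x)}"
  proof (intro Collect_cong conj_cong refl iffI)
    fix w assume w: "place L w" "w a \<noteq> 1"
    let ?u = "\<lambda>x. if x \<in> K then w x else 0"
    have "place K ?u" by (rule place_restrict[OF K L KL w(1)])
    moreover have "?u a \<noteq> 1" using w a by simp
    ultimately have "?u = v" using iso unfolding isolates_def by blast
    from fun_cong[OF this] have "(if x \<in> K then w x else 0) = v x" for x .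
    then have "w x = v x" if "x \<in> K" for x using that by metis
    then show "\<forall>x\<in>K. w x = v x" by blast
  qed (use a in auto)
  have "\<phi> a = (\<Sum>w\<in>{w. place L w \<and> (\<forall>x\<in>K. w x = v x)}. dual_coeff \<phi> (L, w) * place_log w a)"
    unfolding Sstar_eq_place_sum[OF L aL a(2)] place_sum_def eq ..
  also have "\<dots> = (\<Sum>w\<in>{w. place L w \<and> (\<forall>x\<in>K. w x = v x)}. dual_coeff \<phi> (L, w)) * place_log v a"
    unfolding sum_distrib_right
  proof (rule sum.cong)
    fix w assume "w \<in> {w. place L w \<and> (\<forall>x\<in>K. w x = v x)}"
    then have "place_log w a = place_log v a" by (intro place_log_cong[OF K _ a(1)]) simp
    then show "dual_coeff \<phi> (L, w) * place_log w a = dual_coeff \<phi> (L, w) * place_log v a" by simp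
  qed simp
  finally show "dual_coeff \<phi> (K, v) = (\<Sum>w\<in>{w. place L w \<and> (\<forall>x\<in>K. w x = v x)}. dual_coeff \<phi> (L, w))"
    using la K v by (simp add: dual_coeff_def[of \<phi>, THEN fun_cong, of "(K, v)"] J_def a_def[symmetric])
qed

lemma Phi_dual_coeff: "Phi (dual_coeff \<phi>) = \<phi>"
proof
  fix x
  show "Phi (dual_coeff \<phi>) x = \<phi> x"
  proof (cases "nz_alg x")
    case True
    then obtain K where K: "number_field K" "x \<in> K" "x \<noteq> 0" using nz_alg_pair_number_field by metis
    then show ?thesis
      using Phi_eq_place_sum[OF consistent_dual_coeff K] Sstar_eq_place_sum[OF K] by simp
  next
    case False
    then show ?thesis using \<phi> by (simp add: Phi_def Sstar_def)
  qed
qed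

lemma dual_coeff_in_Jstar: "dual_coeff \<phi> \<in> Jstar"
  using consistent_dual_coeff by (auto simp: Jstar_def dual_coeff_def)

end

section \<open>Injectivity, linearity and the isomorphism\<close>

lemma inj_on_Phi: "inj_on Phi Jstar"
proof (rule inj_onI, rule ext)
  fix c d x assume c: "c \<in> Jstar" and d: "d \<in> Jstar" and eq: "Phi c = Phi d"
  show "c x = d x"
  proof (cases "x \<in> J")
    case True
    then obtain K v where x: "x = (K, v)" and K: "number_field K" and v: "place K v" by (auto simp: J_def)
    have "consistent c" "consistent d" using c d by (auto simp: Jstar_def)
    note iso = isolates_isolating[OF K v]
    have "c (K, v) * place_log v (isolating K v) = d (K, v) * place_log v (isolating K v)"
      using Phi_isolates(1)[OF \<open>consistent c\<close> K v iso] Phi_isolates(1)[OF \<open>consistent d\<close> K v iso] eq by metis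
    then show ?thesis using Phi_isolates(2)[OF \<open>consistent c\<close> K v iso] x by simp
  next
    case False
    then have "c x = 0" "d x = 0" using c d unfolding Jstar_def by blast+
    then show ?thesis by simp
  qed
qed

lemma Phi_add: "Phi (\<lambda>x. c x + d x) = (\<lambda>\<alpha>. Phi c \<alpha> + Phi d \<alpha>)"
proof
  fix x
  show "Phi (\<lambda>x. c x + d x) x = Phi c x + Phi d x"
  proof (cases "nz_alg x")
    case True
    then obtain K where "\<And>c. Phi c x = place_sum c K x" using Phi_eq_place_sum_some by metis
    then show ?thesis by (simp add: place_sum_def distrib_right sum.distrib)
  qed (simp add: Phi_def)
qed

lemma Phi_scale: "Phi (\<lambda>x. r * c x) = (\<lambda>\<alpha>. r * Phi c \<alpha>)"
proof
  fix x
  show "Phi (\<lambda>x. r * c x) x = r * Phi c x"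
  proof (cases "nz_alg x")
    case True
    then obtain K where "\<And>c. Phi c x = place_sum c K x" using Phi_eq_place_sum_some by metis
    then show ?thesis by (simp add: place_sum_def sum_distrib_left mult.assoc)
  qed (simp add: Phi_def)
qed

theorem theorem1p1:
  shows "(\<forall>c\<in>Jstar. \<forall>d\<in>Jstar. Phi (\<lambda>x. c x + d x) = (\<lambda>\<alpha>. Phi c \<alpha> + Phi d \<alpha>))
       \<and> (\<forall>c\<in>Jstar. \<forall>r :: rat. Phi (\<lambda>x. r * c x) = (\<lambda>\<alpha>. r * Phi c \<alpha>))
       \<and> bij_betw Phi Jstar Sstar"
proof (intro conjI ballI allI)
  have "Phi ` Jstar = Sstar"
  proof
    show "Phi ` Jstar \<subseteq> Sstar" using Phi_in_Sstar by (auto simp: Jstar_def)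
    show "Sstar \<subseteq> Phi ` Jstar"
    proof
      fix \<phi> assume "\<phi> \<in> Sstar"
      then show "\<phi> \<in> Phi ` Jstar" using Phi_dual_coeff dual_coeff_in_Jstar by (intro image_eqI[of _ _ "dual_coeff \<phi>"]) auto
    qed
  qed
  then show "bij_betw Phi Jstar Sstar" using inj_on_Phi by (simp add: bij_betw_def)
qed (simp_all only: Phi_add Phi_scale)

end
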